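(* Let $K$ be an imaginary quadratic field of class number $1$, $E/K$ an elliptic curve with a $K$-rational point of order $2$ and odd conductor, $D={\mathcal{D}}_{\min}(E)$, and let $a,b,\tau_a$ be as in the context. Set (i) $P=\gcd(D,b,a^2-4b)=As^2$ with $A$ square-free; (ii) $B=(a^2-4b)/(\tau_a^2P)$; (iii) $C=4b/(\tau_a^2P)$; (iv) $\tilde a=as/(\tau_aP)$. Then $\tilde a^2A=B+C$, and $\tilde a,A,B,C\in\mathcal{O}_K$ satisfy: (1) $\gcd(B,C)=1$ and $A$ is square-free; (2) $A,B,C$ are divisible only by primes dividing $2D$. Furthermore: (a) for each prime $\mathfrak{p}\mid D$, with $k=v_{\mathfrak{p}}(D)$ and $k'=k-6$, the triple $(v_{\mathfrak{p}}(A),v_{\mathfrak{p}}(B),v_{\mathfrak{p}}(C))$ is one of $(0,k,0)$, $(0,k',0)$, $(0,0,\tfrac12k)$, $(0,0,\tfrac12k')$, $(1,0,0)$; (b) for each prime $\mathfrak{q}\mid2$ at which $E$ is ordinary, $(v_{\mathfrak{q}}(A),v_{\mathfrak{q}}(B),v_{\mathfrak{q}}(C))$ is $(0,6e_2,0)$ or $(0,0,6e_2)$; (c) for a prime $\mathfrak{q}\mid2$ at which $E$ is supersingular, $(v_{\mathfrak{q}}(A),v_{\mathfrak{q}}(B),v_{\mathfrak{q}}(C))=(0,0,0)$. Conversely, let $D\in\mathcal{O}_K$ be odd and nonzero, and let $A,B,C,\tilde a\in\mathcal{O}_K$ satisfy $\tilde a^2A=B+C$ together with conditions (1) and (2). Set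 $a=2A\tilde a/\gcd(2,C)$ and $b=AC/\gcd(2,C)^2$. Then $E_{a,b}$ and its twists $E_{sa,s^2b}$, for all square-free $s\in\mathcal{O}_K$ dividing $D$, have good reduction at all primes not dividing $2D$.
   Context: $K$ is one of $\mathbb{Q}(\sqrt{-d})$, $d\in\{1,2,3,7,11,19,43,67,163\}$; $e_2$ is the ramification index of $2$ in $K/\mathbb{Q}$; $v_{\mathfrak{p}}$ is the $\mathfrak{p}$-adic valuation; odd means coprime to $2$; gcds are taken in $\mathcal{O}_K$ (defined up to units). For $a,b\in\mathcal{O}_K$, $E_{a,b}$ denotes $y^2=x(x^2+ax+b)$. Construction of $a,b$: take a global minimal model $y^2+a_1xy+a_3y=x^3+a_2x^2+a_4x+a_6$ of $E$ (its discriminant $D$ is odd). Completing the square gives $y^2=f(x)$ with $f(x)=x^3+(a_2+a_1^2/4)x^2+(a_4+a_1a_3/2)x+(a_6+a_3^2/4)$. For each prime $\mathfrak{q}=(\tau_{\mathfrak{q}})$ above $2$ let $m_{\mathfrak{q}}$ be the least $m\ge0$ such that $\tau_{\mathfrak{q}}^{3m}f(x/\tau_{\mathfrak{q}}^m)$ is $\mathfrak{q}$-integral; put $\lambda=\prod_{\mathfrak{q}\mid2}\tau_{\mathfrak{q}}^{m_{\mathfrak{q}}}$ and $g(x)=\lambda^3f(x/\lambda)\in\mathcal{O}_K[x]$. If $x_0\in\mathcal{O}_K$ is the root of $g$ corresponding to the given $2$-torsion point, then $g(x+x_0)=x(x^2+ax+b)$; this defines $a,b\in\mathcal{O}_K$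 and the model $E_{a,b}$ of $E$. $E$ is called ordinary at $\mathfrak{q}\mid2$ if $v_{\mathfrak{q}}(a_1)=0$ and supersingular at $\mathfrak{q}$ if $v_{\mathfrak{q}}(a_1)>0$. Write $(2)=\mathfrak{q}_a\mathfrak{q}_b$, where $\mathfrak{q}_a$ is the product of $\mathfrak{q}^{e_2}$ over the primes $\mathfrak{q}\mid 2$ dividing $a$, and $\mathfrak{q}_b$ the product over the remaining primes above $2$ (which divide $b$); choose generators $\tau_a,\tau_b$ with $\tau_a\tau_b=2$. *)

theory Defs
  imports
    Complex_Main
    "HOL-Computational_Algebra.Computational_Algebra"
    "HOL-Algebra.Algebra"
    "HOL-Algebra.Algebraic_Closure_Type"
begin

section \<open>Imaginary quadratic fields inside the complex numbers\<close>

definition imaginary_quadratic_field :: "complex set \<Rightarrow> bool" where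
  "imaginary_quadratic_field K \<longleftrightarrow> (\<exists>d::nat. d > 0 \<and> squarefree d \<and>
     K = {of_rat x + of_rat y * (\<i> * of_real (sqrt (real d))) | x y. True})"

definition complex_ring :: "complex set \<Rightarrow> complex ring" where
  "complex_ring S = ring_of_type_algebra\<lparr>carrier := S\<rparr>"

definition integers_of :: "complex set \<Rightarrow> complex ring" where
  "integers_of K = complex_ring {x \<in> K. algebraic_int x}"

definition ideal_equivalence :: "('a, 'b) ring_scheme \<Rightarrow> ('a set \<times> 'a set) set" where
  "ideal_equivalence R =
     {(I, J). ideal I R \<and> ideal J R \<and> I \<noteq> {\<zero>\<^bsub>R\<^esub>} \<and> J \<noteq> {\<zero>\<^bsub>R\<^esub>} \<and>
       (\<exists>\<alpha> \<in> carrier R - {\<zero>\<^bsub>R\<^esub>}. \<exists>\<beta> \<in> carrier R - {\<zero>\<^bsub>R\<^esub>}. \<alpha> <#\<^bsub>R\<^esub> I = \<beta> <#\<^bsub>R\<^esub> J)}"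

definition class_number :: "complex set \<Rightarrow> nat" where
  "class_number K =
     card ({I. ideal I (integers_of K) \<and> I \<noteq> {0}} // ideal_equivalence (integers_of K))"

text \<open>
  The fields to which the notions below are applied with a prime \<open>p\<close> have class number one, so
  that nonzero prime ideals are represented by prime elements, up to associates.
\<close>

definition primes_of :: "complex set \<Rightarrow> complex set" where
  "primes_of K = {p \<in> carrier (integers_of K). ring_prime\<^bsub>integers_of K\<^esub> p}"

definition is_gcd :: "('a, 'b) ring_scheme \<Rightarrow> 'a set \<Rightarrow> 'a \<Rightarrow> bool" where
  "is_gcd R S g \<longleftrightarrow> g \<in> carrier R \<and> (\<forall>x\<in>S. g divides\<^bsub>R\<^esub> x) \<and>
     (\<forall>h\<in>carrier R. (\<forall>x\<in>S. h divides\<^bsub>R\<^esub> x) \<longrightarrow> h divides\<^bsub>R\<^esub> g)"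

definition square_free :: "('a, 'b) ring_scheme \<Rightarrow> 'a \<Rightarrow> bool" where
  "square_free R x \<longleftrightarrow> x \<in> carrier R \<and>
     (\<forall>y\<in>carrier R. (y \<otimes>\<^bsub>R\<^esub> y) divides\<^bsub>R\<^esub> x \<longrightarrow> y \<in> Units R)"

text \<open>
  The valuation is only meaningful for nonzero \<open>x\<close> in \<open>K\<close>; wherever the
  argument may vanish, the case of valuation \<open>\<infinity>\<close> is treated separately.
\<close>

definition valuation :: "complex set \<Rightarrow> complex \<Rightarrow> complex \<Rightarrow> int" where
  "valuation K p x = (THE n. \<exists>u \<in> carrier (integers_of K). \<exists>w \<in> carrier (integers_of K).
     \<not> p divides\<^bsub>integers_of K\<^esub> u \<and> \<not> p divides\<^bsub>integers_of K\<^esub> w \<and> x * w = p powi n * u)"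

definition p_integral :: "complex set \<Rightarrow> complex \<Rightarrow> complex \<Rightarrow> bool" where
  "p_integral K p x \<longleftrightarrow> (\<exists>u \<in> carrier (integers_of K). \<exists>w \<in> carrier (integers_of K).
     \<not> p divides\<^bsub>integers_of K\<^esub> w \<and> x * w = u)"

text \<open>
  The ramification index of \<open>2\<close> at a prime above \<open>2\<close>; as \<open>K\<close> is Galois over the rationals, it
  is the same for all such primes.
\<close>

definition ram_index_two :: "complex set \<Rightarrow> complex \<Rightarrow> int" where
  "ram_index_two K q = valuation K q 2"

section \<open>Weierstrass equations\<close>

datatype weierstrass = Weierstrass
  (w1: complex) (w2: complex) (w3: complex) (w4: complex) (w6: complex)

definition coeffs_in :: "weierstrass \<Rightarrow> complex set \<Rightarrow> bool" where
  "coeffs_in E S \<longleftrightarrow> {w1 E, w2 E, w3 E, w4 E, w6 E} \<subseteq> S"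

definition inv_b2 :: "weierstrass \<Rightarrow> complex" where
  "inv_b2 E = (w1 E)^2 + 4 * w2 E"
definition inv_b4 :: "weierstrass \<Rightarrow> complex" where
  "inv_b4 E = 2 * w4 E + w1 E * w3 E"
definition inv_b6 :: "weierstrass \<Rightarrow> complex" where
  "inv_b6 E = (w3 E)^2 + 4 * w6 E"
definition inv_b8 :: "weierstrass \<Rightarrow> complex" where
  "inv_b8 E = (w1 E)^2 * w6 E + 4 * w2 E * w6 E - w1 E * w3 E * w4 E + w2 E * (w3 E)^2 - (w4 E)^2"
definition inv_c4 :: "weierstrass \<Rightarrow> complex" where
  "inv_c4 E = (inv_b2 E)^2 - 24 * inv_b4 E"
definition discr :: "weierstrass \<Rightarrow> complex" where
  "discr E = - ((inv_b2 E)^2 * inv_b8 E) - 8 * (inv_b4 E)^3 - 27 * (inv_b6 E)^2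
     + 9 * inv_b2 E * inv_b4 E * inv_b6 E"

definition elliptic_curve :: "complex set \<Rightarrow> weierstrass \<Rightarrow> bool" where
  "elliptic_curve K E \<longleftrightarrow> coeffs_in E K \<and> discr E \<noteq> 0"

definition E_ab :: "complex \<Rightarrow> complex \<Rightarrow> weierstrass" where
  "E_ab a b = Weierstrass 0 a 0 b 0"

text \<open>The substitution \<open>x = u\<^sup>2x' + r\<close>, \<open>y = u\<^sup>3y' + u\<^sup>2sx' + t\<close>, on equations and on points.\<close>

definition change_eq ::
  "complex \<Rightarrow> complex \<Rightarrow> complex \<Rightarrow> complex \<Rightarrow> weierstrass \<Rightarrow> weierstrass" where
  "change_eq u r s t E = Weierstrass
     ((w1 E + 2 * s) / u)
     ((w2 E - s * w1 E + 3 * r - s^2) / u^2)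
     ((w3 E + r * w1 E + 2 * t) / u^3)
     ((w4 E - s * w3 E + 2 * r * w2 E - (t + r * s) * w1 E + 3 * r^2 - 2 * s * t) / u^4)
     ((w6 E + r * w4 E + r^2 * w2 E + r^3 - t * w3 E - t^2 - r * t * w1 E) / u^6)"

datatype ec_point = EC_zero | EC_pt complex complex

fun change_pt :: "complex \<Rightarrow> complex \<Rightarrow> complex \<Rightarrow> complex \<Rightarrow> ec_point \<Rightarrow> ec_point" where
  "change_pt u r s t EC_zero = EC_zero"
| "change_pt u r s t (EC_pt x y) = EC_pt ((x - r) / u^2) ((y - s * (x - r) - t) / u^3)"

definition isomorphic_over :: "complex set \<Rightarrow> weierstrass \<Rightarrow> weierstrass \<Rightarrow> bool" where
  "isomorphic_over K E W \<longleftrightarrow>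
     (\<exists>u\<in>K. \<exists>r\<in>K. \<exists>s\<in>K. \<exists>t\<in>K. u \<noteq> 0 \<and> W = change_eq u r s t E)"

definition ec_points :: "weierstrass \<Rightarrow> complex set \<Rightarrow> ec_point set" where
  "ec_points E F = insert EC_zero {EC_pt x y | x y. x \<in> F \<and> y \<in> F \<and>
     y^2 + w1 E * x * y + w3 E * y = x^3 + w2 E * x^2 + w4 E * x + w6 E}"

fun ec_add :: "weierstrass \<Rightarrow> ec_point \<Rightarrow> ec_point \<Rightarrow> ec_point" where
  "ec_add E EC_zero Q = Q"
| "ec_add E (EC_pt x y) EC_zero = EC_pt x y"
| "ec_add E (EC_pt x1 y1) (EC_pt x2 y2) =
    (if x1 = x2 \<and> y1 + y2 + w1 E * x2 + w3 E = 0 then EC_zero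
     else
       (let l = (if x1 = x2
                 then (3 * x1^2 + 2 * w2 E * x1 + w4 E - w1 E * y1) / (2 * y1 + w1 E * x1 + w3 E)
                 else (y2 - y1) / (x2 - x1));
            x3 = l^2 + w1 E * l - w2 E - x1 - x2
        in EC_pt x3 (- (l + w1 E) * x3 - (y1 - l * x1) - w3 E)))"

definition ec_multiple :: "weierstrass \<Rightarrow> nat \<Rightarrow> ec_point \<Rightarrow> ec_point" where
  "ec_multiple E n T = ((ec_add E T) ^^ n) EC_zero"

definition ec_has_order :: "weierstrass \<Rightarrow> ec_point \<Rightarrow> nat \<Rightarrow> bool" where
  "ec_has_order E T n \<longleftrightarrow> 0 < n \<and> ec_multiple E n T = EC_zero \<and>
     (\<forall>m. 0 < m \<and> m < n \<longrightarrow> ec_multiple E m T \<noteq> EC_zero)"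

section \<open>Minimal models and reduction types\<close>

definition p_integral_eq :: "complex set \<Rightarrow> complex \<Rightarrow> weierstrass \<Rightarrow> bool" where
  "p_integral_eq K p W \<longleftrightarrow> coeffs_in W {x. p_integral K p x}"

definition minimal_model_at ::
  "complex set \<Rightarrow> complex \<Rightarrow> weierstrass \<Rightarrow> weierstrass \<Rightarrow> bool" where
  "minimal_model_at K p E W \<longleftrightarrow> isomorphic_over K E W \<and> p_integral_eq K p W \<and>
     (\<forall>W'. isomorphic_over K E W' \<and> p_integral_eq K p W' \<longrightarrow>
        valuation K p (discr W) \<le> valuation K p (discr W'))"

definition global_minimal_model :: "complex set \<Rightarrow> weierstrass \<Rightarrow> weierstrass \<Rightarrow> bool" where
  "global_minimal_model K E W \<longleftrightarrow> isomorphic_over K E W \<and>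
     coeffs_in W (carrier (integers_of K)) \<and> (\<forall>p\<in>primes_of K. minimal_model_at K p E W)"

definition good_reduction :: "complex set \<Rightarrow> weierstrass \<Rightarrow> complex \<Rightarrow> bool" where
  "good_reduction K E p \<longleftrightarrow>
     (\<exists>W. minimal_model_at K p E W \<and> discr W \<noteq> 0 \<and> valuation K p (discr W) = 0)"

definition multiplicative_reduction :: "complex set \<Rightarrow> weierstrass \<Rightarrow> complex \<Rightarrow> bool" where
  "multiplicative_reduction K E p \<longleftrightarrow>
     (\<exists>W. minimal_model_at K p E W \<and> discr W \<noteq> 0 \<and> valuation K p (discr W) > 0 \<and>
        inv_c4 W \<noteq> 0 \<and> valuation K p (inv_c4 W) = 0)"

definition ordinary_at :: "complex set \<Rightarrow> weierstrass \<Rightarrow> complex \<Rightarrow> bool" where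
  "ordinary_at K W q \<longleftrightarrow> w1 W \<noteq> 0 \<and> valuation K q (w1 W) = 0"

definition supersingular_at :: "complex set \<Rightarrow> weierstrass \<Rightarrow> complex \<Rightarrow> bool" where
  "supersingular_at K W q \<longleftrightarrow> w1 W = 0 \<or> valuation K q (w1 W) > 0"

section \<open>The conductor\<close>

text \<open>
  The exponent of the conductor at \<open>p\<close> is the sum of the tame part (\<open>0\<close>, \<open>1\<close> or \<open>2\<close> for good,
  multiplicative or additive reduction) and of the wild part
  \<open>\<Sum>i\<ge>1. (|G i| / |G 0|) * dim (E[l] / E[l]^(G i))\<close>. Here \<open>l\<close> is a rational prime not divisible
  by \<open>p\<close>, on the choice of which the sum does not depend, and the \<open>G i\<close> are the ramification
  groups in lower numbering, at a prime above \<open>p\<close>, of the extension of \<open>K\<close> generated by \<open>E[l]\<close>.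
\<close>

definition torsion_points :: "weierstrass \<Rightarrow> nat \<Rightarrow> ec_point set" where
  "torsion_points E l = {T \<in> ec_points E UNIV. ec_multiple E l T = EC_zero}"

definition torsion_field :: "complex set \<Rightarrow> weierstrass \<Rightarrow> nat \<Rightarrow> complex set" where
  "torsion_field K E l = generate_field ring_of_type_algebra
     (K \<union> {z. \<exists>x y. EC_pt x y \<in> torsion_points E l \<and> (z = x \<or> z = y)})"

definition galois_group :: "complex set \<Rightarrow> complex set \<Rightarrow> (complex \<Rightarrow> complex) set" where
  "galois_group L K = {\<sigma> \<in> extensional L.
     \<sigma> \<in> ring_iso (complex_ring L) (complex_ring L) \<and> (\<forall>x\<in>K. \<sigma> x = x)}"

fun galois_act :: "(complex \<Rightarrow> complex) \<Rightarrow> ec_point \<Rightarrow> ec_point" where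
  "galois_act \<sigma> EC_zero = EC_zero"
| "galois_act \<sigma> (EC_pt x y) = EC_pt (\<sigma> x) (\<sigma> y)"

definition prime_above :: "complex set \<Rightarrow> complex \<Rightarrow> complex set" where
  "prime_above L p = (SOME I. primeideal I (integers_of L) \<and> p \<in> I)"

definition ideal_power :: "('a, 'b) ring_scheme \<Rightarrow> 'a set \<Rightarrow> nat \<Rightarrow> 'a set" where
  "ideal_power R I n = ((\<lambda>J. ideal_prod R J I) ^^ n) (carrier R)"

definition ramification_group ::
  "complex set \<Rightarrow> complex set \<Rightarrow> complex \<Rightarrow> nat \<Rightarrow> (complex \<Rightarrow> complex) set" where
  "ramification_group L K p i = {\<sigma> \<in> galois_group L K. \<forall>x\<in>carrier (integers_of L).
     \<sigma> x - x \<in> ideal_power (integers_of L) (prime_above L p) (i + 1)}"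

definition fixed_torsion ::
  "weierstrass \<Rightarrow> nat \<Rightarrow> (complex \<Rightarrow> complex) set \<Rightarrow> ec_point set" where
  "fixed_torsion E l G = {T \<in> torsion_points E l. \<forall>\<sigma>\<in>G. galois_act \<sigma> T = T}"

text \<open>
  The dimension over the field with \<open>l\<close> elements of the quotient of \<open>E[l]\<close> by a subspace of
  cardinality \<open>c\<close> is \<open>2 - log l c\<close>. Trivial \<open>G i\<close> contribute \<open>0\<close> and are omitted to make the sum
  finite. The sum is a nonnegative integer, so taking the floor does not change it.
\<close>

definition wild_exponent :: "complex set \<Rightarrow> weierstrass \<Rightarrow> complex \<Rightarrow> nat" where
  "wild_exponent K E p =
     (let l = (if p divides\<^bsub>integers_of K\<^esub> 2 then 3 else 2);
          G = ramification_group (torsion_field K E l) K p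
      in nat \<lfloor>\<Sum>i \<in> {i. 1 \<le> i \<and> 1 < card (G i)}.
           real (card (G i)) / real (card (G 0)) *
           (2 - log (real l) (real (card (fixed_torsion E l (G i)))))\<rfloor>)"

definition conductor_exponent :: "complex set \<Rightarrow> weierstrass \<Rightarrow> complex \<Rightarrow> nat" where
  "conductor_exponent K E p =
     (if good_reduction K E p then 0 else if multiplicative_reduction K E p then 1 else 2)
     + wild_exponent K E p"

text \<open>\<open>N\<close> generates the conductor of \<open>E\<close> over \<open>K\<close>.\<close>

definition is_conductor :: "complex set \<Rightarrow> weierstrass \<Rightarrow> complex \<Rightarrow> bool" where
  "is_conductor K E N \<longleftrightarrow> N \<in> carrier (integers_of K) \<and> N \<noteq> 0 \<and>
     (\<forall>p\<in>primes_of K. valuation K p N = int (conductor_exponent K E p))"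

definition odd_in :: "complex set \<Rightarrow> complex \<Rightarrow> bool" where
  "odd_in K x \<longleftrightarrow> is_gcd (integers_of K) {x, 2} 1"

section \<open>The model attached to a point of order two\<close>

definition completed_cubic :: "weierstrass \<Rightarrow> complex poly" where
  "completed_cubic W =
     [:w6 W + (w3 W)^2 / 4, w4 W + w1 W * w3 W / 2, w2 W + (w1 W)^2 / 4, 1:]"

definition scale_cubic :: "complex \<Rightarrow> complex poly \<Rightarrow> complex poly" where
  "scale_cubic c f = smult (c^3) (pcompose f [:0, 1 / c:])"

definition scaling_exponent :: "complex set \<Rightarrow> weierstrass \<Rightarrow> complex \<Rightarrow> nat" where
  "scaling_exponent K W q = (LEAST m. \<forall>i.
     p_integral K q (poly.coeff (scale_cubic (q ^ m) (completed_cubic W)) i))"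

text \<open>One generator \<open>\<tau>\<close> for each prime ideal above \<open>2\<close>.\<close>

definition generators_above_two :: "complex set \<Rightarrow> complex set \<Rightarrow> bool" where
  "generators_above_two K T \<longleftrightarrow> finite T \<and>
     T \<subseteq> {q \<in> primes_of K. q divides\<^bsub>integers_of K\<^esub> 2} \<and>
     (\<forall>q\<in>primes_of K. q divides\<^bsub>integers_of K\<^esub> 2 \<longrightarrow> (\<exists>!\<tau>. \<tau> \<in> T \<and> q \<sim>\<^bsub>integers_of K\<^esub> \<tau>))"

text \<open>
  \<open>x\<close> is the first coordinate of the given point of order two on \<open>W\<close>; it is not affected by
  completing the square, so \<open>l * x\<close> is the corresponding root of the scaled cubic.
\<close>

definition two_torsion_model ::
  "complex set \<Rightarrow> weierstrass \<Rightarrow> complex \<Rightarrow> complex \<Rightarrow> complex \<Rightarrow> bool" where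
  "two_torsion_model K W x a b \<longleftrightarrow> (\<exists>T. generators_above_two K T \<and>
     (let l = (\<Prod>\<tau>\<in>T. \<tau> ^ scaling_exponent K W \<tau>)
      in pcompose (scale_cubic l (completed_cubic W)) [:l * x, 1:] = [:0, b, a, 1:]))"

text \<open>\<open>\<tau>\<close> generates the product of the \<open>q^e\<close> over the primes \<open>q\<close> above \<open>2\<close> satisfying \<open>R\<close>.\<close>

definition generates_part_of_two ::
  "complex set \<Rightarrow> (complex \<Rightarrow> bool) \<Rightarrow> complex \<Rightarrow> bool" where
  "generates_part_of_two K R \<tau> \<longleftrightarrow> \<tau> \<in> carrier (integers_of K) \<and> \<tau> \<noteq> 0 \<and>
     (\<forall>q\<in>primes_of K. valuation K q \<tau> =
        (if q divides\<^bsub>integers_of K\<^esub> 2 \<and> R q then ram_index_two K q else 0))"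

definition val3 ::
  "complex set \<Rightarrow> complex \<Rightarrow> complex \<Rightarrow> complex \<Rightarrow> complex \<Rightarrow> real \<times> real \<times> real" where
  "val3 K p A B C = (of_int (valuation K p A), of_int (valuation K p B), of_int (valuation K p C))"

definition only_primes_dividing :: "complex set \<Rightarrow> complex \<Rightarrow> complex \<Rightarrow> bool" where
  "only_primes_dividing K x y \<longleftrightarrow> (\<forall>p\<in>primes_of K.
     p divides\<^bsub>integers_of K\<^esub> x \<longrightarrow> p divides\<^bsub>integers_of K\<^esub> y)"

end

theory Submission
  imports Defs
begin

text \<open>
  All valuations are read off from \<open>16 b\<^sup>2 (a\<^sup>2 - 4b) = \<lambda>\<^sup>6 D\<close>, the discriminant of the model
  \<open>E\<^sub>a\<^sub>,\<^sub>b\<close>, together with \<open>a\<^sup>2 = (a\<^sup>2 - 4b) + 4b\<close>. The conductor only enters through good reduction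
  above 2. At an odd prime p, minimality of the model excludes that \<open>p\<^sup>2\<close> divides a and \<open>p\<^sup>4\<close>
  divides b, which leaves the listed triples. At an ordinary prime above 2 the root of the cubic
  is either integral or of valuation \<open>-2e\<close>, and these two cases give the two triples. At a
  supersingular prime above 2 the point of order two cannot be integral, and as the ramification
  index is at most 2 this forces \<open>e = 2\<close> and a root of valuation \<open>-2\<close>. For the converse, the
  discriminant of \<open>E\<^sub>a\<^sub>,\<^sub>b\<close> is \<open>64 A\<^sup>3 B C\<^sup>2 / g\<^sup>6\<close>.
\<close>

section \<open>Integers of an imaginary quadratic field\<close>

text \<open>Every assertion is local, so the global work lies in providing valuations: class number
  one turns prime ideals into prime elements \<open>p\<close>, and dividing by \<open>p\<close>
  lowers the norm, so each \<open>p\<close> gives a discrete valuation on \<open>K\<close>. What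
  remains is arithmetic with the valuations of a, b and c = a^2 - 4b. The discriminant fixes one
  combination of v(b) and v(c), and a^2 = c + 4b forces the two smallest of v(a^2), v(c), v(4b) to
  agree. The divisors in B and C are chosen to remove exactly the common part of c and 4b. At odd
  primes this is P, whose square part passes into \<open>a'\<close>. Above 2, where P is a unit
  because P divides D, it is the square of the generator \<tau>, since there the common part is 4 if
  the prime divides a and 1 otherwise. As 16 b^2 = (4b)^2, the number 2 v(C) + v(B) equals 6
  v(\<lambda>) + v(D) minus three times the valuation of the common part. This explains the
  constants: a common part of valuation 2 at an odd prime gives k - 6; at an ordinary prime 6
  v(\<lambda>) = 12e, and a common part of valuation 0 or 2e leaves 6e for C or for B; at a
  supersingular prime 12 - 3 * 4 = 0.\<close>

locale quadratic_field =
  fixes K :: "complex set" and d :: nat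
  assumes d_pos: "d > 0"
    and K_eq: "K = {of_rat x + of_rat y * (\<i> * of_real (sqrt (real d))) | x y. True}"
begin

definition \<omega> :: complex where "\<omega> = \<i> * of_real (sqrt (real d))"

lemma omega_sq: "\<omega> * \<omega> = - of_nat d"
proof -
  have "complex_of_real (sqrt (real d)) * complex_of_real (sqrt (real d)) = of_real (real d)"
    by (metis of_real_mult abs_of_nat real_sqrt_mult_self)
  then show ?thesis by (simp add: \<omega>_def algebra_simps)
qed

lemma omega_mult_left: "\<omega> * (\<omega> * z) = - (of_nat d * z)"
  by (simp flip: mult.assoc add: omega_sq)

lemma cnj_of_rat: "cnj (of_rat p) = of_rat p"
proof -
  obtain a b where "p = of_int a / of_int b" using quotient_of_div by (metis surj_pair)
  then show ?thesis by (simp add: of_rat_divide)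
qed

lemma cnj_omega: "cnj \<omega> = - \<omega>"
  by (simp add: \<omega>_def)

lemma mem_K: "x \<in> K \<longleftrightarrow> (\<exists>p q. x = of_rat p + of_rat q * \<omega>)"
  by (auto simp: K_eq \<omega>_def)

lemma K_of_rat: "of_rat p \<in> K"
  unfolding mem_K by (rule exI[of _ p], rule exI[of _ 0]) simp

lemma K_of_int: "of_int p \<in> K"
  using K_of_rat[of "of_int p"] by simp

lemma K_0: "0 \<in> K" and K_1: "1 \<in> K"
  using K_of_int[of 0] K_of_int[of 1] by simp_all

lemma K_add: "x \<in> K \<Longrightarrow> y \<in> K \<Longrightarrow> x + y \<in> K"
proof -
  assume "x \<in> K" "y \<in> K"
  then obtain p q p' q' where "x = of_rat p + of_rat q * \<omega>" "y = of_rat p' + of_rat q' * \<omega>"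
    by (auto simp: mem_K)
  then have "x + y = of_rat (p + p') + of_rat (q + q') * \<omega>"
    by (simp add: of_rat_add algebra_simps)
  then show ?thesis unfolding mem_K by blast
qed

lemma K_uminus: "x \<in> K \<Longrightarrow> - x \<in> K"
proof -
  assume "x \<in> K"
  then obtain p q where "x = of_rat p + of_rat q * \<omega>" by (auto simp: mem_K)
  then have "- x = of_rat (- p) + of_rat (- q) * \<omega>"
    by (simp add: of_rat_minus algebra_simps)
  then show ?thesis unfolding mem_K by blast
qed

lemma K_mult: "x \<in> K \<Longrightarrow> y \<in> K \<Longrightarrow> x * y \<in> K"
proof -
  assume "x \<in> K" "y \<in> K"
  then obtain p q p' q' where "x = of_rat p + of_rat q * \<omega>" "y = of_rat p' + of_rat q' * \<omega>"
    by (auto simp: mem_K)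
  then have "x * y = of_rat (p * p' - of_nat d * q * q') + of_rat (p * q' + q * p') * \<omega>"
    by (simp add: of_rat_add of_rat_diff of_rat_mult algebra_simps omega_mult_left omega_sq)
  then show ?thesis unfolding mem_K by blast
qed

lemma K_cnj: "x \<in> K \<Longrightarrow> cnj x \<in> K"
proof -
  assume "x \<in> K"
  then obtain p q where "x = of_rat p + of_rat q * \<omega>" by (auto simp: mem_K)
  then have "cnj x = of_rat p + of_rat (- q) * \<omega>"
    by (simp add: of_rat_minus cnj_omega cnj_of_rat)
  then show ?thesis unfolding mem_K by blast
qed

lemma norm_K:
  assumes "x \<in> K"
  obtains p q where "x * cnj x = of_rat (p\<^sup>2 + of_nat d * q\<^sup>2)" "x + cnj x = of_rat (2 * p)"
    "x = of_rat p + of_rat q * \<omega>"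
proof -
  from assms obtain p q where pq: "x = of_rat p + of_rat q * \<omega>" by (auto simp: mem_K)
  show ?thesis
  proof (rule that[OF _ _ pq])
    show "x * cnj x = of_rat (p\<^sup>2 + of_nat d * q\<^sup>2)"
      by (simp add: pq cnj_omega cnj_of_rat of_rat_add of_rat_mult of_rat_power power2_eq_square
          algebra_simps omega_mult_left omega_sq)
    show "x + cnj x = of_rat (2 * p)"
      by (simp add: pq cnj_omega cnj_of_rat of_rat_mult)
  qed
qed

lemma K_inverse: "x \<in> K \<Longrightarrow> inverse x \<in> K"
proof (cases "x = 0")
  case False
  assume x: "x \<in> K"
  then obtain p q where n: "x * cnj x = of_rat (p\<^sup>2 + of_nat d * q\<^sup>2)"
    by (rule norm_K)
  from False have "x * cnj x \<noteq> 0" by simp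
  then have "inverse x = cnj x * inverse (x * cnj x)"
    by (simp add: field_simps)
  also have "\<dots> = cnj x * of_rat (inverse (p\<^sup>2 + of_nat d * q\<^sup>2))"
    by (simp add: n of_rat_inverse)
  also have "\<dots> \<in> K" using x by (intro K_mult K_cnj K_of_rat)
  finally show ?thesis .
qed (simp add: K_0)

lemma K_diff: "x \<in> K \<Longrightarrow> y \<in> K \<Longrightarrow> x - y \<in> K"
  using K_add[of x "- y"] K_uminus[of y] by simp

lemma K_divide: "x \<in> K \<Longrightarrow> y \<in> K \<Longrightarrow> x / y \<in> K"
  using K_mult[of x "inverse y"] K_inverse[of y] by (simp add: divide_inverse)

section \<open>Integrality through bounded denominators\<close>

definition lattice :: "complex set" where
  "lattice = {of_int x + of_int y * \<omega> | x y. True}"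

lemma lattice_of_int: "of_int m \<in> lattice"
  unfolding lattice_def by (rule CollectI, rule exI[of _ m], rule exI[of _ 0]) simp

lemma lattice_add: "x \<in> lattice \<Longrightarrow> y \<in> lattice \<Longrightarrow> x + y \<in> lattice"
proof -
  assume "x \<in> lattice" "y \<in> lattice"
  then obtain p q p' q' where "x = of_int p + of_int q * \<omega>" "y = of_int p' + of_int q' * \<omega>"
    by (auto simp: lattice_def)
  then have "x + y = of_int (p + p') + of_int (q + q') * \<omega>"
    by (simp add: algebra_simps)
  then show ?thesis unfolding lattice_def by blast
qed

lemma lattice_mult: "x \<in> lattice \<Longrightarrow> y \<in> lattice \<Longrightarrow> x * y \<in> lattice"
proof -
  assume "x \<in> lattice" "y \<in> lattice"
  then obtain p q p' q' where "x = of_int p + of_int q * \<omega>" "y = of_int p' + of_int q' * \<omega>"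
    by (auto simp: lattice_def)
  then have "x * y = of_int (p * p' - of_nat d * q * q') + of_int (p * q' + q * p') * \<omega>"
    by (simp add: algebra_simps omega_mult_left omega_sq)
  then show ?thesis unfolding lattice_def by blast
qed

lemma lattice_power: "x \<in> lattice \<Longrightarrow> x ^ n \<in> lattice"
  using lattice_of_int[of 1] by (induction n) (auto intro: lattice_mult)

lemma lattice_sum: "(\<And>i. i \<in> I \<Longrightarrow> f i \<in> lattice) \<Longrightarrow> sum f I \<in> lattice"
  using lattice_of_int[of 0] by (induction I rule: infinite_finite_induct) (auto intro: lattice_add)

lemma lattice_norm:
  assumes "x \<in> lattice"
  shows "x * cnj x \<in> \<int>"
proof -
  from assms obtain p q where "x = of_int p + of_int q * \<omega>" by (auto simp: lattice_def)
  then have "x * cnj x = of_int (p * p + int d * q * q)"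
    by (simp add: cnj_omega algebra_simps omega_mult_left omega_sq)
  then show ?thesis by (metis Ints_of_int)
qed

lemma common_denominator:
  assumes "x \<in> K"
  obtains w where "w > 0" "of_int w * x \<in> lattice"
proof -
  from assms obtain p q where pq: "x = of_rat p + of_rat q * \<omega>" by (auto simp: mem_K)
  obtain a b where ab: "p = of_int a / of_int b" "b > 0"
    using quotient_of_div[of p] quotient_of_denom_pos[of p] by (metis surj_pair)
  obtain a' b' where ab': "q = of_int a' / of_int b'" "b' > 0"
    using quotient_of_div[of q] quotient_of_denom_pos[of q] by (metis surj_pair)
  have "of_int (b * b') * x = of_int (a * b') + of_int (a' * b) * \<omega>"
    using ab(2) ab'(2) by (simp add: pq ab(1) ab'(1) of_rat_divide field_simps)
  then have "of_int (b * b') * x \<in> lattice"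
    unfolding lattice_def by blast
  with ab(2) ab'(2) show ?thesis by (intro that[of "b * b'"]) auto
qed

text \<open>
  An element of K is integral iff its powers have bounded denominators; closure under
  sums and products is immediate from this characterisation.
\<close>

definition almost_integral :: "complex \<Rightarrow> bool" where
  "almost_integral x \<longleftrightarrow> (\<exists>m>0. \<forall>k. of_int m * x ^ k \<in> lattice)"

lemma almost_integral_mult:
  assumes "almost_integral x" "almost_integral y"
  shows "almost_integral (x * y)"
proof -
  obtain m n where mn: "m > 0" "\<And>k. of_int m * x ^ k \<in> lattice" "n > 0" "\<And>k. of_int n * y ^ k \<in> lattice"
    using assms unfolding almost_integral_def by blast
  have "of_int (m * n) * (x * y) ^ k \<in> lattice" for k
    using lattice_mult[OF mn(2)[of k] mn(4)[of k]] by (simp add: power_mult_distrib mult_ac)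
  then show ?thesis using mn(1,3) unfolding almost_integral_def
    by (intro exI[of _ "m * n"]) auto
qed

lemma almost_integral_add:
  assumes "almost_integral x" "almost_integral y"
  shows "almost_integral (x + y)"
proof -
  obtain m n where mn: "m > 0" "\<And>k. of_int m * x ^ k \<in> lattice" "n > 0" "\<And>k. of_int n * y ^ k \<in> lattice"
    using assms unfolding almost_integral_def by blast
  have "of_int (m * n) * (x + y) ^ k \<in> lattice" for k
  proof -
    have "of_int (m * n) * (x + y) ^ k =
        (\<Sum>i\<le>k. of_int (int (k choose i)) * ((of_int m * x ^ i) * (of_int n * y ^ (k - i))))"
      unfolding binomial_ring sum_distrib_left by (intro sum.cong) (auto simp: mult_ac)
    also have "\<dots> \<in> lattice"
      by (intro lattice_sum lattice_mult lattice_of_int mn)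
    finally show ?thesis .
  qed
  then show ?thesis using mn(1,3) unfolding almost_integral_def
    by (intro exI[of _ "m * n"]) auto
qed

lemma almost_integral_of_int: "almost_integral (of_int n)"
  unfolding almost_integral_def
  by (intro exI[of _ 1]) (auto intro: lattice_power lattice_of_int)

text \<open>If n is the degree of the monic equation of \<open>x\<close>, then \<open>w ^ n\<close>
  clears the denominators of the powers up to \<open>x ^ n\<close>. The equation writes each higher
  power as an integer combination of lower ones, so the same multiplier serves for all of
  them.\<close>

lemma algebraic_int_imp_almost_integral:
  assumes "x \<in> K" "algebraic_int x"
  shows "almost_integral x"
proof -
  obtain w where w: "w > 0" "of_int w * x \<in> lattice"
    using common_denominator[OF assms(1)] by blast
  obtain f where f: "poly (map_poly of_int f) x = 0" "lead_coeff f = 1"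
    using assms(2) unfolding algebraic_int_altdef_ipoly by blast
  define n where "n = degree f"
  have small: "of_int (w ^ n) * x ^ k \<in> lattice" if "k \<le> n" for k
  proof -
    have "of_int (w ^ n) * x ^ k = of_int (w ^ (n - k)) * (of_int w * x) ^ k"
      using that by (simp add: power_mult_distrib mult_ac flip: power_add)
    also have "\<dots> \<in> lattice" by (intro lattice_mult lattice_power w lattice_of_int)
    finally show ?thesis .
  qed
  have "(\<Sum>i\<le>n. of_int (coeff f i) * x ^ i) = 0"
    using f(1) by (simp add: poly_altdef n_def degree_map_poly coeff_map_poly)
  moreover have "{..n} = insert n {..<n}" by auto
  ultimately have top: "x ^ n = (\<Sum>i<n. of_int (- coeff f i) * x ^ i)"
    using f(2) by (simp add: n_def sum_negf add_eq_0_iff2)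
  have "of_int (w ^ n) * x ^ k \<in> lattice" for k
  proof (induction k rule: less_induct)
    case (less k)
    show ?case
    proof (cases "k < n")
      case True
      then show ?thesis by (intro small) auto
    next
      case False
      have "of_int (w ^ n) * x ^ k = of_int (w ^ n) * (x ^ n * x ^ (k - n))"
        using False by (simp flip: power_add)
      also have "\<dots> = (\<Sum>i<n. of_int (- coeff f i) * (of_int (w ^ n) * x ^ (i + (k - n))))"
        unfolding top sum_distrib_right sum_distrib_left
        by (intro sum.cong) (auto simp: power_add mult_ac)
      also have "\<dots> \<in> lattice"
        using False by (intro lattice_sum lattice_mult lattice_of_int less) auto
      finally show ?thesis .
    qed
  qed
  then show ?thesis using w(1) unfolding almost_integral_def
    by (intro exI[of _ "w ^ n"]) auto
qed

text \<open>If \<open>b\<close> is the denominator in lowest terms, every power of \<open>b\<close>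
  divides the fixed number \<open>m\<close>, which is possible only for
  \<open>b = 1\<close>.\<close>

lemma bounded_denominators_imp_int:
  fixes r :: rat
  assumes "m > 0" "\<And>k. of_int m * r ^ k \<in> \<int>"
  shows "r \<in> \<int>"
proof -
  obtain a b where ab: "b > 0" "Rings.coprime a b" "r = of_int a / of_int b"
    by (metis quotient_of_coprime quotient_of_denom_pos quotient_of_div surj_pair)
  have dvd: "b ^ k dvd m" for k
  proof -
    obtain c where c: "of_int m * r ^ k = of_int c" using assms(2)[of k] by (auto elim: Ints_cases)
    have "(of_int (m * a ^ k) :: rat) = of_int (c * b ^ k)"
      using c ab(1) by (simp add: ab(3) power_divide field_simps)
    then have "m * a ^ k = c * b ^ k" by (simp only: of_int_eq_iff)
    then have "b ^ k dvd m * a ^ k" by simp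
    moreover have "Rings.coprime (b ^ k) (a ^ k)" using ab(2) by (simp add: ac_simps)
    ultimately show ?thesis by (simp add: coprime_dvd_mult_left_iff)
  qed
  have "b = 1"
  proof (rule ccontr)
    assume "b \<noteq> 1"
    with ab(1) have "b \<ge> 2" by simp
    \<comment> \<open>The exponent \<open>m\<close> itself is large enough for a contradiction,
      because 2 ^ m exceeds m.\<close>
    then have "2 ^ nat m \<le> b ^ nat m" by (intro Power.power_mono) auto
    moreover have "b ^ nat m \<le> m" using dvd[of "nat m"] assms(1) by (intro zdvd_imp_le)
    ultimately have "2 ^ nat m \<le> m" by linarith
    moreover have "int (nat m) < 2 ^ nat m"
      by (metis less_exp of_nat_less_iff of_nat_numeral of_nat_power)
    ultimately show False using assms(1) by simp
  qed
  then show ?thesis by (simp add: ab(3))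
qed

text \<open>Lattice elements have integral norm and the norm is multiplicative: if \<open>m\<close>
  clears the denominators of all powers of \<open>x\<close>, then \<open>m * m\<close> clears those
  of all powers of the rational number N(x).\<close>

lemma almost_integral_norm:
  assumes "x \<in> K" "almost_integral x"
  shows "x * cnj x \<in> \<int>"
proof -
  obtain m where m: "m > 0" "\<And>k. of_int m * x ^ k \<in> lattice"
    using assms(2) unfolding almost_integral_def by blast
  obtain p q where n: "x * cnj x = of_rat (p\<^sup>2 + of_nat d * q\<^sup>2)"
    using norm_K[OF assms(1)] by blast
  define r where "r = p\<^sup>2 + of_nat d * q\<^sup>2"
  have "r \<in> \<int>"
  proof (rule bounded_denominators_imp_int[of "m * m"])
    show "of_int (m * m) * r ^ k \<in> \<int>" for k
    proof -
      have "of_rat (of_int (m * m) * r ^ k) = (of_int m * x ^ k) * cnj (of_int m * x ^ k)"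
        using n by (simp add: r_def of_rat_mult of_rat_power power_mult_distrib mult_ac
            flip: n)
      also have "\<dots> \<in> \<int>" by (rule lattice_norm[OF m(2)])
      finally obtain c where "(of_rat (of_int (m * m) * r ^ k) :: complex) = of_int c"
        by (auto elim: Ints_cases)
      then have "(of_rat (of_int (m * m) * r ^ k) :: complex) = of_rat (of_int c)" by simp
      then have "of_int (m * m) * r ^ k = of_int c" by (simp only: of_rat_eq_iff)
      then show ?thesis by simp
    qed
  qed (use m in auto)
  then show ?thesis using n by (auto simp: r_def[symmetric] elim!: Ints_cases)
qed

text \<open>The trace is obtained from norms alone, by N(x + 1) = N(x) + Tr(x) + 1.\<close>

lemma almost_integral_trace:
  assumes "x \<in> K" "almost_integral x"
  shows "x + cnj x \<in> \<int>"
proof -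
  have "(x + 1) * cnj (x + 1) \<in> \<int>"
    using almost_integral_norm[of "x + 1"] almost_integral_add[OF assms(2) almost_integral_of_int[of 1]]
      K_add[OF assms(1) K_1] by simp
  moreover have "(x + 1) * cnj (x + 1) = (x * cnj x + 1) + (x + cnj x)" by (simp add: algebra_simps)
  moreover have "x * cnj x + 1 \<in> \<int>" using almost_integral_norm[OF assms] by simp
  ultimately have "((x * cnj x + 1) + (x + cnj x)) - (x * cnj x + 1) \<in> \<int>"
    by (metis Ints_diff)
  then show ?thesis by simp
qed

text \<open>The witness is the characteristic polynomial X^2 - Tr(x) X + N(x), with roots
  \<open>x\<close> and \<open>cnj x\<close>.\<close>

lemma almost_integral_imp_algebraic_int:
  assumes "x \<in> K" "almost_integral x"
  shows "algebraic_int x"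
proof (rule algebraic_int.intros[of "[:x * cnj x, - (x + cnj x), 1:]"])
  show "\<forall>i. coeff [:x * cnj x, - (x + cnj x), 1:] i \<in> \<int>"
    using almost_integral_norm[OF assms] almost_integral_trace[OF assms]
    by (auto simp: coeff_pCons Ints_minus split: nat.split simp del: minus_add_distrib)
  show "poly [:x * cnj x, - (x + cnj x), 1:] x = 0" by (simp add: algebra_simps)
qed simp

abbreviation \<O> :: "complex set" where "\<O> \<equiv> carrier (integers_of K)"

lemma O_altdef: "\<O> = {x \<in> K. almost_integral x}"
  using almost_integral_imp_algebraic_int algebraic_int_imp_almost_integral
  by (auto simp: integers_of_def complex_ring_def)

lemma O_in_K: "x \<in> \<O> \<Longrightarrow> x \<in> K" by (simp add: O_altdef)

lemma O_add: "x \<in> \<O> \<Longrightarrow> y \<in> \<O> \<Longrightarrow> x + y \<in> \<O>"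
  by (simp add: O_altdef K_add almost_integral_add)

lemma O_mult: "x \<in> \<O> \<Longrightarrow> y \<in> \<O> \<Longrightarrow> x * y \<in> \<O>"
  by (simp add: O_altdef K_mult almost_integral_mult)

lemma O_of_int: "of_int n \<in> \<O>"
  by (simp add: O_altdef K_of_int almost_integral_of_int)

lemma O_0: "0 \<in> \<O>" and O_1: "1 \<in> \<O>" and O_2: "2 \<in> \<O>"
  using O_of_int[of 0] O_of_int[of 1] O_of_int[of 2] by simp_all

lemma O_uminus: "x \<in> \<O> \<Longrightarrow> - x \<in> \<O>"
  using O_mult[OF O_of_int[of "-1"]] by simp

lemma O_diff: "x \<in> \<O> \<Longrightarrow> y \<in> \<O> \<Longrightarrow> x - y \<in> \<O>"
  using O_add[of x "- y"] O_uminus[of y] by simp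

lemma O_power: "x \<in> \<O> \<Longrightarrow> x ^ n \<in> \<O>"
  by (induction n) (auto intro: O_mult O_1)

lemma O_numeral: "numeral n \<in> \<O>"
  using O_of_int[of "numeral n"] by simp

lemma O_cnj: "x \<in> \<O> \<Longrightarrow> cnj x \<in> \<O>"
  using K_cnj by (auto simp: integers_of_def complex_ring_def)

section \<open>Norms of integers, fractions\<close>

lemma O_norm_int:
  assumes "x \<in> \<O>"
  obtains n :: nat where "x * cnj x = of_nat n" "(cmod x)\<^sup>2 = real n"
proof -
  have "x * cnj x \<in> \<int>" using assms almost_integral_norm by (auto simp: O_altdef)
  then obtain m where m: "x * cnj x = of_int m" by (auto elim: Ints_cases)
  moreover have "x * cnj x = of_real ((cmod x)\<^sup>2)" by (metis complex_norm_square of_real_power)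
  ultimately have eq: "(cmod x)\<^sup>2 = real_of_int m"
    by (metis of_real_eq_iff of_real_of_int_eq)
  then have "m \<ge> 0" by (metis of_int_0_le_iff zero_le_power2)
  with m eq show ?thesis by (intro that[of "nat m"]) auto
qed

text \<open>The norm is a positive integer. This archimedean bound serves to recognise units and to
  limit the power of a prime that divides 2.\<close>

lemma O_norm_ge_1:
  assumes "x \<in> \<O>" "x \<noteq> 0"
  shows "cmod x \<ge> 1"
proof -
  obtain n where n: "(cmod x)\<^sup>2 = real n" using O_norm_int[OF assms(1)] by blast
  with assms(2) have "n \<noteq> 0" by (metis norm_eq_zero of_nat_0 power_eq_0_iff)
  then have "(cmod x)\<^sup>2 \<ge> 1\<^sup>2" using n by simp
  then show ?thesis using power2_le_imp_le[of 1 "cmod x"] by simp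
qed

text \<open>The denominator can be a rational integer, because the lattice elements of
  \<open>K\<close> are integral: the lattice is closed under powers, so the multiplier 1 serves in
  \<open>almost_integral\<close>.\<close>

lemma fraction_K:
  assumes "x \<in> K"
  obtains u w where "u \<in> \<O>" "w \<in> \<O>" "w \<noteq> 0" "x * w = u"
proof -
  obtain w where w: "w > 0" "of_int w * x \<in> lattice" using common_denominator[OF assms] .
  have "of_int w * x \<in> \<O>"
    unfolding O_altdef almost_integral_def
    using lattice_power[OF w(2)] assms
    by (auto intro!: K_mult K_of_int exI[of _ 1])
  then show ?thesis using w(1)
    by (intro that[of "of_int w * x" "of_int w"]) (auto intro: O_of_int simp: mult_ac)
qed

end

lemma imaginary_quadratic_field_imp_locale:
  "imaginary_quadratic_field K \<Longrightarrow> \<exists>d. quadratic_field K d"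
  unfolding imaginary_quadratic_field_def quadratic_field_def by blast

section \<open>Weierstrass equations with a point of order two\<close>

text \<open>Invariance of the discriminant under translation holds only modulo this relation, which
  is used there to eliminate \<open>inv_b8\<close>.\<close>

lemma inv_b_relation: "4 * inv_b8 E = inv_b2 E * inv_b6 E - (inv_b4 E)^2"
  unfolding inv_b2_def inv_b4_def inv_b6_def inv_b8_def by (simp add: algebra_simps power2_eq_square)

text \<open>Splitting off the scaling reduces the composition law and the discriminant formula to
  the two cases of a change with \<open>u = 1\<close> and of a pure scaling.\<close>

lemma change_eq_split: "change_eq u r s t E = change_eq u 0 0 0 (change_eq 1 r s t E)"
  by (simp add: change_eq_def)

lemma change_eq_translate:
  "change_eq 1 r' s' t' (change_eq 1 r s t E) = change_eq 1 (r' + r) (s' + s) (t' + r' * s + t) E"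
  by (simp add: change_eq_def algebra_simps power2_eq_square power3_eq_cube)

lemma change_eq_scale:
  "change_eq u' 0 0 0 (change_eq u 0 0 0 E) = change_eq (u * u') 0 0 0 E"
  by (simp add: change_eq_def power_mult_distrib)

text \<open>Moving a translation past a scaling multiplies its parameters by the weights
  \<open>u^2\<close>, \<open>u\<close> and \<open>u^3\<close>; the parameters in the general
  composition law come from here.\<close>

lemma change_eq_translate_scale:
  assumes "u \<noteq> 0"
  shows "change_eq 1 r s t (change_eq u 0 0 0 E) =
    change_eq u 0 0 0 (change_eq 1 (u^2 * r) (u * s) (u^3 * t) E)"
proof -
  have "u ^ 2 = u * u" "u ^ 3 = u * u * u" "u ^ 4 = u * u * u * u" "u ^ 6 = u * u * u * u * u * u"
    by (simp_all add: eval_nat_numeral)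
  then show ?thesis using assms
    by (simp add: change_eq_def add_divide_distrib diff_divide_distrib power2_eq_square power3_eq_cube)
      (simp add: field_simps)
qed

lemma change_eq_comp:
  assumes "u \<noteq> 0"
  shows "change_eq u' r' s' t' (change_eq u r s t E) =
    change_eq (u * u') (u^2 * r' + r) (u * s' + s) (u^3 * t' + u^2 * r' * s + t) E"
  by (subst (1 2 3) change_eq_split)
    (simp only: change_eq_translate_scale[OF assms] change_eq_translate change_eq_scale mult_1)

lemma inv_b_translate:
  shows "inv_b2 (change_eq 1 r s t E) = inv_b2 E + 12 * r"
    and "inv_b4 (change_eq 1 r s t E) = inv_b4 E + r * inv_b2 E + 6 * r^2"
    and "inv_b6 (change_eq 1 r s t E) = inv_b6 E + 2 * r * inv_b4 E + r^2 * inv_b2 E + 4 * r^3"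
    and "inv_b8 (change_eq 1 r s t E) =
      inv_b8 E + 3 * r * inv_b6 E + 3 * r^2 * inv_b4 E + r^3 * inv_b2 E + 3 * r^4"
  unfolding change_eq_def inv_b2_def inv_b4_def inv_b6_def inv_b8_def
  by (simp_all add: algebra_simps power2_eq_square power3_eq_cube power4_eq_xxxx)

lemma discr_translate: "discr (change_eq 1 r s t E) = discr E"
proof -
  define b2 b4 b6 b8 where b: "b2 = inv_b2 E" "b4 = inv_b4 E" "b6 = inv_b6 E" "b8 = inv_b8 E"
  have "4 * b8 = b2 * b6 - b4^2" unfolding b by (rule inv_b_relation)
  then have b8: "b8 = (b2 * b6 - b4^2) / 4" by (simp add: field_simps)
  show ?thesis
    unfolding discr_def inv_b_translate b[symmetric] b8
    by (simp add: algebra_simps power2_eq_square power3_eq_cube power4_eq_xxxx)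
      (simp add: field_simps)
qed

lemma inv_b_scale:
  "inv_b2 (change_eq u 0 0 0 E) = inv_b2 E / u^2"
  "inv_b4 (change_eq u 0 0 0 E) = inv_b4 E / u^4"
  "inv_b6 (change_eq u 0 0 0 E) = inv_b6 E / u^6"
  "inv_b8 (change_eq u 0 0 0 E) = inv_b8 E / u^8"
  unfolding change_eq_def inv_b2_def inv_b4_def inv_b6_def inv_b8_def
  by (simp_all add: add_divide_distrib diff_divide_distrib power_divide flip: power_mult power_add)
    (simp_all add: eval_nat_numeral)

lemma discr_scale: "discr (change_eq u 0 0 0 E) = discr E / u^12"
  unfolding discr_def inv_b_scale
  by (simp add: add_divide_distrib diff_divide_distrib power_divide flip: power_mult power_add)

lemma discr_change_eq: "discr (change_eq u r s t E) = discr E / u^12"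
  by (subst change_eq_split) (simp only: discr_scale discr_translate)

lemma change_eq_id: "change_eq 1 0 0 0 E = E"
  by (cases E) (simp add: change_eq_def)

text \<open>The choice r = x, t = y moves the point to the origin, s = -a1/2 removes the xy term,
  and the order two condition removes the y term. With f the completed cubic, the two remaining
  coefficients are f''(x)/2 and f'(x), up to the scaling.\<close>

lemma change_eq_two_torsion:
  assumes eq: "y^2 + w1 W * x * y + w3 W * y = x^3 + w2 W * x^2 + w4 W * x + w6 W"
    and tors: "2 * y + w1 W * x + w3 W = 0"
  shows "change_eq u x (- w1 W / 2) y W =
    E_ab ((3 * x + (w2 W + (w1 W)^2 / 4)) / u^2)
      ((3 * x^2 + 2 * (w2 W + (w1 W)^2 / 4) * x + (w4 W + w1 W * w3 W / 2)) / u^4)"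
proof -
  have w3: "w3 W = - (2 * y) - w1 W * x" using tors by (simp add: add_eq_0_iff)
  have w6: "w6 W = y^2 + w1 W * x * y + w3 W * y - (x^3 + w2 W * x^2 + w4 W * x)"
    using eq by (simp add: algebra_simps)
  have "change_eq 1 x (- w1 W / 2) y W =
    E_ab (3 * x + (w2 W + (w1 W)^2 / 4))
      (3 * x^2 + 2 * (w2 W + (w1 W)^2 / 4) * x + (w4 W + w1 W * w3 W / 2))"
    unfolding change_eq_def E_ab_def w6 unfolding w3
    by (simp add: algebra_simps power2_eq_square power3_eq_cube) (simp add: field_simps)
  then show ?thesis by (subst change_eq_split) (simp add: change_eq_def E_ab_def)
qed

lemma discr_E_ab: "discr (E_ab a b) = 16 * b^2 * (a^2 - 4 * b)"
  unfolding discr_def E_ab_def inv_b2_def inv_b4_def inv_b6_def inv_b8_def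
  by (simp add: algebra_simps power2_eq_square power3_eq_cube)

lemma
  fixes W x y
  assumes eq: "y^2 + w1 W * x * y + w3 W * y = x^3 + w2 W * x^2 + w4 W * x + w6 W"
    and tors: "2 * y + w1 W * x + w3 W = 0"
  shows two_torsion_square: "- (y^2) = x^3 + w2 W * x^2 + w4 W * x + w6 W"
    and two_torsion_cubic: "4 * x^3 + inv_b2 W * x^2 + 2 * inv_b4 W * x + inv_b6 W = 0"
    and two_torsion_discr:
      "16 * (l^2 * (3 * x^2 + 2 * (w2 W + (w1 W)^2 / 4) * x + (w4 W + w1 W * w3 W / 2)))^2 *
      ((l * (3 * x + (w2 W + (w1 W)^2 / 4)))^2 -
        4 * (l^2 * (3 * x^2 + 2 * (w2 W + (w1 W)^2 / 4) * x + (w4 W + w1 W * w3 W / 2)))) =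
      l^6 * discr W"
proof -
  have e: "w1 W * x + w3 W = - (2 * y)" using tors by (simp add: add_eq_0_iff2 add.assoc)
  have "y^2 + w1 W * x * y + w3 W * y = y^2 + (w1 W * x + w3 W) * y" by (simp add: algebra_simps)
  also have "\<dots> = - (y^2)" unfolding e by (simp add: power2_eq_square)
  finally show 1: "- (y^2) = x^3 + w2 W * x^2 + w4 W * x + w6 W" using eq by simp
  have "4 * x^3 + inv_b2 W * x^2 + 2 * inv_b4 W * x + inv_b6 W =
      4 * (x^3 + w2 W * x^2 + w4 W * x + w6 W) + (w1 W * x + w3 W)^2"
    unfolding inv_b2_def inv_b4_def inv_b6_def by (simp add: algebra_simps power2_eq_square)
  also have "\<dots> = 0" unfolding e 1[symmetric] by (simp add: power2_eq_square)
  finally show "4 * x^3 + inv_b2 W * x^2 + 2 * inv_b4 W * x + inv_b6 W = 0" .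
  define A B where A: "A = 3 * x + (w2 W + (w1 W)^2 / 4)"
    and B: "B = 3 * x^2 + 2 * (w2 W + (w1 W)^2 / 4) * x + (w4 W + w1 W * w3 W / 2)"
  have "discr W = discr (change_eq 1 x (- w1 W / 2) y W)" by (simp add: discr_change_eq)
  also have "\<dots> = discr (E_ab A B)"
    unfolding change_eq_two_torsion[OF eq tors] A B by simp
  finally have D: "discr W = 16 * B^2 * (A^2 - 4 * B)" unfolding discr_E_ab .
  show "16 * (l^2 * (3 * x^2 + 2 * (w2 W + (w1 W)^2 / 4) * x + (w4 W + w1 W * w3 W / 2)))^2 *
      ((l * (3 * x + (w2 W + (w1 W)^2 / 4)))^2 -
        4 * (l^2 * (3 * x^2 + 2 * (w2 W + (w1 W)^2 / 4) * x + (w4 W + w1 W * w3 W / 2)))) =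
      l^6 * discr W"
    unfolding A[symmetric] B[symmetric] D by (simp add: power_mult_distrib algebra_simps flip: power_mult power_add)
qed

section \<open>Discretely valued subfields\<close>

locale valued_field =
  fixes K :: "complex set" and v :: "complex \<Rightarrow> int"
  assumes one_in: "1 \<in> K"
    and add_in: "x \<in> K \<Longrightarrow> y \<in> K \<Longrightarrow> x + y \<in> K"
    and uminus_in: "x \<in> K \<Longrightarrow> - x \<in> K"
    and mult_in: "x \<in> K \<Longrightarrow> y \<in> K \<Longrightarrow> x * y \<in> K"
    and inverse_in: "x \<in> K \<Longrightarrow> inverse x \<in> K"
    and v_mult: "x \<in> K \<Longrightarrow> y \<in> K \<Longrightarrow> x \<noteq> 0 \<Longrightarrow> y \<noteq> 0 \<Longrightarrow> v (x * y) = v x + v y"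
    and v_add: "x \<in> K \<Longrightarrow> y \<in> K \<Longrightarrow> x \<noteq> 0 \<Longrightarrow> y \<noteq> 0 \<Longrightarrow> x + y \<noteq> 0 \<Longrightarrow> min (v x) (v y) \<le> v (x + y)"
begin

text \<open>Nothing is known about \<open>v 0\<close>, so zero is made to satisfy every lower bound
  and, in \<open>val_is\<close>, no exact value. Coefficients that may vanish are then handled
  without case distinctions.\<close>

definition val_ge :: "int \<Rightarrow> complex \<Rightarrow> bool" where
  "val_ge n x \<longleftrightarrow> x \<in> K \<and> (x = 0 \<or> n \<le> v x)"

definition val_is :: "int \<Rightarrow> complex \<Rightarrow> bool" where
  "val_is n x \<longleftrightarrow> x \<in> K \<and> x \<noteq> 0 \<and> v x = n"

lemma zero_in: "0 \<in> K"
  using add_in[OF one_in uminus_in[OF one_in]] by simp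

lemma v_one: "v 1 = 0"
  using v_mult[OF one_in one_in] by simp

lemma v_uminus:
  assumes "x \<in> K"
  shows "v (- x) = v x"
proof (cases "x = 0")
  case False
  have "v (-1) = 0" using v_mult[OF uminus_in uminus_in, OF one_in one_in] v_one by simp
  then show ?thesis using v_mult[OF uminus_in[OF one_in] assms] False by simp
qed simp

lemma val_is_imp_ge: "val_is n x \<Longrightarrow> m \<le> n \<Longrightarrow> val_ge m x"
  by (simp add: val_is_def val_ge_def)

lemma val_ge_mono: "val_ge n x \<Longrightarrow> m \<le> n \<Longrightarrow> val_ge m x"
  by (auto simp: val_ge_def)

lemma val_ge_0: "val_ge n 0"
  by (simp add: val_ge_def zero_in)

lemma val_is_valuation: "x \<in> K \<Longrightarrow> x \<noteq> 0 \<Longrightarrow> val_is (v x) x"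
  by (simp add: val_is_def)

lemma val_ge_uminus: "val_ge n x \<Longrightarrow> val_ge n (- x)"
  by (auto simp: val_ge_def uminus_in v_uminus)

lemma val_is_uminus: "val_is n x \<Longrightarrow> val_is n (- x)"
  by (auto simp: val_is_def uminus_in v_uminus)

lemma val_ge_add:
  assumes "val_ge n x" "val_ge n y"
  shows "val_ge n (x + y)"
proof (cases "x = 0 \<or> y = 0 \<or> x + y = 0")
  case True
  then show ?thesis using assms add_in by (auto simp: val_ge_def)
next
  case False
  then show ?thesis using assms v_add[of x y] by (auto simp: val_ge_def add_in)
qed

lemma val_ge_diff: "val_ge n x \<Longrightarrow> val_ge n y \<Longrightarrow> val_ge n (x - y)"
  using val_ge_add[of n x "- y"] val_ge_uminus by simp

text \<open>If the sum had a larger valuation than \<open>x\<close>, so would \<open>x\<close>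
  itself, being the sum minus \<open>y\<close>.\<close>

lemma val_is_add:
  assumes "val_is n x" "val_ge m y" "n < m"
  shows "val_is n (x + y)"
proof (rule ccontr)
  assume *: "\<not> val_is n (x + y)"
  have "val_ge n y" using assms val_ge_mono by force
  then have "val_ge n (x + y)" using assms val_ge_add val_is_imp_ge by blast
  with * have "val_ge (n + 1) (x + y)" by (auto simp: val_is_def val_ge_def)
  moreover have "val_ge (n + 1) y" using assms val_ge_mono[of m y "n + 1"] by simp
  ultimately have "val_ge (n + 1) (x + y - y)" by (intro val_ge_diff)
  then show False using assms by (auto simp: val_is_def val_ge_def)
qed

lemma val_is_add': "val_is n x \<Longrightarrow> val_ge m y \<Longrightarrow> n < m \<Longrightarrow> val_is n (y + x)"
  using val_is_add by (simp add: add.commute)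

lemma val_is_diff: "val_is n x \<Longrightarrow> val_ge m y \<Longrightarrow> n < m \<Longrightarrow> val_is n (x - y)"
  using val_is_add[of n x m "- y"] val_ge_uminus by simp

lemma val_ge_mult:
  assumes "val_ge n x" "val_ge m y" "k \<le> n + m"
  shows "val_ge k (x * y)"
  using assms by (auto simp: val_ge_def mult_in v_mult)

lemma val_is_mult:
  assumes "val_is n x" "val_is m y"
  shows "val_is (n + m) (x * y)"
  using assms by (auto simp: val_is_def mult_in v_mult)

lemma val_is_1: "val_is 0 1"
  by (simp add: val_is_def one_in v_one)

lemma val_is_power: "val_is n x \<Longrightarrow> val_is (int k * n) (x ^ k)"
proof (induction k)
  case (Suc k)
  then show ?case using val_is_mult[of n x "int k * n" "x ^ k"] by (simp add: algebra_simps)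
qed (simp add: val_is_1)

lemma val_ge_power: "val_ge n x \<Longrightarrow> val_ge (int k * n) (x ^ k)"
proof (induction k)
  case 0
  then show ?case using val_is_1 val_is_imp_ge by simp
next
  case (Suc k)
  then show ?case using val_ge_mult[of n x "int k * n" "x ^ k"] by (simp add: algebra_simps)
qed

lemma val_is_square: "val_is n x \<Longrightarrow> val_is (2 * n) (x ^ 2)"
  using val_is_power[of n x 2] by simp

lemma val_ge_square: "val_ge n x \<Longrightarrow> val_ge (2 * n) (x ^ 2)"
  using val_ge_power[of n x 2] by simp

lemma val_is_inverse:
  assumes "val_is n x"
  shows "val_is (- n) (inverse x)"
proof -
  have "v (x * inverse x) = v x + v (inverse x)"
    using assms by (intro v_mult) (auto simp: val_is_def inverse_in)
  then show ?thesis using assms by (auto simp: val_is_def inverse_in v_one)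
qed

lemma val_is_divide: "val_is n x \<Longrightarrow> val_is m y \<Longrightarrow> val_is (n - m) (x / y)"
  using val_is_mult[of n x "- m" "inverse y"] val_is_inverse by (simp add: divide_inverse)

lemma val_ge_divide: "val_ge n x \<Longrightarrow> val_is m y \<Longrightarrow> val_ge (n - m) (x / y)"
  using val_ge_mult[of n x "- m" "inverse y" "n - m"] val_is_imp_ge[OF val_is_inverse, of m y "- m"]
  by (simp add: divide_inverse)

lemma val_is_unique: "val_is n x \<Longrightarrow> val_is m x \<Longrightarrow> n = m"
  by (simp add: val_is_def)

lemma val_is_ge: "val_is n x \<Longrightarrow> val_ge m x \<Longrightarrow> m \<le> n"
  by (auto simp: val_is_def val_ge_def)

lemma val_ge_of_int: "val_ge 0 (of_int n)"
proof -
  have nat: "val_ge 0 (of_nat k)" for k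
    using val_is_imp_ge[OF val_is_1] by (induction k) (auto intro: val_ge_add val_ge_0)
  show ?thesis
  proof (cases n)
    case (nonneg k)
    then show ?thesis using nat by simp
  next
    case (neg k)
    then show ?thesis using val_ge_uminus[OF nat[of "Suc k"]] by simp
  qed
qed

lemma val_ge_numeral: "val_ge 0 (numeral n)"
  using val_ge_of_int[of "numeral n"] by simp

lemma val_ge_integral:
  "val_ge 0 x \<Longrightarrow> val_ge 0 y \<Longrightarrow> val_ge 0 (x * y)"
  "val_ge 0 x \<Longrightarrow> val_ge 0 (x ^ k)"
  using val_ge_mult[of 0 x 0 y 0] val_ge_power[of 0 x k] by auto

lemmas val_ge_integralI = val_ge_add val_ge_diff val_ge_integral val_ge_numeral val_ge_uminus

lemma val_ge_inv_b:
  assumes "val_ge 0 (w1 W)" "val_ge 0 (w2 W)" "val_ge 0 (w3 W)" "val_ge 0 (w4 W)" "val_ge 0 (w6 W)"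
  shows "val_ge 0 (inv_b2 W)" "val_ge 0 (inv_b4 W)" "val_ge 0 (inv_b6 W)" "val_ge 0 (inv_b8 W)"
    "val_ge 0 (discr W)"
proof -
  show b: "val_ge 0 (inv_b2 W)" "val_ge 0 (inv_b4 W)" "val_ge 0 (inv_b6 W)" "val_ge 0 (inv_b8 W)"
    unfolding inv_b2_def inv_b4_def inv_b6_def inv_b8_def
    by (intro val_ge_integralI assms)+
  show "val_ge 0 (discr W)"
    unfolding discr_def by (intro val_ge_integralI b)
qed

lemma val_is_cases:
  assumes "val_ge n x"
  shows "val_is n x \<or> val_ge (n + 1) x"
  using assms by (auto simp: val_is_def val_ge_def)

lemma val_ge_sqrt: "x \<in> K \<Longrightarrow> val_ge (2 * n) (x^2) \<Longrightarrow> val_ge n x"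
  by (auto simp: val_ge_def power2_eq_square v_mult)

lemma val_is_sqrt: "x \<in> K \<Longrightarrow> val_is m (x^2) \<Longrightarrow> val_is (v x) x \<and> m = 2 * v x"
  by (auto simp: val_is_def power2_eq_square v_mult)

lemma val_is_cong: "val_is n x \<Longrightarrow> x = y \<Longrightarrow> n = m \<Longrightarrow> val_is m y"
  by simp

lemma val_is_ge_mult: "val_is n x \<Longrightarrow> val_ge m y \<Longrightarrow> val_ge (n + m) (x * y)"
  using val_ge_mult[OF val_is_imp_ge[of n x n], of m y "n + m"] by simp

lemma val_ge_cong: "val_ge n x \<Longrightarrow> x = y \<Longrightarrow> m \<le> n \<Longrightarrow> val_ge m y"
  using val_ge_mono by blast

lemma square_in: "x \<in> K \<Longrightarrow> x^2 \<in> K"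
  by (simp add: power2_eq_square mult_in)

lemma diff_in: "x \<in> K \<Longrightarrow> y \<in> K \<Longrightarrow> x - y \<in> K"
  using add_in[of x "- y"] uminus_in by simp

lemma val_is_4: "val_is e 2 \<Longrightarrow> val_is (2 * e) 4"
  using val_is_power[of e 2 2] by simp

lemma val_is_3:
  assumes "val_is e 2" "0 < e"
  shows "val_is 0 3"
  using val_is_add[OF val_is_1, of e 2] assms val_is_imp_ge by simp

lemma val_is_mult_cancel:
  assumes "val_is n (x * y)" "val_is m x" "y \<in> K"
  shows "val_is (n - m) y"
  using assms by (auto simp: val_is_def v_mult)

text \<open>Here \<open>c\<close> stands for a^2 - 4b, and \<open>4 * e\<close> is the valuation of
  16. Above 2 this is applied with \<open>k = 0\<close>, at odd primes with \<open>e = 0\<close> and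
  \<open>n = 0\<close>; in each case it turns one known valuation into the other.\<close>

lemma val_discr_E_ab:
  assumes "b \<in> K" "c \<in> K" "16 * b^2 * c = l^6 * D" "val_is e 2" "val_is n l" "val_is k D"
  shows "val_is (v b) b" "val_is (v c) c" "4 * e + 2 * v b + v c = 6 * n + k"
proof -
  have r: "val_is (6 * n + k) (16 * b^2 * c)"
    unfolding assms(3) using val_is_mult[OF val_is_power[OF assms(5), of 6] assms(6)] by simp
  then have "b \<noteq> 0" "c \<noteq> 0" by (auto simp: val_is_def)
  then show bc: "val_is (v b) b" "val_is (v c) c" using assms by (auto simp: val_is_def)
  have "val_is (4 * e) 16" using val_is_power[OF assms(4), of 4] by simp
  then have "val_is (4 * e + 2 * v b + v c) (16 * b^2 * c)"
    using val_is_mult[OF val_is_mult val_is_power[of "v c" c 1]] val_is_square[OF bc(1)] bc(2)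
    by simp
  then show "4 * e + 2 * v b + v c = 6 * n + k" using r val_is_unique by blast
qed

text \<open>Here \<beta>, \<delta> and \<open>min \<beta> \<delta>\<close> are the valuations of b,
  a^2 - 4b and P. If \<beta> and \<delta> differ, then a^2 has valuation
  \<open>min \<beta> \<delta>\<close>, which is therefore even, and minimality leaves only 0 and 2.
  The value 2 is contained three times in \<open>k = 2 * \<beta> + \<delta>\<close> and produces k -
  6.\<close>

lemma val_odd_triple:
  assumes "a \<in> K" and two: "val_is 0 2"
    and b: "val_is \<beta> b" and c: "val_is \<delta> (a^2 - 4 * b)" and nonneg: "0 \<le> \<beta>" "0 \<le> \<delta>"
    and minimal: "\<not> (val_ge 2 a \<and> val_ge 4 b)"
    and A: "0 \<le> vA" "vA \<le> 1" "vA + 2 * vs = min \<beta> \<delta>" and k: "k = 2 * \<beta> + \<delta>"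
    and B: "vB = \<delta> - min \<beta> \<delta>" and C: "vC = \<beta> - min \<beta> \<delta>"
  shows "vA = 0 \<and> vB = k \<and> vC = 0 \<or> vA = 0 \<and> vB = k - 6 \<and> vC = 0 \<or>
    vA = 0 \<and> vB = 0 \<and> 2 * vC = k \<or> vA = 0 \<and> vB = 0 \<and> 2 * vC = k - 6 \<or>
    vA = 1 \<and> vB = 0 \<and> vC = 0"
proof -
  have b4: "val_is \<beta> (4 * b)" using val_is_mult[OF val_is_4[OF two] b] by simp
  show ?thesis
  proof (cases "\<beta> = \<delta>")
    case False
    have "val_is (min \<beta> \<delta>) (a^2 - 4 * b + 4 * b)"
    proof (cases "\<beta> < \<delta>")
      case True
      then have "val_is \<beta> (a^2 - 4 * b + 4 * b)"
        by (intro val_is_add'[OF b4 val_is_imp_ge[OF c order.refl]])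
      then show ?thesis using True by simp
    next
      case *: False
      then have "\<delta> < \<beta>" using False by simp
      then have "val_is \<delta> (a^2 - 4 * b + 4 * b)"
        by (intro val_is_add[OF c val_is_imp_ge[OF b4 order.refl]])
      then show ?thesis using \<open>\<delta> < \<beta>\<close> by simp
    qed
    then have "val_is (min \<beta> \<delta>) (a^2)" by simp
    then have a: "val_is (v a) a" "min \<beta> \<delta> = 2 * v a" using val_is_sqrt assms(1) by blast+
    \<comment> \<open>Since \<open>min \<beta> \<delta> = 2 * v a\<close>, a valuation of a at least
      2 would also make that of b at least 4.\<close>
    have "v a < 2"
    proof (rule ccontr)
      assume "\<not> v a < 2"
      then have "val_ge 2 a" "val_ge 4 b" using a b by (auto intro: val_is_imp_ge)
      with minimal show False by blast
    qed
    moreover have "0 \<le> min \<beta> \<delta>" using nonneg by simp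
    ultimately have "v a = 0 \<or> v a = 1" using a(2) by linarith
    then have m: "min \<beta> \<delta> = 0 \<or> min \<beta> \<delta> = 2" using a(2) by auto
    have "vA = 0" using A a(2) by presburger
    with m show ?thesis using False B C k by (auto simp: min_def split: if_splits)
  next
    case True
    have "val_ge \<beta> (a^2 - 4 * b + 4 * b)"
      using b4 c True by (intro val_ge_add val_is_imp_ge) auto
    then have sq: "val_ge \<beta> (a^2)" by simp
    have "\<beta> < 4"
    proof (rule ccontr)
      assume "\<not> \<beta> < 4"
      then have "val_ge 4 (a^2)" "val_ge 4 b" using val_ge_mono[OF sq] val_is_imp_ge[OF b] by auto
      then show False using minimal val_ge_sqrt[of a 2] assms(1) by auto
    qed
    \<comment> \<open>Now \<open>k = 3 * \<beta>\<close> and \<open>vB = vC = 0\<close>. For \<beta>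
      = 0 and \<beta> = 2 the triple (0, 0, 0) is listed as \<open>vB = k\<close> and as
      \<open>vB = k - 6\<close>; for odd \<beta> the square-free part A has valuation 1.\<close>
    then have "\<beta> = 0 \<or> \<beta> = 1 \<or> \<beta> = 2 \<or> \<beta> = 3" using nonneg by linarith
    moreover have "vA = \<beta> mod 2" using A True by simp presburger
    ultimately show ?thesis using B C k True by auto
  qed
qed

end

section \<open>The point of order two at a prime above 2\<close>

locale two_torsion_at_two = valued_field +
  fixes W :: weierstrass and x y :: complex and e :: int
  assumes w_int: "val_ge 0 (w1 W)" "val_ge 0 (w2 W)" "val_ge 0 (w3 W)" "val_ge 0 (w4 W)" "val_ge 0 (w6 W)"
    and xy: "x \<in> K" "y \<in> K"
    and curve: "y^2 + w1 W * x * y + w3 W * y = x^3 + w2 W * x^2 + w4 W * x + w6 W"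
    and tors: "2 * y + w1 W * x + w3 W = 0"
    and two: "val_is e 2" "0 < e"
    and good: "val_is 0 (discr W)"
begin

definition f2 where "f2 = w2 W + (w1 W)^2 / 4"
definition f4 where "f4 = w4 W + w1 W * w3 W / 2"
definition f6 where "f6 = w6 W + (w3 W)^2 / 4"

lemma f_inv_b: "f2 = inv_b2 W / 4" "f4 = inv_b4 W / 2" "f6 = inv_b6 W / 4"
  unfolding f2_def f4_def f6_def by (simp_all add: inv_b2_def inv_b4_def inv_b6_def add_divide_distrib)

lemmas four = val_is_4[OF two(1)]
lemmas three = val_is_3[OF two]
lemmas b_int = val_ge_inv_b[OF w_int]

lemma f_in: "f2 \<in> K" "f4 \<in> K"
  using val_ge_divide[OF b_int(1) four] val_ge_divide[OF b_int(2) two(1)]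
  unfolding f_inv_b by (auto simp: val_ge_def)

lemma model_in:
  assumes "l \<in> K"
  shows "l * (3 * x + f2) \<in> K" "l^2 * (3 * x^2 + 2 * f2 * x + f4) \<in> K"
proof -
  have "2 \<in> K" "3 \<in> K" using val_ge_numeral by (auto simp: val_ge_def)
  note nums = this
  have in3: "3 * x + f2 \<in> K"
    by (rule add_in[OF mult_in[OF nums(2) xy(1)] f_in(1)])
  have in4: "3 * x^2 + 2 * f2 * x + f4 \<in> K"
    by (rule add_in[OF add_in[OF mult_in[OF nums(2) square_in[OF xy(1)]]
        mult_in[OF mult_in[OF nums(1) f_in(1)] xy(1)]] f_in(2)])
  show "l * (3 * x + f2) \<in> K" by (rule mult_in[OF assms in3])
  show "l^2 * (3 * x^2 + 2 * f2 * x + f4) \<in> K" by (rule mult_in[OF square_in[OF assms] in4])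
qed

text \<open>As 4 is divisible by the prime, b2 = a1^2 + 4 a2 is a unit. The scaling exponent is
  determined by the exact valuation of \<open>f2\<close>; for \<open>f4\<close> and
  \<open>f6\<close> lower bounds are enough.\<close>

lemma ordinary_f:
  assumes "val_is 0 (w1 W)"
  shows "val_is 0 (inv_b2 W)" "val_is (- 2 * e) f2" "val_ge (- e) f4" "val_ge (- 2 * e) f6"
proof -
  have "val_is 0 ((w1 W)^2)" using val_is_square[OF assms] by simp
  moreover have "val_ge (2 * e) (4 * w2 W)" using val_is_ge_mult[OF four w_int(2)] by simp
  ultimately show b2: "val_is 0 (inv_b2 W)"
    unfolding inv_b2_def using two by (intro val_is_add[of 0 _ "2 * e"]) auto
  show "val_is (- 2 * e) f2" "val_ge (- e) f4" "val_ge (- 2 * e) f6"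
    unfolding f_inv_b using val_is_divide[OF b2 four] val_ge_divide[OF b_int(2) two(1)]
      val_ge_divide[OF b_int(3) four] by simp_all
qed

text \<open>A Newton polygon argument for 4x^3 + b2 x^2 + 2 b4 x + b6: at negative v(x) = n the
  first two terms, of valuations 2e + 3n and 2n, have to cancel, since otherwise the smaller of the
  two lies strictly below all other terms.\<close>

lemma ordinary_root:
  assumes ord: "val_is 0 (w1 W)"
  shows "val_ge 0 x \<or> val_is (- 2 * e) x"
proof (cases "val_ge 0 x")
  case False
  define n where "n = v x"
  have x: "val_is n x" "n < 0" using False xy by (auto simp: val_ge_def val_is_def n_def)
  have t3: "val_is (2 * e + 3 * n) (4 * x^3)"
    using val_is_mult[OF four val_is_power[OF x(1), of 3]] by simp
  have t2: "val_is (2 * n) (inv_b2 W * x^2)"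
    using val_is_mult[OF ordinary_f(1)[OF ord] val_is_square[OF x(1)]] by simp
  have t1: "val_ge (e + n) (2 * inv_b4 W * x)"
    using val_is_ge_mult[OF x(1) val_is_ge_mult[OF two(1) b_int(2)]] by (simp add: ac_simps)
  have zero: "4 * x^3 + inv_b2 W * x^2 + (2 * inv_b4 W * x + inv_b6 W) = 0"
    using two_torsion_cubic[OF curve tors] by (simp only: add.assoc)
  have "2 * e + 3 * n = 2 * n"
  proof (rule ccontr)
    assume "2 * e + 3 * n \<noteq> 2 * n"
    then consider "2 * n < 2 * e + 3 * n" | "2 * e + 3 * n < 2 * n" by linarith
    then have "\<exists>m. val_is m (4 * x^3 + inv_b2 W * x^2) \<and> m < e + n \<and> m < 0"
    proof cases
      case 1
      then show ?thesis
        using val_is_add'[OF t2 val_is_imp_ge[OF t3 order.refl]] x(2) two(2)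
        by (intro exI[of _ "2 * n"]) auto
    next
      case 2
      then show ?thesis
        using val_is_add[OF t3 val_is_imp_ge[OF t2 order.refl]] x(2) two(2)
        by (intro exI[of _ "2 * e + 3 * n"]) auto
    qed
    then obtain m where m: "val_is m (4 * x^3 + inv_b2 W * x^2)" "m < e + n" "m < 0" by blast
    have low: "val_ge (min (e + n) 0) (2 * inv_b4 W * x + inv_b6 W)"
      by (intro val_ge_add val_ge_mono[OF t1] val_ge_mono[OF b_int(3)]) auto
    have "val_is m (4 * x^3 + inv_b2 W * x^2 + (2 * inv_b4 W * x + inv_b6 W))"
      by (rule val_is_add[OF m(1) low]) (use m(2,3) in simp)
    then show False unfolding zero by (simp add: val_is_def)
  qed
  then have "n = - 2 * e" by simp
  with x show ?thesis by simp
qed simp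

text \<open>One coefficient is dominated by a single term in each case: for integral x the term
  \<open>f2\<close> makes a a unit, for v(x) = -2e the term 3x^2 makes b a unit. The other
  valuations follow from the discriminant and from a^2 = c + 4b.\<close>

lemma ordinary_model:
  assumes ord: "val_is 0 (w1 W)" and l: "val_is (2 * e) l"
    and a: "a = l * (3 * x + f2)" and b: "b = l^2 * (3 * x^2 + 2 * f2 * x + f4)"
  shows "val_is 0 a \<and> val_is (4 * e) b \<and> val_is 0 (a^2 - 4 * b) \<or>
    val_is e a \<and> val_is 0 b \<and> val_is (8 * e) (a^2 - 4 * b)"
proof -
  have "l \<in> K" using l by (simp add: val_is_def)
  note K = model_in[OF this, folded a b]
  have "4 \<in> K" using four by (simp add: val_is_def)
  then have cK: "a^2 - 4 * b \<in> K" using K by (intro diff_in mult_in square_in)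
  note disc = val_discr_E_ab[OF K(2) cK two_torsion_discr[OF curve tors, of l, folded f2_def f4_def, folded a b] two(1) l good]
  note f = ordinary_f[OF ord]
  have l2: "val_is (4 * e) (l^2)" using val_is_square[OF l] by simp
  have f2x: "val_ge (e + (- 2 * e) + n) (2 * f2 * x)" if "val_ge n x" for n
    using val_is_ge_mult[OF val_is_mult[OF two(1) f(2)] that] .
  have x2: "val_ge (2 * n) (3 * x^2)" if "val_ge n x" for n
    using val_is_ge_mult[OF three val_ge_square[OF that]] by simp
  from ordinary_root[OF ord] show ?thesis
  proof
    assume x: "val_ge 0 x"
    have "val_ge 0 (3 * x)" using val_ge_mult[OF val_ge_numeral x] by simp
    then have m2: "val_is (- 2 * e) (3 * x + f2)"
      by (rule val_is_add'[OF f(2)]) (use two(2) in simp)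
    then have a0: "val_is 0 a" using val_is_mult[OF l m2] a by simp
    have low: "val_ge (- e) (3 * x^2 + 2 * f2 * x + f4)"
      using two(2) by (intro val_ge_add f(3) val_ge_mono[OF x2[OF x]] val_ge_mono[OF f2x[OF x]]) auto
    have "val_ge 0 b" unfolding b
      by (rule val_ge_mono[OF val_is_ge_mult[OF l2 low]]) (use two(2) in simp)
    then have "val_ge (2 * e) (4 * b)" using val_is_ge_mult[OF four, of 0 b] by simp
    then have c0: "val_is 0 (a^2 - 4 * b)"
      using val_is_square[OF a0] two(2) by (intro val_is_diff[of 0 _ "2 * e"]) auto
    then have "v (a^2 - 4 * b) = 0" by (simp add: val_is_def)
    \<comment> \<open>The direct estimate bounds v(b) only from below; the exact value solves 4e + 2
      v(b) = 6 * 2e.\<close>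
    then have "v b = 4 * e" using disc(3) by simp
    then show ?thesis using a0 c0 disc(1) by simp
  next
    assume x: "val_is (- 2 * e) x"
    then have xg: "val_ge (- 2 * e) x" by (rule val_is_imp_ge) simp
    have "val_is (- 4 * e) (3 * x^2)" using val_is_mult[OF three val_is_square[OF x]] by simp
    moreover have "val_ge (- 3 * e) (2 * f2 * x)" using f2x[OF xg] by simp
    ultimately have "val_is (- 4 * e) (3 * x^2 + 2 * f2 * x)"
      by (rule val_is_add) (use two(2) in simp)
    then have m4: "val_is (- 4 * e) (3 * x^2 + 2 * f2 * x + f4)"
      by (rule val_is_add[OF _ f(3)]) (use two(2) in simp)
    have b0: "val_is 0 b" using val_is_mult[OF l2 m4] b by simp
    then have "v b = 0" by (simp add: val_is_def)
    \<comment> \<open>From 4e + v(c) = 12e, as b is a unit.\<close>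
    then have c0: "val_is (8 * e) (a^2 - 4 * b)" using disc(2,3) by simp
    have "val_is (2 * e) (4 * b)" using val_is_mult[OF four b0] by simp
    then have "val_is (2 * e) (a^2 - 4 * b + 4 * b)"

      by (rule val_is_add'[OF _ val_is_imp_ge[OF c0 order.refl]]) (use two(2) in simp)
    then have "val_is (2 * e) (a^2)" by simp
    then have "val_is e a" using val_is_sqrt[of a "2 * e"] K by auto
    then show ?thesis using b0 c0 by simp
  qed
qed

text \<open>Comparing valuations in 2y + a1 x + a3 = 0 at a non-integral point yields v(a1) + m = e,
  where m is the valuation of x/y. Both summands are positive and e is at most 2, so all the
  valuations are determined.\<close>

lemma supersingular_root:
  assumes ss: "val_ge 1 (w1 W)" and e2: "e \<le> 2"
  shows "e = 2" "val_is 1 (w1 W)" "val_is 0 (w3 W)" "val_is (- 2) x"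
proof -
  show w3: "val_is 0 (w3 W)"
  proof (rule ccontr)
    assume "\<not> val_is 0 (w3 W)"
    \<comment> \<open>In this case b2, b4 and b6 all have positive valuation; each term of the
      discriminant contains one of them, so it could not be a unit.\<close>
    then have w3: "val_ge 1 (w3 W)" using val_is_cases[OF w_int(3)] by simp
    have four1: "val_ge 1 (4 * z)" if "val_ge 0 z" for z
      by (rule val_ge_mono[OF val_is_ge_mult[OF four that]]) (use two(2) in simp)
    have two1: "val_ge 1 (2 * z)" if "val_ge 0 z" for z
      by (rule val_ge_mono[OF val_is_ge_mult[OF two(1) that]]) (use two(2) in simp)
    have sq: "val_ge 1 (z^2)" if "val_ge 1 z" for z
      by (rule val_ge_mono[OF val_ge_square[OF that]]) simp
    have mult1: "val_ge 1 (z * z')" if "val_ge 1 z" "val_ge 0 z'" for z z'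
      using val_ge_mult[OF that] by simp
    have b2: "val_ge 1 (inv_b2 W)"
      unfolding inv_b2_def by (intro val_ge_add sq ss four1 w_int)
    have b4: "val_ge 1 (inv_b4 W)"
      unfolding inv_b4_def by (intro val_ge_add mult1[OF ss] two1 w_int)
    have b6: "val_ge 1 (inv_b6 W)"
      unfolding inv_b6_def by (intro val_ge_add sq w3 four1 w_int)
    have "val_ge 1 (discr W)"
      unfolding discr_def
    proof (intro val_ge_add val_ge_diff val_ge_uminus)
      show "val_ge 1 ((inv_b2 W)^2 * inv_b8 W)" by (intro mult1 sq b2 b_int)
      show "val_ge 1 (8 * inv_b4 W ^ 3)"
        using mult1[OF b4 val_ge_integral(2)[OF b_int(2), of 2]]
          mult1[of "inv_b4 W ^ 3" 8] val_ge_numeral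
        by (simp add: power3_eq_cube power2_eq_square mult_ac)
      show "val_ge 1 (27 * (inv_b6 W)^2)"
        using mult1[OF sq[OF b6], of 27] val_ge_numeral by (simp add: mult_ac)
      show "val_ge 1 (9 * inv_b2 W * inv_b4 W * inv_b6 W)"
        using mult1[OF b6, of "9 * inv_b2 W * inv_b4 W"] val_ge_numeral b_int
        by (simp add: mult_ac val_ge_integral)
    qed
    then show False using val_is_ge[OF good, of 1] by simp
  qed
  have e_y: "w1 W * x + w3 W = - (2 * y)" using tors by (simp add: add_eq_0_iff2 add.assoc)
  have not_int: "\<not> val_ge 0 x"
  proof
    \<comment> \<open>For integral x the number 2y = -(a1 x + a3) is a unit, so y^2 has valuation
      -2e; but -y^2 is the value of an integral cubic at x.\<close>
    assume x: "val_ge 0 x"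
    have "val_ge 1 (w1 W * x)" using val_ge_mult[OF ss x] by simp
    then have "val_is 0 (- (2 * y))" unfolding e_y[symmetric] by (intro val_is_add'[OF w3, of 1]) auto
    then have "val_is 0 (2 * y)" using val_is_uminus[of 0 "- (2 * y)"] by simp
    then have "val_is (- e) y" using val_is_mult_cancel[OF _ two(1) xy(2), of 0] by simp
    then have "val_is (- 2 * e) (- (y^2))" using val_is_uminus[OF val_is_square, of "- e" y] by simp
    moreover have "val_ge 0 (- (y^2))"
      unfolding two_torsion_square[OF curve tors] by (intro val_ge_integralI x w_int)
    ultimately show False using val_is_ge[of "- 2 * e" "- (y^2)" 0] two(2) by simp
  qed
  define n where "n = v x"
  have x: "val_is n x" "n < 0" using not_int xy by (auto simp: val_ge_def val_is_def n_def)
  have c3: "val_is (3 * n) (x^3)" using val_is_power[OF x(1), of 3] by simp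
  have c2: "val_ge (2 * n) (w2 W * x^2)"
    using val_is_ge_mult[OF val_is_square[OF x(1)] w_int(2)] by (simp add: ac_simps)
  have c1: "val_ge n (w4 W * x)"
    using val_is_ge_mult[OF x(1) w_int(4)] by (simp add: ac_simps)
  have "val_is (3 * n) (x^3 + w2 W * x^2 + w4 W * x + w6 W)"
    using x(2) by (intro val_is_add[OF val_is_add[OF val_is_add[OF c3 c2] c1] w_int(5)]) auto
  then have "val_is (3 * n) (y^2)"
    unfolding two_torsion_square[OF curve tors, symmetric] using val_is_uminus[of "3 * n" "- (y^2)"] by simp
  then have y: "val_is (v y) y" "3 * n = 2 * v y" using val_is_sqrt xy by blast+
  \<comment> \<open>The valuation of x/y, the local parameter at the zero of the curve; 3 v(x) = 2
    v(y) gives v(x) = -2m and v(y) = -3m.\<close>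
  define m where "m = n - v y"
  have m: "n = - 2 * m" "v y = - 3 * m" "m \<ge> 1" using y(2) x(2) m_def by auto
  have sum: "val_is (e - 3 * m) (w1 W * x + w3 W)"
    unfolding e_y using val_is_uminus[OF val_is_mult[OF two(1) y(1)]] m(2) by simp
  \<comment> \<open>Here e - 3m is negative because e is at most 2 and m at least 1. As a3 is
    integral, the term a1 x must account for the negative valuation.\<close>
  have "\<not> val_ge 0 (w1 W * x + w3 W)"
    using val_is_ge[OF sum, of 0] e2 m(3) by auto
  then have "\<not> val_ge 0 (w1 W * x)" using val_ge_add w_int(3) by blast
  then have nz: "w1 W \<noteq> 0" using val_ge_0 by auto
  define g where "g = v (w1 W)"
  have g: "val_is g (w1 W)" "g \<ge> 1" using nz ss by (auto simp: g_def val_is_def val_ge_def)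
  have w1x: "val_is (g - 2 * m) (w1 W * x)" using val_is_mult[OF g(1) x(1)] m(1) by simp
  have "g - 2 * m < 0" using val_is_imp_ge[OF w1x, of 0] \<open>\<not> val_ge 0 (w1 W * x)\<close> by linarith
  then have "val_is (g - 2 * m) (w1 W * x + w3 W)"
    by (intro val_is_add[OF w1x w_int(3)])
  \<comment> \<open>That is, g + m = e.\<close>
  then have "g - 2 * m = e - 3 * m" using sum val_is_unique by blast
  with g(2) e2 m(3) have "m = 1" "e = 2" "g = 1" by linarith+
  then show "e = 2" "val_is 1 (w1 W)" "val_is (- 2) x" using g x m(1) by simp_all
qed

text \<open>With v(a1) = 1 and e = 2, the term a1^2 of valuation 2 dominates 4 a2 in b2. The exact
  valuation of \<open>f2\<close>, again decisive for the scaling exponent, is thus 2 - 4.\<close>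

lemma supersingular_f:
  assumes ss: "val_ge 1 (w1 W)" and e2: "e \<le> 2"
  shows "val_is (- 2) f2" "val_ge (- 1) f4" "val_ge (- 4) f6"
proof -
  note r = supersingular_root[OF assms]
  have "val_ge 4 (4 * w2 W)" using val_is_ge_mult[OF four w_int(2)] r(1) by simp
  moreover have "val_is 2 ((w1 W)^2)" using val_is_square[OF r(2)] by simp
  ultimately have "val_is 2 (inv_b2 W)" unfolding inv_b2_def by (intro val_is_add[of 2 _ 4]) auto
  then show "val_is (- 2) f2" unfolding f_inv_b using val_is_divide[OF _ four, of 2] r(1) by simp
  have "val_ge 1 (2 * w4 W)" "val_ge 1 (w1 W * w3 W)"
    using val_ge_cong[OF val_is_ge_mult[OF two(1) w_int(4)], of _ 1] r(1)
      val_ge_mult[OF ss w_int(3), of 1] by simp_all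
  then have "val_ge 1 (inv_b4 W)" unfolding inv_b4_def by (intro val_ge_add)
  then show "val_ge (- 1) f4" unfolding f_inv_b using val_ge_divide[OF _ two(1), of 1] r(1) by simp
  show "val_ge (- 4) f6" unfolding f_inv_b using val_ge_divide[OF b_int(3) four] r(1) by simp
qed

text \<open>The term 3x^2 of valuation -4 dominates, so b is a unit, and the discriminant gives 8 +
  v(c) = 12. For a there is only a bound: c and 4b have the same valuation 4, so their sum a^2 may
  involve cancellation.\<close>

lemma supersingular_model:
  assumes ss: "val_ge 1 (w1 W)" and e2: "e \<le> 2" and l: "val_is 2 l"
    and a: "a = l * (3 * x + f2)" and b: "b = l^2 * (3 * x^2 + 2 * f2 * x + f4)"
  shows "val_ge 2 a" "val_is 0 b" "val_is 4 (a^2 - 4 * b)"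
proof -
  note r = supersingular_root[OF ss e2] and f = supersingular_f[OF ss e2]
  have "l \<in> K" using l by (simp add: val_is_def)
  note K = model_in[OF this, folded a b]
  have "4 \<in> K" using four by (simp add: val_is_def)
  then have cK: "a^2 - 4 * b \<in> K" using K by (intro diff_in mult_in square_in)
  note disc = val_discr_E_ab[OF K(2) cK two_torsion_discr[OF curve tors, of l, folded f2_def f4_def, folded a b] two(1) l good]
  have "val_is (- 4) (3 * x^2)" using val_is_mult[OF three val_is_square[OF r(4)]] by simp
  moreover have "val_is (- 2) (2 * f2 * x)"
    using val_is_mult[OF val_is_mult[OF two(1) f(1)] r(4)] r(1) by simp
  ultimately have "val_is (- 4) (3 * x^2 + 2 * f2 * x)"
    by (rule val_is_add[OF _ val_is_imp_ge[OF _ order.refl]]) simp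
  then have m4: "val_is (- 4) (3 * x^2 + 2 * f2 * x + f4)"
    using f(2) by (rule val_is_add) simp
  show b0: "val_is 0 b" using val_is_mult[OF val_is_square[OF l] m4] b by simp
  then have "v b = 0" by (simp add: val_is_def)
  then show c0: "val_is 4 (a^2 - 4 * b)" using disc(2,3) r(1) by simp
  have "val_is 4 (4 * b)" using val_is_mult[OF four b0] r(1) by simp
  then have "val_ge 4 (a^2 - 4 * b + 4 * b)" using c0 by (intro val_ge_add val_is_imp_ge) auto
  then have "val_ge (2 * 2) (a^2)" by simp
  then show "val_ge 2 a" using val_ge_sqrt K(1) by blast
qed

end

section \<open>Class number one\<close>

context quadratic_field
begin

abbreviation R where "R \<equiv> integers_of K"

lemma R_simps [simp]:
  "x \<otimes>\<^bsub>R\<^esub> y = x * y" "x \<oplus>\<^bsub>R\<^esub> y = x + y" "\<one>\<^bsub>R\<^esub> = 1" "\<zero>\<^bsub>R\<^esub> = 0"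
  by (simp_all add: integers_of_def complex_ring_def ring_of_type_algebra_def)

lemma divides_R: "x divides\<^bsub>R\<^esub> y \<longleftrightarrow> (\<exists>c\<in>\<O>. y = x * c)"
  by (simp add: factor_def)

lemma Units_R: "Units R = {x \<in> \<O>. \<exists>y\<in>\<O>. x * y = 1}"
  by (auto simp: Units_def mult.commute)

lemma domain_R: "domain R"
proof (intro domain.intro cringI domain_axioms.intro)
  show "abelian_group R"
  proof (rule abelian_groupI)
    fix x assume "x \<in> \<O>"
    then show "\<exists>y\<in>\<O>. y \<oplus>\<^bsub>R\<^esub> x = \<zero>\<^bsub>R\<^esub>" by (intro bexI[of _ "- x"]) (auto intro: O_uminus)
  qed (auto intro: O_add O_0)
  show "comm_monoid R" by (rule comm_monoidI) (auto intro: O_mult O_1)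
qed (auto simp: algebra_simps)

lemma unit_iff_norm:
  assumes "x \<in> \<O>"
  shows "x \<in> Units R \<longleftrightarrow> (cmod x)\<^sup>2 = 1"
proof
  assume "x \<in> Units R"
  then obtain y where y: "y \<in> \<O>" "x * y = 1" by (auto simp: Units_R)
  have "cmod x * cmod y = 1" using y(2) by (metis norm_mult norm_one)
  moreover have "cmod x \<ge> 1" "cmod y \<ge> 1" using assms y by (auto intro!: O_norm_ge_1)
  ultimately have "cmod x = 1"
    using mult_left_mono[of 1 "cmod y" "cmod x"] by auto
  then show "(cmod x)\<^sup>2 = 1" by simp
next
  assume "(cmod x)\<^sup>2 = 1"
  then have "x * cnj x = 1" by (metis complex_norm_square of_real_1 of_real_power)
  then show "x \<in> Units R" using assms O_cnj by (auto simp: Units_R)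
qed

end

locale quadratic_pid = quadratic_field +
  assumes class_number: "class_number K = 1"
begin

text \<open>That I and the unit ideal are in the same class gives nonzero \<alpha>, \<beta> with
  \<alpha> times the unit ideal equal to \<beta> I, and \<alpha>/\<beta> is the generator
  sought.\<close>

lemma principal_ideal:
  assumes "ideal I R"
  shows "\<exists>i\<in>\<O>. I = PIdl\<^bsub>R\<^esub> i"
proof (cases "I = {0}")
  case True
  then show ?thesis using O_0 by (intro bexI[of _ 0]) (auto simp: cgenideal_def)
next
  case False
  define S where "S = {I. ideal I R \<and> I \<noteq> {0}}"
  define r where "r = ideal_equivalence R"
  have I: "I \<in> S" using assms False by (simp add: S_def)
  have "1 \<in> \<O>" by (rule O_1)
  then have O: "\<O> \<in> S" using ring.oneideal[OF cring.axioms(1)[OF domain.axioms(1)[OF domain_R]]]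
    by (auto simp: S_def)
  have "card (S // r) = 1" using class_number by (simp add: class_number_def S_def r_def)
  then obtain Cl where Cl: "S // r = {Cl}" by (rule card_1_singletonE)
  have "r `` {I} \<in> S // r" "r `` {\<O>} \<in> S // r" using I O by (simp_all add: quotientI)
  then have classes: "r `` {I} = r `` {\<O>}" using Cl by simp
  \<comment> \<open>Reflexivity at \<open>I\<close> places \<open>I\<close> in its own class, hence
    in the class of the unit ideal.\<close>
  have "\<exists>\<alpha>\<in>\<O> - {0}. \<exists>\<beta>\<in>\<O> - {0}. \<alpha> <#\<^bsub>R\<^esub> I = \<beta> <#\<^bsub>R\<^esub> I"
    by (rule bexI[of _ 1], rule bexI[of _ 1]) (simp_all add: O_1)
  then have "(I, I) \<in> r"
    using I unfolding r_def ideal_equivalence_def S_def by simp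
  then have "I \<in> r `` {\<O>}" unfolding classes[symmetric] by (rule ImageI) simp
  then have "(\<O>, I) \<in> r" by (simp add: Image_singleton_iff)
  then obtain \<alpha> \<beta> where ab: "\<alpha> \<in> \<O>" "\<alpha> \<noteq> 0" "\<beta> \<in> \<O>" "\<beta> \<noteq> 0" "\<alpha> <#\<^bsub>R\<^esub> \<O> = \<beta> <#\<^bsub>R\<^esub> I"
    unfolding r_def ideal_equivalence_def by auto
  then have eq: "(\<lambda>x. \<alpha> * x) ` \<O> = (\<lambda>x. \<beta> * x) ` I"
    by (simp add: l_coset_def UNION_singleton_eq_range)
  have "\<alpha> * 1 \<in> (\<lambda>x. \<beta> * x) ` I" unfolding eq[symmetric] using O_1 by (rule imageI)
  then obtain i where i: "i \<in> I" "\<alpha> = \<beta> * i" by auto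
  interpret I: ideal I R by fact
  have iO: "i \<in> \<O>" using i by (rule_tac I.Icarr)
  have "I = PIdl\<^bsub>R\<^esub> i"
  proof
    show "I \<subseteq> PIdl\<^bsub>R\<^esub> i"
    proof
      fix x assume "x \<in> I"
      then have "\<beta> * x \<in> (\<lambda>x. \<alpha> * x) ` \<O>" unfolding eq by (rule imageI)
      then obtain c where "c \<in> \<O>" "\<beta> * x = \<alpha> * c" by auto
      then show "x \<in> PIdl\<^bsub>R\<^esub> i" using ab i by (auto simp: cgenideal_def mult_ac)
    qed
    show "PIdl\<^bsub>R\<^esub> i \<subseteq> I"
      using I.I_l_closed[OF i(1)] by (auto simp: cgenideal_def)
  qed
  then show ?thesis using iO by blast
qed

sublocale R: principal_domain R
  by (intro principal_domain.intro principal_domain_axioms.intro domain_R principal_ideal)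

lemma primes_of_iff:
  "p \<in> primes_of K \<longleftrightarrow> p \<in> \<O> \<and> p \<noteq> 0 \<and> p \<notin> Units R \<and>
    (\<forall>a\<in>\<O>. \<forall>b\<in>\<O>. p divides\<^bsub>R\<^esub> (a * b) \<longrightarrow> p divides\<^bsub>R\<^esub> a \<or> p divides\<^bsub>R\<^esub> b)"
  unfolding primes_of_def ring_prime_def Divisibility.prime_def mem_Collect_eq R_simps by (rule refl)

lemma exists_prime_divisor:
  assumes "x \<in> \<O>" "x \<noteq> 0" "x \<notin> Units R"
  obtains p where "p \<in> primes_of K" "p divides\<^bsub>R\<^esub> x"
proof -
  obtain p where "p \<in> \<O>" "ring_irreducible\<^bsub>R\<^esub> p" "p divides\<^bsub>R\<^esub> x"
    using R.exists_irreducible_divisor[of x] assms by (metis Diff_iff R_simps(4) singletonD)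
  then show ?thesis using that[of p] R.primeness_condition[of p] by (simp add: primes_of_def)
qed

lemma dvd_trans:
  assumes "x divides\<^bsub>R\<^esub> y" "y divides\<^bsub>R\<^esub> z"
  shows "x divides\<^bsub>R\<^esub> z"
proof -
  obtain c c' where "c \<in> \<O>" "y = x * c" "c' \<in> \<O>" "z = y * c'" using assms by (auto simp: divides_R)
  then have "c * c' \<in> \<O>" "z = x * (c * c')" by (simp_all add: O_mult)
  then show ?thesis unfolding divides_R by blast
qed

lemma dvd_mult:
  assumes "x divides\<^bsub>R\<^esub> y" "z \<in> \<O>"
  shows "x divides\<^bsub>R\<^esub> (y * z)"
  using assms by (intro dvd_trans[OF assms(1)]) (auto simp: divides_R)

lemma dvd_zero: "x divides\<^bsub>R\<^esub> 0"
  unfolding divides_R by (intro bexI[of _ 0] O_0) simp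

text \<open>The denominators of x form a principal ideal, whose generator is divisible by no prime.\<close>

lemma locally_integral:
  assumes "x \<in> K" and loc: "\<And>p. p \<in> primes_of K \<Longrightarrow> p_integral K p x"
  shows "x \<in> \<O>"
proof -
  define I where "I = {w \<in> \<O>. x * w \<in> \<O>}"
  have "ideal I R"
  proof (rule idealI)
    show "ring R" by (rule R.ring_axioms)
    show "subgroup I (add_monoid R)"
    proof (rule R.add.subgroupI)
      show "I \<noteq> {}" using O_0 by (auto simp: I_def)
      show "\<ominus>\<^bsub>R\<^esub> w \<in> I" if "w \<in> I" for w
      proof -
        have "\<ominus>\<^bsub>R\<^esub> w = - w"
          using that O_uminus[of w] by (intro R.minus_equality) (auto simp: I_def)
        then show ?thesis using that O_uminus[of w] O_uminus[of "x * w"] by (auto simp: I_def)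
      qed
    qed (auto simp: I_def O_add distrib_left)
  next
    fix a c assume "a \<in> I" "c \<in> \<O>"
    then have "c * a \<in> \<O> \<and> x * (c * a) \<in> \<O>"
      using O_mult[of c a] O_mult[of c "x * a"] by (simp add: I_def mult.left_commute)
    then show "c \<otimes>\<^bsub>R\<^esub> a \<in> I" "a \<otimes>\<^bsub>R\<^esub> c \<in> I" by (simp_all add: I_def mult.commute)
  qed
  then obtain d where d: "d \<in> \<O>" "I = PIdl\<^bsub>R\<^esub> d" using principal_ideal by blast
  have dI: "d \<in> I" unfolding d(2) cgenideal_def using O_1 by (auto intro!: exI[of _ 1])
  have dvd: "d divides\<^bsub>R\<^esub> w" if "w \<in> I" for w
    using that unfolding d(2) by (auto simp: cgenideal_def divides_R mult.commute)
  obtain w where w: "w \<in> I" "w \<noteq> 0" using fraction_K[OF assms(1)] unfolding I_def by blast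
  then have "d \<noteq> 0" using dvd[OF w(1)] by (auto simp: divides_R)
  have "d \<in> Units R"
  proof (rule ccontr)
    assume "d \<notin> Units R"
    then obtain p where p: "p \<in> primes_of K" "p divides\<^bsub>R\<^esub> d"
      using exists_prime_divisor d(1) \<open>d \<noteq> 0\<close> by blast
    then obtain u w where "u \<in> \<O>" "w \<in> \<O>" "\<not> p divides\<^bsub>R\<^esub> w" "x * w = u"
      using loc unfolding p_integral_def by blast
    \<comment> \<open>The local denominator \<open>w\<close> belongs to \<open>I\<close>, so
      \<open>d\<close>, and with it \<open>p\<close>, would divide \<open>w\<close>.\<close>
    then show False using dvd[of w] p(2) dvd_trans by (auto simp: I_def)
  qed
  then obtain c where c: "c \<in> \<O>" "d * c = 1" by (auto simp: Units_R)
  have "(x * d) * c = x" using c(2) by (simp add: mult.assoc)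
  moreover have "(x * d) * c \<in> \<O>" using dI c(1) O_mult[of "x * d" c] by (auto simp only: I_def)
  ultimately show ?thesis by (simp only:)
qed

end

section \<open>The valuation of a prime element\<close>

locale prime_element = quadratic_pid +
  fixes p :: complex
  assumes p: "p \<in> primes_of K"
begin

lemma p_O: "p \<in> \<O>" and p_nz: "p \<noteq> 0" and p_nonunit: "p \<notin> Units R"
  using p by (auto simp: primes_of_iff)

lemma p_prime: "a \<in> \<O> \<Longrightarrow> b \<in> \<O> \<Longrightarrow> p divides\<^bsub>R\<^esub> (a * b) \<Longrightarrow> p divides\<^bsub>R\<^esub> a \<or> p divides\<^bsub>R\<^esub> b"
  using p by (auto simp: primes_of_iff)

lemma p_not_dvd_1: "\<not> p divides\<^bsub>R\<^esub> 1"
  using p_nonunit p_O by (auto simp: divides_R Units_R)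

lemma p_norm_ge_2: "(cmod p)\<^sup>2 \<ge> 2"
proof -
  obtain n where n: "(cmod p)\<^sup>2 = real n" using O_norm_int[OF p_O] by blast
  have "n \<noteq> 0" using n p_nz by (metis norm_eq_zero of_nat_0 power_eq_0_iff)
  moreover have "n \<noteq> 1" using n unit_iff_norm[OF p_O] p_nonunit by auto
  ultimately show ?thesis using n by simp
qed

text \<open>Dividing by \<open>p\<close> at least halves the norm, a positive integer, so the
  division must stop.\<close>

lemma exists_power:
  assumes "x \<in> \<O>" "x \<noteq> 0"
  obtains n u where "u \<in> \<O>" "x = p ^ n * u" "\<not> p divides\<^bsub>R\<^esub> u"
proof -
  have "\<exists>n u. u \<in> \<O> \<and> x = p ^ n * u \<and> \<not> p divides\<^bsub>R\<^esub> u"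
    if "x \<in> \<O>" "x \<noteq> 0" "(cmod x)\<^sup>2 = real k" for k x
    using that
  proof (induction k arbitrary: x rule: less_induct)
    case (less k)
    show ?case
    proof (cases "p divides\<^bsub>R\<^esub> x")
      case False
      then show ?thesis using less.prems by (intro exI[of _ 0] exI[of _ x]) auto
    next
      case True
      then obtain c where c: "c \<in> \<O>" "x = p * c" by (auto simp: divides_R)
      obtain m where m: "(cmod c)\<^sup>2 = real m" using O_norm_int[OF c(1)] by blast
      have c0: "c \<noteq> 0" using c less.prems by auto
      then have "real m > 0" using m by (metis norm_eq_zero zero_less_power2)
      moreover have "real k = (cmod p)\<^sup>2 * real m"
        using less.prems(3) m by (simp add: c(2) norm_mult power_mult_distrib)
      ultimately have "real m < real k"
        using p_norm_ge_2 mult_right_mono[of 2 "(cmod p)\<^sup>2" "real m"] by linarith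
      then have "m < k" by simp
      then obtain n u where "u \<in> \<O>" "c = p ^ n * u" "\<not> p divides\<^bsub>R\<^esub> u"
        using less.IH[OF _ c(1) c0 m] by blast
      then show ?thesis using c(2) by (intro exI[of _ "Suc n"] exI[of _ u]) auto
    qed
  qed
  then show ?thesis using assms that O_norm_int[OF assms(1)] by metis
qed

text \<open>The relation inside the definite description of \<open>valuation\<close>; existence and
  uniqueness of the exponent are statements about it.\<close>

definition has_valuation :: "complex \<Rightarrow> int \<Rightarrow> bool" where
  "has_valuation x n \<longleftrightarrow> (\<exists>u\<in>\<O>. \<exists>w\<in>\<O>. \<not> p divides\<^bsub>R\<^esub> u \<and> \<not> p divides\<^bsub>R\<^esub> w \<and> x * w = p powi n * u)"

lemma has_valuationI:
  "u \<in> \<O> \<Longrightarrow> w \<in> \<O> \<Longrightarrow> \<not> p divides\<^bsub>R\<^esub> u \<Longrightarrow> \<not> p divides\<^bsub>R\<^esub> w \<Longrightarrow> x * w = p powi n * u \<Longrightarrow>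
    has_valuation x n"
  unfolding has_valuation_def by blast

lemma not_dvd_mult:
  "u \<in> \<O> \<Longrightarrow> w \<in> \<O> \<Longrightarrow> \<not> p divides\<^bsub>R\<^esub> u \<Longrightarrow> \<not> p divides\<^bsub>R\<^esub> w \<Longrightarrow> \<not> p divides\<^bsub>R\<^esub> (u * w)"
  using p_prime by blast

lemma has_valuation_le:
  assumes "has_valuation x n" "has_valuation x m"
  shows "m \<le> n"
proof (rule ccontr)
  assume "\<not> m \<le> n"
  then have nm: "n < m" by simp
  obtain u w where uw: "u \<in> \<O>" "w \<in> \<O>" "\<not> p divides\<^bsub>R\<^esub> u" "\<not> p divides\<^bsub>R\<^esub> w" "x * w = p powi n * u"
    using assms(1) unfolding has_valuation_def by blast
  obtain u' w' where uw': "u' \<in> \<O>" "w' \<in> \<O>" "\<not> p divides\<^bsub>R\<^esub> u'" "\<not> p divides\<^bsub>R\<^esub> w'" "x * w' = p powi m * u'"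
    using assms(2) unfolding has_valuation_def by blast
  obtain k where k: "m = n + int (Suc k)" using nm by (metis zless_iff_Suc_zadd)
  have pm: "p powi m = p powi n * (p * p ^ k)" using p_nz by (simp add: k power_int_add)
  have "p powi n * (u * w') = (x * w) * w'" using uw(5) by simp
  also have "\<dots> = (x * w') * w" by simp
  also have "\<dots> = p powi n * (p * (p ^ k * u' * w))" unfolding uw'(5) pm by (simp add: mult_ac)
  finally have "u * w' = p * (p ^ k * u' * w)" using p_nz by simp
  moreover have "p ^ k * u' * w \<in> \<O>" by (intro O_mult O_power p_O uw uw')
  ultimately have "p divides\<^bsub>R\<^esub> (u * w')" by (auto simp: divides_R)
  then show False using p_prime uw uw' by blast
qed

lemma valuation_eq: "has_valuation x n \<Longrightarrow> valuation K p x = n"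
  unfolding valuation_def has_valuation_def[symmetric]
  by (intro the_equality) (auto intro: order.antisym has_valuation_le)

lemma has_valuation:
  assumes "x \<in> K" "x \<noteq> 0"
  shows "has_valuation x (valuation K p x)"
proof -
  obtain u w where uw: "u \<in> \<O>" "w \<in> \<O>" "w \<noteq> 0" "x * w = u" using fraction_K[OF assms(1)] .
  then have "u \<noteq> 0" using assms by auto
  obtain n u' where u': "u' \<in> \<O>" "u = p ^ n * u'" "\<not> p divides\<^bsub>R\<^esub> u'"
    using exists_power[OF uw(1) \<open>u \<noteq> 0\<close>] .
  obtain m w' where w': "w' \<in> \<O>" "w = p ^ m * w'" "\<not> p divides\<^bsub>R\<^esub> w'"
    using exists_power[OF uw(2,3)] .
  have "x * w' = p powi (int n - int m) * u'"
    using uw(4) p_nz by (simp add: u'(2) w'(2) power_int_diff field_simps)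
  then have "has_valuation x (int n - int m)" unfolding has_valuation_def using u' w' by blast
  then show ?thesis using valuation_eq by metis
qed

lemma has_valuation_O:
  assumes "u \<in> \<O>" "\<not> p divides\<^bsub>R\<^esub> u"
  shows "has_valuation (p ^ n * u) (int n)"
  unfolding has_valuation_def using assms p_not_dvd_1 O_1
  by (intro bexI[of _ u] bexI[of _ 1]) auto

lemma has_valuation_mult:
  assumes "has_valuation x n" "has_valuation y m"
  shows "has_valuation (x * y) (n + m)"
proof -
  obtain u w where uw: "u \<in> \<O>" "w \<in> \<O>" "\<not> p divides\<^bsub>R\<^esub> u" "\<not> p divides\<^bsub>R\<^esub> w" "x * w = p powi n * u"
    using assms(1) unfolding has_valuation_def by blast
  obtain u' w' where uw': "u' \<in> \<O>" "w' \<in> \<O>" "\<not> p divides\<^bsub>R\<^esub> u'" "\<not> p divides\<^bsub>R\<^esub> w'" "y * w' = p powi m * u'"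
    using assms(2) unfolding has_valuation_def by blast
  have "(x * y) * (w * w') = (x * w) * (y * w')" by simp
  also have "\<dots> = p powi (n + m) * (u * u')"
    unfolding uw(5) uw'(5) using p_nz by (simp add: power_int_add)
  finally show ?thesis
    by (intro has_valuationI[of "u * u'" "w * w'"] not_dvd_mult O_mult uw uw')
qed

text \<open>Over a common denominator prime to \<open>p\<close>, the numerator \<open>z\<close> may
  contain further factors \<open>p\<close>, whence only an inequality for the exponent.\<close>

lemma has_valuation_add:
  assumes "has_valuation x n" "has_valuation y m" "x + y \<noteq> 0" "n \<le> m"
  shows "\<exists>k\<ge>n. has_valuation (x + y) k"
proof -
  obtain u w where uw: "u \<in> \<O>" "w \<in> \<O>" "\<not> p divides\<^bsub>R\<^esub> u" "\<not> p divides\<^bsub>R\<^esub> w" "x * w = p powi n * u"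
    using assms(1) unfolding has_valuation_def by blast
  obtain u' w' where uw': "u' \<in> \<O>" "w' \<in> \<O>" "\<not> p divides\<^bsub>R\<^esub> u'" "\<not> p divides\<^bsub>R\<^esub> w'" "y * w' = p powi m * u'"
    using assms(2) unfolding has_valuation_def by blast
  obtain k where k: "m = n + int k" using assms(4) by (metis zle_iff_zadd)
  define z where "z = u * w' + p ^ k * u' * w"
  have "(x + y) * (w * w') = (x * w) * w' + (y * w') * w" by (simp add: algebra_simps)
  also have "\<dots> = p powi n * z"
    unfolding uw(5) uw'(5) z_def using p_nz by (simp add: power_int_add k algebra_simps)
  finally have eq: "(x + y) * (w * w') = p powi n * z" .
  have "w \<noteq> 0" "w' \<noteq> 0" using uw(4) uw'(4) dvd_zero by auto
  then have "z \<noteq> 0" using eq assms(3) by auto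
  moreover have "z \<in> \<O>" unfolding z_def by (intro O_add O_mult O_power p_O uw uw')
  ultimately obtain j v where v: "v \<in> \<O>" "z = p ^ j * v" "\<not> p divides\<^bsub>R\<^esub> v" using exists_power by blast
  have "(x + y) * (w * w') = p powi (n + int j) * v"
    unfolding eq v(2) using p_nz by (simp add: power_int_add)
  then have "has_valuation (x + y) (n + int j)"
    by (intro has_valuationI[of v "w * w'"] not_dvd_mult O_mult uw uw' v)
  then show ?thesis by (intro exI[of _ "n + int j"]) auto
qed

sublocale valued_field K "valuation K p"
proof
  show "valuation K p (x * y) = valuation K p x + valuation K p y"
    if "x \<in> K" "y \<in> K" "x \<noteq> 0" "y \<noteq> 0" for x y
    using that by (intro valuation_eq has_valuation_mult has_valuation)
  show "min (valuation K p x) (valuation K p y) \<le> valuation K p (x + y)"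
    if "x \<in> K" "y \<in> K" "x \<noteq> 0" "y \<noteq> 0" "x + y \<noteq> 0" for x y
  proof (cases "valuation K p x \<le> valuation K p y")
    case True
    then show ?thesis
      using has_valuation_add[OF has_valuation has_valuation that(5) True] that valuation_eq by auto
  next
    case False
    then have "\<exists>k\<ge>valuation K p y. has_valuation (y + x) k"
      using has_valuation_add[OF has_valuation has_valuation, of y x] that by (simp add: add.commute)
    then show ?thesis using valuation_eq by (auto simp: add.commute)
  qed
qed (auto intro: K_1 K_add K_uminus K_mult K_inverse)

lemma val_ge_iff_p_integral: "val_ge 0 x \<longleftrightarrow> p_integral K p x"
proof
  assume x: "val_ge 0 x"
  show "p_integral K p x"
  proof (cases "x = 0")
    case True
    then show ?thesis unfolding p_integral_def using p_not_dvd_1 O_0 O_1 by auto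
  next
    case False
    then obtain n where n: "valuation K p x = int n" "x \<in> K"
      using x nonneg_int_cases by (auto simp: val_ge_def)
    then obtain u w where "u \<in> \<O>" "w \<in> \<O>" "\<not> p divides\<^bsub>R\<^esub> w" "x * w = p ^ n * u"
      using has_valuation[OF n(2) False] unfolding has_valuation_def by auto
    then show ?thesis unfolding p_integral_def by (metis O_mult O_power p_O)
  qed
next
  assume "p_integral K p x"
  then obtain u w where uw: "u \<in> \<O>" "w \<in> \<O>" "\<not> p divides\<^bsub>R\<^esub> w" "x * w = u"
    unfolding p_integral_def by blast
  then have w0: "w \<noteq> 0" using dvd_zero by auto
  then have "x = u / w" using uw by (simp add: field_simps)
  then have xK: "x \<in> K" using uw by (auto intro: K_divide O_in_K)
  show "val_ge 0 x"
  proof (cases "x = 0")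
    case False
    then have "u \<noteq> 0" using uw(4) w0 by auto
    then obtain n u' where u': "u' \<in> \<O>" "u = p ^ n * u'" "\<not> p divides\<^bsub>R\<^esub> u'"
      using exists_power uw(1) by blast
    then have "has_valuation x (int n)" unfolding has_valuation_def using uw by auto
    then show ?thesis using valuation_eq xK by (auto simp: val_ge_def)
  qed (simp add: val_ge_0)
qed

lemma val_ge_O: "x \<in> \<O> \<Longrightarrow> val_ge 0 x"
  unfolding val_ge_iff_p_integral p_integral_def using p_not_dvd_1 O_1 by (metis mult.right_neutral)

lemma val_is_0_iff:
  assumes "x \<in> \<O>"
  shows "val_is 0 x \<longleftrightarrow> \<not> p divides\<^bsub>R\<^esub> x"
proof
  assume "\<not> p divides\<^bsub>R\<^esub> x"
  then show "val_is 0 x" using has_valuation_O[OF assms, of 0] valuation_eq O_in_K[OF assms] dvd_zero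
    by (auto simp: val_is_def)
next
  assume x: "val_is 0 x"
  show "\<not> p divides\<^bsub>R\<^esub> x"
  proof
    assume "p divides\<^bsub>R\<^esub> x"
    then obtain c where c: "c \<in> \<O>" "x = p * c" by (auto simp: divides_R)
    have "val_is 1 p" using has_valuation_O[OF O_1 p_not_dvd_1, of 1] valuation_eq O_in_K[OF p_O] p_nz
      by (auto simp: val_is_def)
    then have "val_ge 1 x" using val_is_ge_mult val_ge_O[OF c(1)] c(2) by fastforce
    then show False using val_is_ge[OF x] by force
  qed
qed

lemma val_is_p: "val_is 1 p"
  using has_valuation_O[OF O_1 p_not_dvd_1, of 1] valuation_eq O_in_K[OF p_O] p_nz
  by (auto simp: val_is_def)

lemma dvd_power_iff:
  assumes "x \<in> \<O>"
  shows "p ^ n divides\<^bsub>R\<^esub> x \<longleftrightarrow> val_ge (int n) x"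
proof
  assume "p ^ n divides\<^bsub>R\<^esub> x"
  then obtain c where c: "c \<in> \<O>" "x = p ^ n * c" by (auto simp: divides_R)
  then show "val_ge (int n) x"
    using val_is_ge_mult[OF val_is_power[OF val_is_p, of n] val_ge_O[OF c(1)]] by simp
next
  assume x: "val_ge (int n) x"
  show "p ^ n divides\<^bsub>R\<^esub> x"
  proof (cases "x = 0")
    case False
    obtain m u where u: "u \<in> \<O>" "x = p ^ m * u" "\<not> p divides\<^bsub>R\<^esub> u"
      using exists_power[OF assms False] .
    have "valuation K p x = int m" using has_valuation_O[OF u(1,3)] valuation_eq u(2) by blast
    then have "n \<le> m" using x False by (simp add: val_ge_def)
    then have "x = p ^ n * (p ^ (m - n) * u)" unfolding u(2) by (simp flip: mult.assoc power_add)
    then show ?thesis using O_mult O_power p_O u(1) by (auto simp: divides_R)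
  qed (simp add: dvd_zero)
qed

lemma dvd_iff: "x \<in> \<O> \<Longrightarrow> p divides\<^bsub>R\<^esub> x \<longleftrightarrow> val_ge 1 x"
  using dvd_power_iff[of x 1] by simp

text \<open>If \<open>p\<^sup>3\<close> divided 2, the norm of p, an integer greater than 1, would have its cube dividing 4.\<close>

lemma ram_index_le_2: "valuation K p 2 \<le> 2"
proof (rule ccontr)
  assume "\<not> valuation K p 2 \<le> 2"
  then have "val_ge (int 3) 2" using O_in_K[OF O_2] by (simp add: val_ge_def)
  then have "p ^ 3 divides\<^bsub>R\<^esub> 2" using dvd_power_iff[OF O_2] by blast
  then obtain c where c: "c \<in> \<O>" "2 = p ^ 3 * c" by (auto simp: divides_R)
  then have "cmod c \<ge> 1" by (intro O_norm_ge_1) auto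
  have "2 = cmod p ^ 3 * cmod c" using c(2) by (metis norm_mult norm_power norm_numeral)
  then have "2\<^sup>2 = (cmod p ^ 3 * cmod c)\<^sup>2" by simp
  also have "\<dots> = ((cmod p)\<^sup>2) ^ 3 * (cmod c)\<^sup>2"
    by (simp add: power_mult_distrib flip: power_mult)
  finally have eq: "((cmod p)\<^sup>2) ^ 3 * (cmod c)\<^sup>2 = 4" by simp
  have "2 ^ 3 \<le> ((cmod p)\<^sup>2) ^ 3" using p_norm_ge_2 by (intro Power.power_mono) auto
  moreover have "1 \<le> (cmod c)\<^sup>2" using \<open>cmod c \<ge> 1\<close> by simp
  ultimately have "2 ^ 3 * 1 \<le> ((cmod p)\<^sup>2) ^ 3 * (cmod c)\<^sup>2" by (intro mult_mono) auto
  then show False using eq by simp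
qed

text \<open>The bound from above holds because g divides the element x of least valuation, the bound
  from below because the power of \<open>p\<close> with exponent n is a common divisor of S.\<close>

lemma val_gcd:
  assumes gcd: "is_gcd R S g" and S: "S \<subseteq> \<O>" and x: "x \<in> S" "val_is n x"
    and min: "\<And>y. y \<in> S \<Longrightarrow> val_ge n y"
  shows "val_is n g"
proof -
  have g: "g \<in> \<O>" "g divides\<^bsub>R\<^esub> x" using gcd x by (auto simp: is_gcd_def)
  have "0 \<le> n" using val_is_ge[OF x(2) val_ge_O] x S by blast
  then obtain k where k: "n = int k" using nonneg_int_cases by blast
  have "p ^ k divides\<^bsub>R\<^esub> y" if "y \<in> S" for y
    using dvd_power_iff[of y k] min[OF that] that S k by auto
  then have "p ^ k divides\<^bsub>R\<^esub> g" using gcd O_power[OF p_O] by (auto simp: is_gcd_def)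
  then have ge: "val_ge n g" using dvd_power_iff[OF g(1)] k by simp
  obtain c where c: "c \<in> \<O>" "x = g * c" using g(2) by (auto simp: divides_R)
  then have "g \<noteq> 0" using x(2) by (auto simp: val_is_def)
  then have gv: "val_is (valuation K p g) g" using O_in_K[OF g(1)] val_is_valuation by simp
  then have "val_ge (valuation K p g + 0) (g * c)" by (rule val_is_ge_mult[OF _ val_ge_O[OF c(1)]])
  then have "valuation K p g \<le> n" using val_is_ge[OF x(2)] c(2) by simp
  moreover have "n \<le> valuation K p g" using val_is_ge[OF gv ge] .
  ultimately show ?thesis using gv by simp
qed

text \<open>Zero is excluded as well, since \<open>p ^ 2\<close> divides it.\<close>

lemma val_square_free:
  assumes "square_free R x"
  obtains n where "val_is n x" "0 \<le> n" "n \<le> 1"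
proof -
  have x: "x \<in> \<O>" and sf: "\<And>y. y \<in> \<O> \<Longrightarrow> (y * y) divides\<^bsub>R\<^esub> x \<Longrightarrow> y \<in> Units R"
    using assms by (auto simp: square_free_def)
  have "\<not> val_ge (int 2) x"
    using sf[OF p_O] p_nonunit dvd_power_iff[OF x, of 2] by (auto simp: power2_eq_square)
  then show ?thesis using val_ge_O[OF x] by (intro that[of "valuation K p x"]) (auto simp: val_is_def val_ge_def)
qed

end

section \<open>The converse\<close>

lemma discr_twist: "discr (E_ab (s * a) (s^2 * b)) = s^6 * discr (E_ab a b)"
  unfolding discr_E_ab by (simp add: power_mult_distrib algebra_simps flip: power_mult power_add)

context prime_element
begin

text \<open>An integral equation with unit discriminant is automatically minimal, because the
  discriminant of any integral equation has nonnegative valuation.\<close>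

lemma good_reductionI:
  assumes a: "val_ge 0 a" and b: "val_ge 0 b" and discr: "val_is 0 (discr (E_ab a b))"
  shows "good_reduction K (E_ab a b) p"
proof -
  have nz: "discr (E_ab a b) \<noteq> 0" using discr by (simp add: val_is_def)
  have "isomorphic_over K (E_ab a b) (E_ab a b)"
    unfolding isomorphic_over_def using K_0 K_1 change_eq_id[of "E_ab a b"]
    by (metis zero_neq_one)
  moreover have "p_integral_eq K p (E_ab a b)"
    using a b val_ge_0 by (simp add: p_integral_eq_def coeffs_in_def E_ab_def flip: val_ge_iff_p_integral)
  moreover have "valuation K p (discr (E_ab a b)) \<le> valuation K p (discr W')"
    if "isomorphic_over K (E_ab a b) W'" "p_integral_eq K p W'" for W'
  proof -
    have "discr W' \<noteq> 0" using that(1) nz by (auto simp: isomorphic_over_def discr_change_eq)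
    moreover have "val_ge 0 (discr W')"
      using that(2) by (intro val_ge_inv_b) (simp_all add: p_integral_eq_def coeffs_in_def val_ge_iff_p_integral)
    ultimately show ?thesis using discr by (simp add: val_ge_def val_is_def)
  qed
  ultimately show ?thesis using nz discr
    unfolding good_reduction_def minimal_model_at_def by (auto simp: val_is_def)
qed

end

context quadratic_pid
begin

text \<open>Euclid's argument: a prime dividing 1 + 3x cannot divide x.\<close>

lemma exists_prime_not_dvd:
  assumes "x \<in> \<O>" "x \<noteq> 0"
  obtains p where "p \<in> primes_of K" "\<not> p divides\<^bsub>R\<^esub> x"
proof -
  \<comment> \<open>With the factor 3 the absolute value is at least 3 - 1 = 2, so that
    \<open>y\<close> is not a unit.\<close>
  define y where "y = 1 + x * 3"
  have y: "y \<in> \<O>" unfolding y_def using assms O_numeral by (intro O_add O_mult O_1)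
  have "cmod (x * 3) \<le> cmod y + 1"
    using norm_triangle_ineq4[of y 1] by (simp add: y_def)
  moreover have "cmod x \<ge> 1" using O_norm_ge_1 assms by blast
  ultimately have big: "cmod y \<ge> 2" by (simp add: norm_mult)
  then have "y \<noteq> 0" by auto
  moreover have "y \<notin> Units R"
  proof
    assume "y \<in> Units R"
    then have "(cmod y)\<^sup>2 = 1" using unit_iff_norm y by blast
    moreover have "2\<^sup>2 \<le> (cmod y)\<^sup>2" using big by (intro Power.power_mono) auto
    ultimately show False by simp
  qed
  ultimately obtain p where pr: "p \<in> primes_of K" "p divides\<^bsub>R\<^esub> y"
    using exists_prime_divisor y by blast
  interpret prime_element K d p by unfold_locales (rule pr)
  have "\<not> p divides\<^bsub>R\<^esub> x"
  proof
    assume "p divides\<^bsub>R\<^esub> x"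
    then have "val_ge 1 (x * 3)" using dvd_iff[OF assms(1)] val_ge_mult[of 1 x 0 3] val_ge_numeral by simp
    moreover have "val_ge 1 y" using pr(2) dvd_iff[OF y] by blast
    ultimately have "val_ge 1 (y - x * 3)" by (rule val_ge_diff[rotated])
    then have "val_ge 1 1" by (simp add: y_def)
    then show False using val_is_ge[OF val_is_1] by force
  qed
  then show ?thesis using that pr(1) by blast
qed

text \<open>Zero is divisible by every prime, so it would make every prime a divisor of y. In this
  way condition (2) yields that A, B, C are nonzero and that the constructed curve is
  nonsingular.\<close>

lemma only_primes_dividing_nonzero:
  assumes "only_primes_dividing K x y" "y \<in> \<O>" "y \<noteq> 0"
  shows "x \<noteq> 0"
proof
  assume "x = 0"
  then have "p divides\<^bsub>R\<^esub> y" if "p \<in> primes_of K" for p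
    using assms(1) that dvd_zero by (simp add: only_primes_dividing_def)
  then show False using exists_prime_not_dvd[OF assms(2,3)] by blast
qed

text \<open>The relation enters through a^2 - 4b = 4A (a'^2 A - C) / g^2 = 4AB / g^2; a twist by s
  multiplies the discriminant by s^6.\<close>

lemma converse_discr:
  assumes "g \<noteq> 0" and rel: "a'^2 * A = B + C"
  shows "discr (E_ab (s * (2 * A * a' / g)) (s^2 * (A * C / g^2))) = s^6 * (64 * A^3 * C^2 * B) / g^6"
proof -
  have "(2 * A * a' / g)^2 - 4 * (A * C / g^2) = 4 * A * (a'^2 * A - C) / g^2"
    by (simp add: power_divide power_mult_distrib power2_eq_square diff_divide_distrib algebra_simps)
  then have quad: "(2 * A * a' / g)^2 - 4 * (A * C / g^2) = 4 * A * B / g^2" unfolding rel by simp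
  have "discr (E_ab (s * (2 * A * a' / g)) (s^2 * (A * C / g^2))) =
      s^6 * (16 * (A * C / g^2)^2 * ((2 * A * a' / g)^2 - 4 * (A * C / g^2)))"
    by (rule trans[OF discr_twist]) (simp only: discr_E_ab)
  also have "\<dots> = s^6 * (64 * A^3 * C^2 * B) / g^6"
    unfolding quad by (simp add: power_divide power_mult_distrib power2_eq_square power3_eq_cube)
      (simp add: eval_nat_numeral ac_simps)
  finally show ?thesis .
qed

text \<open>At a prime not dividing 2D all of 2, g, s, A, B, C are units: g divides 2, s divides D,
  and A, B, C are covered by the support condition. The given equation is then integral with unit
  discriminant.\<close>

lemma converse_good_reduction:
  assumes D: "D \<in> \<O>" "D \<noteq> 0" and O: "A \<in> \<O>" "B \<in> \<O>" "C \<in> \<O>" "a' \<in> \<O>"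
    and rel: "a'^2 * A = B + C"
    and only: "only_primes_dividing K A (2 * D)" "only_primes_dividing K B (2 * D)"
      "only_primes_dividing K C (2 * D)"
    and g: "g \<in> \<O>" "g divides\<^bsub>R\<^esub> 2" and s: "s \<in> \<O>" "s divides\<^bsub>R\<^esub> D"
  defines "E \<equiv> E_ab (s * (2 * A * a' / g)) (s^2 * (A * C / g^2))"
  shows "elliptic_curve K E \<and> (\<forall>p\<in>primes_of K. \<not> p divides\<^bsub>R\<^esub> (2 * D) \<longrightarrow> good_reduction K E p)"
proof -
  have D2: "2 * D \<in> \<O>" "2 * D \<noteq> 0" using D O_2 O_mult by auto
  have nz: "A \<noteq> 0" "B \<noteq> 0" "C \<noteq> 0" using only only_primes_dividing_nonzero D2 by blast+
  have "g \<noteq> 0" "s \<noteq> 0" using g s D(2) by (auto simp: divides_R)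
  note discr = converse_discr[OF \<open>g \<noteq> 0\<close> rel, of s, folded E_def]
  have K: "A \<in> K" "B \<in> K" "C \<in> K" "a' \<in> K" "g \<in> K" "s \<in> K" "2 \<in> K"
    using O g s O_2 O_in_K by blast+
  have "elliptic_curve K E"
    unfolding elliptic_curve_def
  proof
    show "coeffs_in E K" unfolding E_def coeffs_in_def E_ab_def power2_eq_square
      using K by (simp add: K_0 K_mult K_divide)
    show "discr E \<noteq> 0" unfolding discr using nz \<open>g \<noteq> 0\<close> \<open>s \<noteq> 0\<close> by simp
  qed
  moreover have "good_reduction K E p" if pr: "p \<in> primes_of K" "\<not> p divides\<^bsub>R\<^esub> (2 * D)" for p
  proof -
    interpret prime_element K d p by unfold_locales (rule pr)
    have two: "\<not> p divides\<^bsub>R\<^esub> 2" using pr(2) dvd_mult D(1) by blast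
    have "\<not> p divides\<^bsub>R\<^esub> D" using pr(2) dvd_mult[of p D 2] O_2 by (auto simp: mult.commute)
    then have "\<not> p divides\<^bsub>R\<^esub> s" "\<not> p divides\<^bsub>R\<^esub> g" using two g s dvd_trans by blast+
    moreover have "\<not> p divides\<^bsub>R\<^esub> A" "\<not> p divides\<^bsub>R\<^esub> B" "\<not> p divides\<^bsub>R\<^esub> C"
      using only pr unfolding only_primes_dividing_def by blast+
    ultimately have v: "val_is 0 2" "val_is 0 s" "val_is 0 g" "val_is 0 A" "val_is 0 B" "val_is 0 C"
      using two val_is_0_iff O g s O_2 by auto
    have v6: "val_is 0 64" using val_is_power[OF v(1), of 6] by simp
    have O': "s * (2 * A * a') \<in> \<O>" "s^2 * (A * C) \<in> \<O>"
      using O s O_2 by (auto intro!: O_mult O_power)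
    have "val_ge 0 (s * (2 * A * a') / g)"
      using val_ge_divide[OF val_ge_O[OF O'(1)] v(3)] by simp
    moreover have "val_ge 0 (s^2 * (A * C) / g^2)"
      using val_ge_divide[OF val_ge_O[OF O'(2)] val_is_power[OF v(3), of 2]] by simp
    moreover have "val_is 0 (discr E)"
      unfolding discr
      using val_is_divide[OF val_is_mult[OF val_is_power[OF v(2), of 6] val_is_mult[OF val_is_mult[OF
        val_is_mult[OF v6 val_is_power[OF v(4), of 3]] val_is_power[OF v(6), of 2]] v(5)]]
        val_is_power[OF v(3), of 6]] by simp
    ultimately show ?thesis unfolding E_def by (intro good_reductionI) auto
  qed
  ultimately show ?thesis by blast
qed

end

section \<open>The model attached to a point of order two\<close>

lemma scale_completed_cubic:
  assumes "c \<noteq> 0"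
  shows "scale_cubic c (completed_cubic W) =
    [:c^3 * (w6 W + (w3 W)^2 / 4), c^2 * (w4 W + w1 W * w3 W / 2), c * (w2 W + (w1 W)^2 / 4), 1:]"
  using assms unfolding scale_cubic_def completed_cubic_def
  by (simp add: pcompose_pCons power2_eq_square power3_eq_cube)

lemma translate_cubic:
  assumes "c \<noteq> 0"
    and "pcompose (scale_cubic c (completed_cubic W)) [:c * x, 1:] = [:0, b, a, 1:]"
  shows "a = c * (3 * x + (w2 W + (w1 W)^2 / 4))"
    and "b = c^2 * (3 * x^2 + 2 * (w2 W + (w1 W)^2 / 4) * x + (w4 W + w1 W * w3 W / 2))"
proof -
  define f2 f4 f6 where f: "f2 = w2 W + (w1 W)^2 / 4" "f4 = w4 W + w1 W * w3 W / 2"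
    "f6 = w6 W + (w3 W)^2 / 4"
  have "pcompose [:c^3 * f6, c^2 * f4, c * f2, 1:] [:c * x, 1:] = [:0, b, a, 1:]"
    using assms(2) unfolding scale_completed_cubic[OF assms(1)] f .
  then have "a = c * (3 * x + f2) \<and> b = c^2 * (3 * x^2 + 2 * f2 * x + f4)"
    by (simp add: pcompose_pCons algebra_simps power2_eq_square)
  then show "a = c * (3 * x + (w2 W + (w1 W)^2 / 4))"
    and "b = c^2 * (3 * x^2 + 2 * (w2 W + (w1 W)^2 / 4) * x + (w4 W + w1 W * w3 W / 2))"
    unfolding f by simp_all
qed

context valued_field
begin

lemma val_is_prod:
  assumes "finite T" "\<And>\<tau>. \<tau> \<in> T \<Longrightarrow> val_is (n \<tau>) (f \<tau>)"
  shows "val_is (sum n T) (prod f T)"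
  using assms by (induction T) (auto intro: val_is_1 val_is_mult)

end

section \<open>The valuation of the scaling factor\<close>

context prime_element
begin

text \<open>The x^2 coefficient decides: scaling by \<open>p ^ m\<close> gives it valuation m - n,
  so m cannot be below n. The bounds on the other two coefficients, which are multiplied by the
  square and the cube, say that n suffices.\<close>

lemma scaling_exponent_eq:
  assumes f2: "val_is (- int n) (w2 W + (w1 W)^2 / 4)"
    and f4: "val_ge (- 2 * int n) (w4 W + w1 W * w3 W / 2)"
    and f6: "val_ge (- 3 * int n) (w6 W + (w3 W)^2 / 4)"
  shows "scaling_exponent K W p = n"
  unfolding scaling_exponent_def
proof (rule Least_equality)
  have pn: "p ^ m \<noteq> 0" for m using p_nz by simp
  have "val_ge 0 (coeff (scale_cubic (p ^ n) (completed_cubic W)) i)" for i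
  proof -
    have "val_ge 0 (p ^ n * (w2 W + (w1 W)^2 / 4))"
      by (rule val_ge_mult[OF val_ge_power[OF val_is_imp_ge[OF val_is_p order.refl]]
          val_is_imp_ge[OF f2 order.refl]]) simp
    moreover have "val_ge 0 ((p ^ n)^2 * (w4 W + w1 W * w3 W / 2))"
      by (rule val_ge_mult[OF val_ge_power[OF val_ge_power[OF val_is_imp_ge[OF val_is_p order.refl]]] f4])
        simp
    moreover have "val_ge 0 ((p ^ n)^3 * (w6 W + (w3 W)^2 / 4))"
      by (rule val_ge_mult[OF val_ge_power[OF val_ge_power[OF val_is_imp_ge[OF val_is_p order.refl]]] f6])
        simp
    ultimately show ?thesis
      using val_ge_0 val_is_imp_ge[OF val_is_1]
      unfolding scale_completed_cubic[OF pn] by (simp add: coeff_pCons split: nat.split)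
  qed
  then show "\<forall>i. p_integral K p (coeff (scale_cubic (p ^ n) (completed_cubic W)) i)"
    by (simp add: val_ge_iff_p_integral)
next
  fix m assume m: "\<forall>i. p_integral K p (coeff (scale_cubic (p ^ m) (completed_cubic W)) i)"
  have pm: "p ^ m \<noteq> 0" using p_nz by simp
  have "p_integral K p (coeff (scale_cubic (p ^ m) (completed_cubic W)) 2)" using m by blast
  then have "val_ge 0 (p ^ m * (w2 W + (w1 W)^2 / 4))"
    unfolding scale_completed_cubic[OF pm] by (simp add: val_ge_iff_p_integral eval_nat_numeral)
  moreover have "val_is (int m * 1 + - int n) (p ^ m * (w2 W + (w1 W)^2 / 4))"
    by (rule val_is_mult[OF val_is_power[OF val_is_p] f2])
  ultimately show "n \<le> m" using val_is_ge by fastforce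
qed

text \<open>The generator in \<open>T\<close> is only associated with the prime under consideration.
  If \<open>p = q * c\<close> with a unit \<open>c\<close>, then \<open>c powi n\<close> is moved
  into the numerator, which stays prime to \<open>q\<close>.\<close>

lemma associated_has_valuation:
  assumes q: "q \<in> primes_of K" "p \<sim>\<^bsub>R\<^esub> q" and x: "has_valuation x n"
  shows "prime_element.has_valuation K q x n"
proof -
  interpret q: prime_element K d q by unfold_locales (rule q(1))
  have dvd: "p divides\<^bsub>R\<^esub> q" "q divides\<^bsub>R\<^esub> p" using q(2) by (auto simp: associated_def)
  then obtain c c' where c: "c \<in> \<O>" "p = q * c" "c' \<in> \<O>" "q = p * c'" by (auto simp: divides_R)
  have "p * (c' * c) = p * 1" using c by (metis mult.assoc mult.right_neutral)
  then have cc: "c' * c = 1" using p_nz by (simp only: mult_cancel_left) simp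
  have c0: "c \<noteq> 0" "c' = inverse c"
    using cc inverse_unique[of c c'] by (auto simp: mult.commute)
  obtain u w where uw: "u \<in> \<O>" "w \<in> \<O>" "\<not> p divides\<^bsub>R\<^esub> u" "\<not> p divides\<^bsub>R\<^esub> w" "x * w = p powi n * u"
    using x unfolding has_valuation_def by blast
  have unit: "c powi k \<in> \<O>" for k
    using O_power[OF c(1)] O_power[OF c(3)] c0(2) by (simp add: power_int_def)
  have eq: "x * w = q powi n * (c powi n * u)"
    unfolding uw(5) using c(2) by (simp add: power_int_mult_distrib)
  have not: "\<not> q divides\<^bsub>R\<^esub> z" if "\<not> p divides\<^bsub>R\<^esub> z" for z using that dvd(1) dvd_trans by blast
  have "\<not> q divides\<^bsub>R\<^esub> (c powi n * u)"
  proof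
    assume "q divides\<^bsub>R\<^esub> (c powi n * u)"
    then have "q divides\<^bsub>R\<^esub> (c powi n * u * c powi (- n))" using dvd_mult unit by blast
    moreover have "c powi n * u * c powi (- n) = u" using c0(1) by (simp add: power_int_minus)
    ultimately show False using not uw(3) by simp
  qed
  from q.has_valuationI[OF _ _ this not[OF uw(4)] eq] show ?thesis
    using O_mult unit uw by blast
qed

lemma associated_valuation:
  assumes q: "q \<in> primes_of K" "p \<sim>\<^bsub>R\<^esub> q" and x: "x \<in> K" "x \<noteq> 0"
  shows "valuation K q x = valuation K p x"
proof -
  interpret q: prime_element K d q by unfold_locales (rule q(1))
  show ?thesis using q.valuation_eq[OF associated_has_valuation[OF q has_valuation[OF x]]] .
qed

lemma scaling_exponent_associated:
  assumes q: "q \<in> primes_of K" "p \<sim>\<^bsub>R\<^esub> q"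
    and f2: "val_is (- int n) (w2 W + (w1 W)^2 / 4)"
    and f4: "val_ge (- 2 * int n) (w4 W + w1 W * w3 W / 2)"
    and f6: "val_ge (- 3 * int n) (w6 W + (w3 W)^2 / 4)"
  shows "scaling_exponent K W q = n"
proof -
  interpret q: prime_element K d q by unfold_locales (rule q(1))
  have is_q: "q.val_is k x" if "val_is k x" for k x
    using that associated_valuation[OF q] by (simp add: q.val_is_def val_is_def)
  have ge_q: "q.val_ge k x" if "val_ge k x" for k x
    using that associated_valuation[OF q] by (auto simp: q.val_ge_def val_ge_def)
  show ?thesis by (rule q.scaling_exponent_eq[OF is_q[OF f2] ge_q[OF f4] ge_q[OF f6]])
qed

text \<open>Only the generator associated with p contributes to the valuation of the scaling factor at p.\<close>

lemma val_scaling_factor: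
  assumes T: "generators_above_two K T" and two: "p divides\<^bsub>R\<^esub> 2"
    and f2: "val_is (- int n) (w2 W + (w1 W)^2 / 4)"
    and f4: "val_ge (- 2 * int n) (w4 W + w1 W * w3 W / 2)"
    and f6: "val_ge (- 3 * int n) (w6 W + (w3 W)^2 / 4)"
  shows "val_is (int n) (\<Prod>\<tau>\<in>T. \<tau> ^ scaling_exponent K W \<tau>)"
proof -
  have fin: "finite T" and sub: "T \<subseteq> primes_of K" and ex1: "\<exists>!\<tau>. \<tau> \<in> T \<and> p \<sim>\<^bsub>R\<^esub> \<tau>"
    using T two p unfolding generators_above_two_def by blast+
  obtain \<sigma> where \<sigma>: "\<sigma> \<in> T" "p \<sim>\<^bsub>R\<^esub> \<sigma>" using ex1 by blast
  have \<sigma>p: "\<sigma> \<in> primes_of K" using \<sigma> sub by blast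
  have "val_is (if \<tau> = \<sigma> then int n else 0) (\<tau> ^ scaling_exponent K W \<tau>)" if \<tau>: "\<tau> \<in> T" for \<tau>
  proof (cases "\<tau> = \<sigma>")
    case True
    interpret s: prime_element K d \<sigma> by unfold_locales (rule \<sigma>p)
    have "valuation K p \<sigma> = 1"
      using associated_valuation[OF \<sigma>p \<sigma>(2), of \<sigma>] s.val_is_p by (simp add: s.val_is_def)
    then have "val_is 1 \<sigma>" using s.val_is_p by (simp add: s.val_is_def val_is_def)
    then have "val_is (int n) (\<sigma> ^ n)" using val_is_power[of 1 \<sigma> n] by simp
    then show ?thesis using True scaling_exponent_associated[OF \<sigma>p \<sigma>(2) f2 f4 f6] by simp
  next
    case False
    interpret t: prime_element K d \<tau> by unfold_locales (use \<tau> sub in blast)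
    have "\<not> p divides\<^bsub>R\<^esub> \<tau>"
    proof
      assume dvd: "p divides\<^bsub>R\<^esub> \<tau>"
      then obtain c where c: "c \<in> \<O>" "\<tau> = p * c" by (auto simp: divides_R)
      have "\<tau> divides\<^bsub>R\<^esub> (p * c)" using c(2) O_1 by (auto simp: divides_R intro!: bexI[of _ 1])
      \<comment> \<open>In the first case \<tau> and \<open>p\<close> are associated, against the
        uniqueness of \<sigma> in \<open>T\<close>; in the second, cancelling \<tau> from
        \<open>\<tau> = p * c\<close> makes \<open>p\<close> a unit.\<close>
      then consider "\<tau> divides\<^bsub>R\<^esub> p" | "\<tau> divides\<^bsub>R\<^esub> c" using t.p_prime[OF p_O c(1)] by blast
      then show False
      proof cases
        case 1
        then have "p \<sim>\<^bsub>R\<^esub> \<tau>" using dvd by (simp add: associated_def)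
        then show False using False \<tau> \<sigma> ex1 by blast
      next
        case 2
        then obtain e where e: "e \<in> \<O>" "c = \<tau> * e" by (auto simp: divides_R)
        have "\<tau> * (p * e) = \<tau> * 1" using c(2) e(2) by (simp add: ac_simps)
        then have "p * e = 1" using t.p_nz by (simp only: mult_cancel_left) simp
        then show False using p_not_dvd_1 e(1) unfolding divides_R by metis
      qed
    qed
    then have "val_is 0 \<tau>" using val_is_0_iff t.p_O by blast
    then show ?thesis using False val_is_power[of 0 \<tau>] by simp
  qed
  then have "val_is (\<Sum>\<tau>\<in>T. if \<tau> = \<sigma> then int n else 0) (\<Prod>\<tau>\<in>T. \<tau> ^ scaling_exponent K W \<tau>)"
    using fin by (intro val_is_prod)
  moreover have "(\<Sum>\<tau>\<in>T. if \<tau> = \<sigma> then int n else 0) = int n"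
    using fin \<sigma>(1) by (simp add: sum.delta)
  ultimately show ?thesis by (simp only:)
qed

lemma val_scaling_factor_odd:
  assumes T: "generators_above_two K T" and two: "\<not> p divides\<^bsub>R\<^esub> 2"
  shows "val_is 0 (\<Prod>\<tau>\<in>T. \<tau> ^ scaling_exponent K W \<tau>)"
proof -
  have fin: "finite T" and sub: "\<And>\<tau>. \<tau> \<in> T \<Longrightarrow> \<tau> \<in> primes_of K \<and> \<tau> divides\<^bsub>R\<^esub> 2"
    using T unfolding generators_above_two_def by blast+
  have "val_is 0 (\<tau> ^ scaling_exponent K W \<tau>)" if "\<tau> \<in> T" for \<tau>
  proof -
    have "\<tau> \<in> \<O>" using sub[OF that] by (simp add: primes_of_def)
    moreover have "\<not> p divides\<^bsub>R\<^esub> \<tau>" using sub[OF that] two dvd_trans by blast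
    ultimately have "val_is 0 \<tau>" using val_is_0_iff by blast
    then show ?thesis using val_is_power[of 0 \<tau>] by simp
  qed
  then have "val_is (\<Sum>\<tau>\<in>T. 0) (\<Prod>\<tau>\<in>T. \<tau> ^ scaling_exponent K W \<tau>)"
    using fin by (intro val_is_prod)
  then show ?thesis by simp
qed

end

context valued_field
begin

lemma monic_cubic_root_integral:
  assumes x: "x \<in> K" and coeffs: "val_ge 0 c2" "val_ge 0 c1" "val_ge 0 c0"
    and root: "x^3 + c2 * x^2 + c1 * x + c0 = 0"
  shows "val_ge 0 x"
proof (rule ccontr)
  assume "\<not> val_ge 0 x"
  define n where "n = v x"
  have n: "val_is n x" "n < 0" using x \<open>\<not> val_ge 0 x\<close> by (auto simp: val_ge_def val_is_def n_def)
  have t3: "val_is (3 * n) (x^3)" using val_is_power[OF n(1), of 3] by simp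
  have t2: "val_ge (2 * n) (c2 * x^2)"
    using val_is_ge_mult[OF val_is_square[OF n(1)] coeffs(1)] by (simp add: ac_simps)
  have t1: "val_ge n (c1 * x)"
    using val_is_ge_mult[OF n(1) coeffs(2)] by (simp add: ac_simps)
  have "val_is (3 * n) (x^3 + c2 * x^2 + c1 * x + c0)"
    using n(2) by (intro val_is_add[OF val_is_add[OF val_is_add[OF t3 t2] t1] coeffs(3)]) auto
  then show False unfolding root by (simp add: val_is_def)
qed

end

section \<open>The minimal equation with its point of order two\<close>

locale minimal_two_torsion = quadratic_pid +
  fixes E W :: weierstrass and u r s0 t x y l a b :: complex and T :: "complex set"
  assumes change: "u \<in> K" "r \<in> K" "s0 \<in> K" "t \<in> K" "u \<noteq> 0" "W = change_eq u r s0 t E"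
    and minimal: "global_minimal_model K E W"
    and ell: "discr E \<noteq> 0"
    and good2: "\<And>q. q \<in> primes_of K \<Longrightarrow> q divides\<^bsub>R\<^esub> 2 \<Longrightarrow> good_reduction K E q"
    and xy: "x \<in> K" "y \<in> K"
    and curve: "y^2 + w1 W * x * y + w3 W * y = x^3 + w2 W * x^2 + w4 W * x + w6 W"
    and tors: "2 * y + w1 W * x + w3 W = 0"
    and T: "generators_above_two K T"
    and l: "l = (\<Prod>\<tau>\<in>T. \<tau> ^ scaling_exponent K W \<tau>)"
    and model: "pcompose (scale_cubic l (completed_cubic W)) [:l * x, 1:] = [:0, b, a, 1:]"
begin

lemma W_O: "w1 W \<in> \<O>" "w2 W \<in> \<O>" "w3 W \<in> \<O>" "w4 W \<in> \<O>" "w6 W \<in> \<O>"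
  using minimal by (auto simp: global_minimal_model_def coeffs_in_def)

lemma D_O: "discr W \<in> \<O>" and D_nz: "discr W \<noteq> 0"
proof -
  show "discr W \<in> \<O>"
    unfolding discr_def inv_b2_def inv_b4_def inv_b6_def inv_b8_def
    by (intro O_add O_diff O_mult O_power O_uminus O_numeral W_O)
  show "discr W \<noteq> 0" using ell change(5) unfolding change(6) discr_change_eq by simp
qed

lemma l_O: "l \<in> \<O>" and l_nz: "l \<noteq> 0"
proof -
  have fin: "finite T" and sub: "T \<subseteq> primes_of K" using T unfolding generators_above_two_def by blast+
  have "(\<Prod>\<tau>\<in>S. \<tau> ^ f \<tau>) \<in> \<O>" if "finite S" "S \<subseteq> \<O>" for S and f :: "complex \<Rightarrow> nat"
    using that by (induction S) (simp_all add: O_1 O_mult O_power)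
  then show "l \<in> \<O>" unfolding l using fin sub by (auto simp: primes_of_def)
  show "l \<noteq> 0" unfolding l using fin sub by (auto simp: primes_of_iff)
qed

lemmas ab = translate_cubic[OF l_nz model]
lemmas disc = two_torsion_discr[OF curve tors, of l, folded ab]

lemma ab_K: "a \<in> K" "b \<in> K" "a^2 - 4 * b \<in> K"
proof -
  have K: "w1 W \<in> K" "w2 W \<in> K" "w3 W \<in> K" "w4 W \<in> K" "l \<in> K" "2 \<in> K" "3 \<in> K" "4 \<in> K"
    using W_O l_O O_numeral O_in_K by blast+
  show a: "a \<in> K" "b \<in> K" unfolding ab power2_eq_square
    using K xy by (simp_all add: K_add K_mult K_divide)
  show "a^2 - 4 * b \<in> K" unfolding power2_eq_square
    using a K by (simp add: K_diff K_mult)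
qed

lemma bc_nz: "b \<noteq> 0" "a^2 - 4 * b \<noteq> 0"
proof -
  have "16 * b^2 * (a^2 - 4 * b) \<noteq> 0" unfolding disc using l_nz D_nz by simp
  then show "b \<noteq> 0" "a^2 - 4 * b \<noteq> 0" by auto
qed

end

locale minimal_two_torsion_at = minimal_two_torsion + prime_element
begin

lemmas w_int = val_ge_O[OF W_O(1)] val_ge_O[OF W_O(2)] val_ge_O[OF W_O(3)]
  val_ge_O[OF W_O(4)] val_ge_O[OF W_O(5)]

lemma val_D: "val_is (valuation K p (discr W)) (discr W)" "0 \<le> valuation K p (discr W)"
proof -
  show D: "val_is (valuation K p (discr W)) (discr W)" using O_in_K[OF D_O] D_nz by (rule val_is_valuation)
  show "0 \<le> valuation K p (discr W)" using val_is_ge[OF D val_ge_O[OF D_O]] .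
qed

lemma min_at: "minimal_model_at K p E W"
  using minimal p by (simp add: global_minimal_model_def)

text \<open>Good reduction supplies some minimal equation with unit discriminant, and the minimality
  of \<open>W\<close> carries this over to \<open>W\<close>.\<close>

lemma val_D_two:
  assumes "p divides\<^bsub>R\<^esub> 2"
  shows "val_is 0 (discr W)"
proof -
  obtain W' where W': "minimal_model_at K p E W'" "valuation K p (discr W') = 0"
    using good2[OF p assms] by (auto simp: good_reduction_def)
  then have "valuation K p (discr W) \<le> 0"
    using min_at by (auto simp: minimal_model_at_def)
  then show ?thesis using val_D by simp
qed

lemma val_2:
  assumes "p divides\<^bsub>R\<^esub> 2"
  shows "val_is (valuation K p 2) 2" "0 < valuation K p 2"
proof -
  show v: "val_is (valuation K p 2) 2" using O_in_K[OF O_2] by (rule val_is_valuation) simp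
  show "0 < valuation K p 2" using val_is_ge[OF v, of 1] dvd_iff[OF O_2] assms by simp
qed

lemma at_two: "p divides\<^bsub>R\<^esub> 2 \<Longrightarrow> two_torsion_at_two K (valuation K p) W x y (valuation K p 2)"
  using w_int xy curve tors val_2 val_D_two by unfold_locales

lemma ordinary:
  assumes two: "p divides\<^bsub>R\<^esub> 2" and ord: "val_is 0 (w1 W)"
  defines "e \<equiv> valuation K p 2"
  shows "val_is 0 a \<and> val_is (4 * e) b \<and> val_is 0 (a^2 - 4 * b) \<or>
    val_is e a \<and> val_is 0 b \<and> val_is (8 * e) (a^2 - 4 * b)"
proof -
  interpret t: two_torsion_at_two K "valuation K p" W x y e unfolding e_def using two by (rule at_two)
  obtain n where n: "2 * e = int n" using t.two(2) by (metis zero_le_imp_eq_int le_less zero_le_mult_iff zero_le_numeral)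
  note f = t.ordinary_f(2-4)[OF ord, unfolded t.f2_def t.f4_def t.f6_def]
  \<comment> \<open>The exponent is 2e because \<open>f2\<close> has valuation exactly -2e; the
    bounds -e and -2e for the other coefficients lie above the required -4e and -6e.\<close>
  have "val_is (int n) l" unfolding l
    by (rule val_scaling_factor[OF T two val_is_cong[OF f(1)] val_ge_mono[OF f(2)] val_ge_mono[OF f(3)]])
      (use n t.two(2) in auto)
  then have "val_is (2 * e) l" using n by simp
  from t.ordinary_model[OF ord this, unfolded t.f2_def t.f4_def, OF ab] show ?thesis .
qed

lemma supersingular:
  assumes two: "p divides\<^bsub>R\<^esub> 2" and ss: "val_ge 1 (w1 W)"
  shows "val_ge 2 a" "val_is 0 b" "val_is 4 (a^2 - 4 * b)" "valuation K p 2 = 2"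
proof -
  interpret t: two_torsion_at_two K "valuation K p" W x y "valuation K p 2" using two by (rule at_two)
  note f = t.supersingular_f[OF ss ram_index_le_2, unfolded t.f2_def t.f4_def t.f6_def]
  \<comment> \<open>Exponent 2 because \<open>f2\<close> has valuation -2; the bounds -1 and -4 are
    not below the required -4 and -6.\<close>
  have "val_is (int 2) l" unfolding l
    by (rule val_scaling_factor[OF T two val_is_cong[OF f(1)] val_ge_mono[OF f(2)] val_ge_mono[OF f(3)]])
      auto
  then have "val_is 2 l" by simp
  from t.supersingular_model[OF ss ram_index_le_2 this, unfolded t.f2_def t.f4_def, OF ab]
  show "val_ge 2 a" "val_is 0 b" "val_is 4 (a^2 - 4 * b)" .
  show "valuation K p 2 = 2" using t.supersingular_root(1)[OF ss ram_index_le_2] .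
qed

lemma w1_cases: "val_is 0 (w1 W) \<or> val_ge 1 (w1 W)"
  using val_is_cases[OF w_int(1)] by simp

lemma odd_units:
  assumes "\<not> p divides\<^bsub>R\<^esub> 2"
  shows "val_is 0 2" "val_is 0 4" "val_is 0 l"
proof -
  show "val_is 0 2" using assms val_is_0_iff[OF O_2] by simp
  then show "val_is 0 4" using val_is_4[of 0] by simp
  show "val_is 0 l" unfolding l using assms by (rule val_scaling_factor_odd[OF T])
qed

lemma odd_disc:
  assumes odd: "\<not> p divides\<^bsub>R\<^esub> 2"
  shows "val_is (valuation K p b) b" "val_is (valuation K p (a^2 - 4 * b)) (a^2 - 4 * b)"
    "2 * valuation K p b + valuation K p (a^2 - 4 * b) = valuation K p (discr W)"
  using val_discr_E_ab[OF ab_K(2,3) disc odd_units(1)[OF odd] odd_units(3)[OF odd] val_D(1)] by auto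

text \<open>Since 4 is a unit, the 2-division polynomial divided by 4 is a monic integral equation
  for x; integrality of a and b follows from that of x.\<close>

lemma odd_integral:
  assumes odd: "\<not> p divides\<^bsub>R\<^esub> 2"
  shows "val_ge 0 a" "val_ge 0 b"
proof -
  note u = odd_units[OF odd]
  have f: "val_ge 0 (w2 W + (w1 W)^2 / 4)" "val_ge 0 (w4 W + w1 W * w3 W / 2)"
    using val_ge_divide[OF val_ge_integral(2)[OF w_int(1)] u(2), of 2]
      val_ge_divide[OF val_ge_integral(1)[OF w_int(1) w_int(3)] u(1)] w_int by (auto intro: val_ge_add)
  have f6: "val_ge 0 (inv_b6 W / 4)" "val_ge 0 (inv_b2 W / 4)" "val_ge 0 (2 * inv_b4 W / 4)"
    using val_ge_divide[OF _ u(2), of 0] val_ge_inv_b[OF w_int] val_ge_integral(1)[OF val_ge_numeral]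
    by (metis diff_self)+
  have "x^3 + (inv_b2 W / 4) * x^2 + (2 * inv_b4 W / 4) * x + inv_b6 W / 4 =
      (4 * x^3 + inv_b2 W * x^2 + 2 * inv_b4 W * x + inv_b6 W) / 4"
    by (simp add: add_divide_distrib)
  also have "\<dots> = 0" unfolding two_torsion_cubic[OF curve tors] by simp
  finally have "x^3 + (inv_b2 W / 4) * x^2 + (2 * inv_b4 W / 4) * x + inv_b6 W / 4 = 0" .
  from monic_cubic_root_integral[OF xy(1) f6(2,3,1) this] have x: "val_ge 0 x" .
  show "val_ge 0 a" unfolding ab(1)
    by (rule val_ge_integral(1)[OF val_ge_O[OF l_O]]) (rule val_ge_add[OF val_ge_integral(1)[OF val_ge_numeral x] f(1)])
  show "val_ge 0 b" unfolding ab(2)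
    by (rule val_ge_integral(1)[OF val_ge_integral(2)[OF val_ge_O[OF l_O]]])
      (rule val_ge_add[OF val_ge_add[OF val_ge_integral(1)[OF val_ge_numeral val_ge_integral(2)[OF x]]
        val_ge_integral(1)[OF val_ge_integral(1)[OF val_ge_numeral f(1)] x]] f(2)])
qed

text \<open>Otherwise moving the point to the origin and scaling by u = p would give an integral
  equation whose discriminant has valuation smaller by 12.\<close>

lemma odd_minimal:
  assumes odd: "\<not> p divides\<^bsub>R\<^esub> 2"
  shows "\<not> (val_ge 2 a \<and> val_ge 4 b)"
proof
  assume ge: "val_ge 2 a \<and> val_ge 4 b"
  note u = odd_units[OF odd]
  define W' where "W' = change_eq p x (- w1 W / 2) y W"
  have W'_eq: "W' = E_ab (a / l / p^2) (b / l^2 / p^4)"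
    unfolding W'_def change_eq_two_torsion[OF curve tors] ab using l_nz by simp
  have K: "p \<in> K" "- w1 W / 2 \<in> K" "l \<in> K" using p_O W_O(1) O_2 l_O O_in_K by (auto intro: K_divide K_uminus)
  have "isomorphic_over K E W'"
    unfolding isomorphic_over_def
  proof (intro bexI conjI)
    \<comment> \<open>Minimality refers to equations isomorphic to \<open>E\<close>, so the changes
      from \<open>E\<close> to \<open>W\<close> and from \<open>W\<close> to \<open>W'\<close> are
      composed.\<close>
    show "W' = change_eq (u * p) (u^2 * x + r) (u * (- w1 W / 2) + s0) (u^3 * y + u^2 * x * s0 + t) E"
      unfolding W'_def change(6) by (rule change_eq_comp[OF change(5)])
    show "u * p \<noteq> 0" using change(5) p_nz by simp
    show "u * p \<in> K" "u^2 * x + r \<in> K" "u * (- w1 W / 2) + s0 \<in> K" "u^3 * y + u^2 * x * s0 + t \<in> K"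
      unfolding power2_eq_square power3_eq_cube
      by (intro K_add K_mult K(1) K(2) change(1-4) xy)+
  qed
  moreover have "val_ge 0 (a / l / p^2)" "val_ge 0 (b / l^2 / p^4)"
    using val_ge_divide[OF val_ge_divide[OF conjunct1[OF ge] u(3)] val_is_power[OF val_is_p, of 2]]
      val_ge_divide[OF val_ge_divide[OF conjunct2[OF ge] val_is_power[OF u(3), of 2]] val_is_power[OF val_is_p, of 4]]
    by simp_all
  then have "p_integral_eq K p W'"
    using val_ge_0[of 0] unfolding W'_eq
    by (simp add: p_integral_eq_def coeffs_in_def E_ab_def flip: val_ge_iff_p_integral)
  ultimately have "valuation K p (discr W) \<le> valuation K p (discr W')"
    using min_at by (auto simp: minimal_model_at_def)
  moreover have "val_is (valuation K p (discr W) - 12) (discr W')"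
    unfolding W'_def discr_change_eq using val_is_divide[OF val_D(1) val_is_power[OF val_is_p, of 12]] by simp
  ultimately show False by (simp add: val_is_def)
qed

lemma ab_integral: "val_ge 0 a" "val_ge 0 b"
proof -
  have "val_ge 0 a \<and> val_ge 0 b"
  proof (cases "p divides\<^bsub>R\<^esub> 2")
    case True
    note e = val_2(2)[OF True]
    from w1_cases show ?thesis
    proof
      assume "val_is 0 (w1 W)"
      from ordinary[OF True this] show ?thesis
        using e by (elim disjE conjE; intro conjI; elim val_is_imp_ge; simp)
    next
      assume ss: "val_ge 1 (w1 W)"
      show ?thesis
        using val_ge_mono[OF supersingular(1)[OF True ss]] val_is_imp_ge[OF supersingular(2)[OF True ss]] by simp
    qed
  qed (use odd_integral in blast)
  then show "val_ge 0 a" "val_ge 0 b" by blast+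
qed

end

context quadratic_pid
begin

lemma integral_everywhere:
  assumes "x \<in> K" "\<And>p. prime_element K d p \<Longrightarrow> valued_field.val_ge K (valuation K p) 0 x"
  shows "x \<in> \<O>"
proof (rule locally_integral[OF assms(1)])
  fix p assume pr: "p \<in> primes_of K"
  interpret prime_element K d p by unfold_locales (rule pr)
  show "p_integral K p x" using assms(2)[OF prime_element_axioms] by (simp add: val_ge_iff_p_integral)
qed

end

section \<open>The valuations of A, B and C\<close>

locale descent_data = minimal_two_torsion +
  fixes \<tau> P A s B C a' :: complex
  assumes tau: "generates_part_of_two K (\<lambda>q. q divides\<^bsub>R\<^esub> a) \<tau>"
    and P: "is_gcd R {discr W, b, a^2 - 4 * b} P"
    and s: "s \<in> \<O>" and A: "square_free R A" and PA: "P = A * s^2"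
    and B: "B = (a^2 - 4 * b) / (\<tau>^2 * P)" and C: "C = 4 * b / (\<tau>^2 * P)"
    and a': "a' = a * s / (\<tau> * P)"
begin

lemma abc_O: "a \<in> \<O>" "b \<in> \<O>" "a^2 - 4 * b \<in> \<O>"
proof -
  have at: "minimal_two_torsion_at K d E W u r s0 t x y l a b T p" if "prime_element K d p" for p
    using that by (intro minimal_two_torsion_at.intro minimal_two_torsion_axioms)
  show ab: "a \<in> \<O>" "b \<in> \<O>"
    using integral_everywhere[OF ab_K(1)] integral_everywhere[OF ab_K(2)]
      minimal_two_torsion_at.ab_integral[OF at] by blast+
  show "a^2 - 4 * b \<in> \<O>" by (intro O_diff O_power O_mult O_numeral ab)
qed

lemma nz: "\<tau> \<noteq> 0" "P \<noteq> 0" "A \<noteq> 0" "s \<noteq> 0" "B \<noteq> 0" "C \<noteq> 0"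
proof -
  show t: "\<tau> \<noteq> 0" using tau by (simp add: generates_part_of_two_def)
  have "P divides\<^bsub>R\<^esub> discr W" using P by (simp add: is_gcd_def)
  then show nzP: "P \<noteq> 0" using D_nz by (auto simp: divides_R)
  then show "A \<noteq> 0" "s \<noteq> 0" using PA by auto
  show "B \<noteq> 0" "C \<noteq> 0" unfolding B C using t nzP bc_nz by simp_all
qed

lemma relation: "a'^2 * A = B + C"
proof -
  have "B + C = a^2 / (\<tau>^2 * P)" unfolding B C by (simp flip: add_divide_distrib)
  moreover have "a'^2 * A = a^2 * (A * s^2) / (\<tau>^2 * P^2)"
    unfolding a' by (simp add: power_mult_distrib power_divide)
  ultimately show ?thesis unfolding PA[symmetric] using nz by (simp add: power2_eq_square)
qed

lemma ABC_K: "A \<in> K" "B \<in> K" "C \<in> K" "a' \<in> K"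
proof -
  have K: "\<tau> \<in> K" "P \<in> K" "A \<in> K" "4 \<in> K" "s \<in> K"
    using tau P A s O_numeral O_in_K by (auto simp: generates_part_of_two_def is_gcd_def square_free_def)
  then show "A \<in> K" "B \<in> K" "C \<in> K" "a' \<in> K"
    unfolding B C a' power2_eq_square using ab_K by (simp_all add: K_mult K_divide power2_eq_square)
qed

end

locale descent_data_at = descent_data + minimal_two_torsion_at
begin

definition vA where "vA = valuation K p A"
definition vB where "vB = valuation K p B"
definition vC where "vC = valuation K p C"

lemma vals: "val_is vA A" "val_is vB B" "val_is vC C"
  unfolding vA_def vB_def vC_def using ABC_K nz by (auto intro: val_is_valuation)

lemma A_bounds: "0 \<le> vA" "vA \<le> 1"
  using val_square_free[OF A] vals(1) val_is_unique by metis+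

lemma tau_val: "val_is (if p divides\<^bsub>R\<^esub> 2 \<and> p divides\<^bsub>R\<^esub> a then valuation K p 2 else 0) \<tau>"
  using tau p O_in_K by (simp add: generates_part_of_two_def ram_index_two_def val_is_def)

lemma S_O: "{discr W, b, a^2 - 4 * b} \<subseteq> \<O>"
  using D_O abc_O by simp

lemma A_P_val:
  assumes "val_is n P"
  shows "vA + 2 * valuation K p s = n"
proof -
  have "val_is (valuation K p s) s" using O_in_K[OF s] nz(4) by (rule val_is_valuation)
  from val_is_mult[OF vals(1) val_is_square[OF this]] show ?thesis
    using assms val_is_unique unfolding PA[symmetric] by blast
qed

lemma s_val: "0 \<le> valuation K p s"
  using val_ge_O[OF s] nz(4) by (simp add: val_ge_def)

lemma BC_val:
  assumes "val_is e 2" "val_is n \<tau>" "val_is m P" "val_is \<beta> b" "val_is \<delta> (a^2 - 4 * b)"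
  shows "vB = \<delta> - (2 * n + m)" "vC = 2 * e + \<beta> - (2 * n + m)"
proof -
  have den: "val_is (2 * n + m) (\<tau>^2 * P)" using val_is_mult[OF val_is_square[OF assms(2)] assms(3)] .
  show "vB = \<delta> - (2 * n + m)"
    using val_is_divide[OF assms(5) den] vals(2) val_is_unique unfolding B by blast
  show "vC = 2 * e + \<beta> - (2 * n + m)"
    using val_is_divide[OF val_is_mult[OF val_is_4[OF assms(1)] assms(4)] den] vals(3) val_is_unique
    unfolding C by blast
qed

text \<open>P divides the discriminant, a unit above 2; hence v(A) + 2 v(s) = 0 with both terms
  nonnegative.\<close>

lemma two_P:
  assumes two: "p divides\<^bsub>R\<^esub> 2"
  shows "val_is 0 P" "vA = 0"
proof -
  have "val_is 0 (discr W)" using two by (rule val_D_two)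
  then show P0: "val_is 0 P"
    using S_O by (intro val_gcd[OF P S_O, of "discr W"]) (auto intro!: val_ge_O)
  show "vA = 0" using A_P_val[OF P0] A_bounds s_val by presburger
qed

text \<open>The factor \<tau> separates the two local models. If a is a unit, so is \<tau>, and C
  has valuation 2e + 4e; if v(a) = e, then v(\<tau>) = e, so B has valuation 8e - 2e and C has 2e -
  2e.\<close>

lemma ordinary_triple:
  assumes two: "p divides\<^bsub>R\<^esub> 2" and ord: "val_is 0 (w1 W)"
  shows "vA = 0 \<and> (vB = 6 * valuation K p 2 \<and> vC = 0 \<or> vB = 0 \<and> vC = 6 * valuation K p 2)"
proof -
  define e where "e = valuation K p 2"
  have e: "val_is e 2" "0 < e" unfolding e_def using two by (rule val_2)+
  from ordinary[OF two ord, folded e_def] have "vB = 6 * e \<and> vC = 0 \<or> vB = 0 \<and> vC = 6 * e"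
  proof (elim disjE conjE)
    assume v: "val_is 0 a" "val_is (4 * e) b" "val_is 0 (a^2 - 4 * b)"
    have "\<not> p divides\<^bsub>R\<^esub> a" using val_is_0_iff[OF abc_O(1)] v(1) by blast
    then have "val_is 0 \<tau>" using tau_val by simp
    from BC_val[OF e(1) this two_P(1)[OF two] v(2,3)] show ?thesis by simp
  next
    assume v: "val_is e a" "val_is 0 b" "val_is (8 * e) (a^2 - 4 * b)"
    have "p divides\<^bsub>R\<^esub> a" using dvd_iff[OF abc_O(1)] val_is_imp_ge[OF v(1), of 1] e(2) by simp
    then have "val_is e \<tau>" using tau_val two by (simp add: e_def)
    from BC_val[OF e(1) this two_P(1)[OF two] v(2,3)] show ?thesis by simp
  qed
  then show ?thesis using two_P(2)[OF two] by (simp add: e_def)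
qed

text \<open>Both a^2 - 4b and 4b have valuation 4, and v(\<tau>) = e = 2 removes exactly
  this.\<close>

lemma supersingular_triple:
  assumes two: "p divides\<^bsub>R\<^esub> 2" and ss: "val_ge 1 (w1 W)"
  shows "vA = 0 \<and> vB = 0 \<and> vC = 0"
proof -
  note v = supersingular[OF two ss]
  have e: "val_is 2 2" using val_2(1)[OF two] v(4) by simp
  have "p divides\<^bsub>R\<^esub> a" using dvd_iff[OF abc_O(1)] val_ge_mono[OF v(1), of 1] by simp
  then have "val_is 2 \<tau>" using tau_val two v(4) by simp
  from BC_val[OF e this two_P(1)[OF two] v(2,3)] two_P(2)[OF two] show ?thesis by simp
qed

lemma odd_triple:
  assumes odd: "\<not> p divides\<^bsub>R\<^esub> 2"
  defines "k \<equiv> valuation K p (discr W)"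
  shows "vA = 0 \<and> vB = k \<and> vC = 0 \<or> vA = 0 \<and> vB = k - 6 \<and> vC = 0 \<or>
    vA = 0 \<and> vB = 0 \<and> 2 * vC = k \<or> vA = 0 \<and> vB = 0 \<and> 2 * vC = k - 6 \<or>
    vA = 1 \<and> vB = 0 \<and> vC = 0"
    and "0 \<le> vB" "0 \<le> vC" "vB = 0 \<or> vC = 0" "k = 0 \<Longrightarrow> vA = 0 \<and> vB = 0 \<and> vC = 0"
proof -
  define \<beta> \<delta> where "\<beta> = valuation K p b" and "\<delta> = valuation K p (a^2 - 4 * b)"
  note bc = odd_disc[OF odd, folded \<beta>_def \<delta>_def k_def]
  have nonneg: "0 \<le> \<beta>" "0 \<le> \<delta>"
    using val_is_ge[OF bc(1) val_ge_O] val_is_ge[OF bc(2) val_ge_O] abc_O by blast+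
  \<comment> \<open>The discriminant does not lower the minimum: its valuation is
    \<open>2 * \<beta> + \<delta>\<close> with \<beta> and \<delta> nonnegative.\<close>
  have P_val: "val_is (min \<beta> \<delta>) P"
  proof (cases "\<beta> \<le> \<delta>")
    case True
    then show ?thesis using bc nonneg val_D(1)[folded k_def]
      by (intro val_gcd[OF P S_O, of b]) (auto intro: val_is_imp_ge)
  next
    case False
    then show ?thesis using bc nonneg val_D(1)[folded k_def]
      by (intro val_gcd[OF P S_O, of "a^2 - 4 * b"]) (auto intro: val_is_imp_ge)
  qed
  have tau0: "val_is 0 \<tau>" using tau_val odd by simp
  note BC = BC_val[OF odd_units(1)[OF odd] tau0 P_val bc(1,2)]
  then have B': "vB = \<delta> - min \<beta> \<delta>" and C': "vC = \<beta> - min \<beta> \<delta>" by simp_all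
  show "vA = 0 \<and> vB = k \<and> vC = 0 \<or> vA = 0 \<and> vB = k - 6 \<and> vC = 0 \<or>
    vA = 0 \<and> vB = 0 \<and> 2 * vC = k \<or> vA = 0 \<and> vB = 0 \<and> 2 * vC = k - 6 \<or>
    vA = 1 \<and> vB = 0 \<and> vC = 0"
    by (rule val_odd_triple[OF ab_K(1) odd_units(1)[OF odd] bc(1,2) nonneg odd_minimal[OF odd]
        A_bounds A_P_val[OF P_val] bc(3)[symmetric] B' C'])
  show "0 \<le> vB" "0 \<le> vC" "vB = 0 \<or> vC = 0" using B' C' by (auto simp: min_def)
  show "vA = 0 \<and> vB = 0 \<and> vC = 0" if "k = 0"
  proof -
    have "\<beta> = 0" "\<delta> = 0" using that bc(3) nonneg by auto
    then show ?thesis using B' C' A_P_val[OF P_val] A_bounds s_val by auto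
  qed
qed

lemma BC_nonneg: "0 \<le> vB" "0 \<le> vC" "vB = 0 \<or> vC = 0"
proof -
  have "0 \<le> vB \<and> 0 \<le> vC \<and> (vB = 0 \<or> vC = 0)"
  proof (cases "p divides\<^bsub>R\<^esub> 2")
    case True
    then show ?thesis
      using w1_cases ordinary_triple[OF True] supersingular_triple[OF True] val_2(2)[OF True] by auto
  qed (use odd_triple in blast)
  then show "0 \<le> vB" "0 \<le> vC" "vB = 0 \<or> vC = 0" by blast+
qed

text \<open>The right side of a'^2 A = B + C is integral and v(A) is at most 1, so 2 v(a') is at
  least -1 and v(a') cannot be negative.\<close>

lemma a'_integral: "val_ge 0 a'"
proof (cases "a' = 0")
  case False
  then have v: "val_is (valuation K p a') a'" using ABC_K(4) by (intro val_is_valuation)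
  have "val_ge 0 (a'^2 * A)"
    unfolding relation using vals BC_nonneg by (intro val_ge_add) (auto intro: val_is_imp_ge)
  then have "0 \<le> 2 * valuation K p a' + vA" using val_is_ge[OF val_is_mult[OF val_is_square[OF v] vals(1)]] by blast
  then have "0 \<le> valuation K p a'" using A_bounds(2) by presburger
  then show ?thesis using v val_is_imp_ge by blast
qed (simp add: val_ge_0)

lemma support:
  assumes "\<not> p divides\<^bsub>R\<^esub> (2 * discr W)"
  shows "val_is 0 A" "val_is 0 B" "val_is 0 C"
proof -
  have two: "\<not> p divides\<^bsub>R\<^esub> 2" using assms dvd_mult D_O by blast
  have "\<not> p divides\<^bsub>R\<^esub> discr W"
    using assms dvd_mult[of p "discr W" 2] O_2 by (auto simp: mult.commute)
  then have "val_is 0 (discr W)" using val_is_0_iff[OF D_O] by blast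
  then have "valuation K p (discr W) = 0" by (simp add: val_is_def)
  then show "val_is 0 A" "val_is 0 B" "val_is 0 C" using odd_triple(5)[OF two] vals by simp_all
qed

end

context descent_data
begin

lemma at: "p \<in> primes_of K \<Longrightarrow> descent_data_at K d E W u r s0 t x y l a b T \<tau> P A s B C a' p"
  by (intro descent_data_at.intro minimal_two_torsion_at.intro descent_data_axioms
      minimal_two_torsion_axioms prime_element.intro quadratic_pid_axioms prime_element_axioms.intro)

lemma ABC_O: "A \<in> \<O>" "B \<in> \<O>" "C \<in> \<O>" "a' \<in> \<O>"
proof -
  show "A \<in> \<O>" using A by (simp add: square_free_def)
  have "valued_field.val_ge K (valuation K p) 0 B \<and> valued_field.val_ge K (valuation K p) 0 C \<and>
      valued_field.val_ge K (valuation K p) 0 a'" if "prime_element K d p" for p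
  proof -
    interpret descent_data_at K d E W u r s0 t x y l a b T \<tau> P A s B C a' p
      by (rule at[OF prime_element.p[OF that]])
    show ?thesis using vals BC_nonneg a'_integral by (auto intro: val_is_imp_ge)
  qed
  then show "B \<in> \<O>" "C \<in> \<O>" "a' \<in> \<O>" using integral_everywhere ABC_K by blast+
qed

text \<open>A nonunit common divisor is nonzero because B is, so it has a prime factor, at which one
  of B and C has valuation 0.\<close>

lemma BC_coprime: "is_gcd R {B, C} 1"
  unfolding is_gcd_def
proof (intro conjI ballI impI)
  show "1 \<in> \<O>" by (rule O_1)
  show "1 divides\<^bsub>R\<^esub> z" if "z \<in> {B, C}" for z using that ABC_O by (auto simp: divides_R)
  fix h assume h: "h \<in> \<O>" "\<forall>x\<in>{B, C}. h divides\<^bsub>R\<^esub> x"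
  have "h \<noteq> 0" using h(2) nz(5) by (auto simp: divides_R)
  have "h \<in> Units R"
  proof (rule ccontr)
    assume "h \<notin> Units R"
    then obtain q where q: "q \<in> primes_of K" "q divides\<^bsub>R\<^esub> h"
      using exists_prime_divisor h(1) \<open>h \<noteq> 0\<close> by blast
    interpret descent_data_at K d E W u r s0 t x y l a b T \<tau> P A s B C a' q by (rule at[OF q(1)])
    have "q divides\<^bsub>R\<^esub> B" "q divides\<^bsub>R\<^esub> C" using q(2) h(2) dvd_trans by blast+
    then have "\<not> val_is 0 B" "\<not> val_is 0 C" using val_is_0_iff ABC_O by blast+
    then show False using BC_nonneg(3) vals by auto
  qed
  then show "h divides\<^bsub>R\<^esub> 1" by (auto simp: Units_R divides_R)
qed

lemma only_bad_primes:
  "only_primes_dividing K A (2 * discr W)" "only_primes_dividing K B (2 * discr W)"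
  "only_primes_dividing K C (2 * discr W)"
proof -
  have "q divides\<^bsub>R\<^esub> (2 * discr W)"
    if q: "q \<in> primes_of K" "q divides\<^bsub>R\<^esub> A \<or> q divides\<^bsub>R\<^esub> B \<or> q divides\<^bsub>R\<^esub> C" for q
  proof (rule ccontr)
    assume not: "\<not> q divides\<^bsub>R\<^esub> (2 * discr W)"
    interpret descent_data_at K d E W u r s0 t x y l a b T \<tau> P A s B C a' q by (rule at[OF q(1)])
    show False using support[OF not] q(2) val_is_0_iff ABC_O by blast
  qed
  then show "only_primes_dividing K A (2 * discr W)" "only_primes_dividing K B (2 * discr W)"
    "only_primes_dividing K C (2 * discr W)" unfolding only_primes_dividing_def by blast+
qed

lemma bad_triple:
  assumes q: "q \<in> primes_of K" "q divides\<^bsub>R\<^esub> discr W"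
  shows "let k = real_of_int (valuation K q (discr W)); k' = k - 6
    in val3 K q A B C \<in> {(0, k, 0), (0, k', 0), (0, 0, k / 2), (0, 0, k' / 2), (1, 0, 0)}"
proof -
  interpret descent_data_at K d E W u r s0 t x y l a b T \<tau> P A s B C a' q by (rule at[OF q(1)])
  \<comment> \<open>Above 2 the discriminant is a unit, so its prime divisors are odd.\<close>
  have "\<not> q divides\<^bsub>R\<^esub> 2" using val_D_two val_is_0_iff[OF D_O] q(2) by blast
  from odd_triple(1)[OF this] show ?thesis
    unfolding val3_def Let_def vA_def vB_def vC_def by (elim disjE conjE) auto
qed

lemma ordinary_at_triple:
  assumes q: "q \<in> primes_of K" "q divides\<^bsub>R\<^esub> 2" "ordinary_at K W q"
  shows "let e = real_of_int (ram_index_two K q)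
    in val3 K q A B C \<in> {(0, 6 * e, 0), (0, 0, 6 * e)}"
proof -
  interpret descent_data_at K d E W u r s0 t x y l a b T \<tau> P A s B C a' q by (rule at[OF q(1)])
  have "val_is 0 (w1 W)" using q(3) O_in_K[OF W_O(1)] by (auto simp: ordinary_at_def val_is_def)
  from ordinary_triple[OF q(2) this] show ?thesis
    unfolding val3_def Let_def ram_index_two_def vA_def vB_def vC_def by auto
qed

lemma supersingular_at_triple:
  assumes q: "q \<in> primes_of K" "q divides\<^bsub>R\<^esub> 2" "supersingular_at K W q"
  shows "val3 K q A B C = (0, 0, 0)"
proof -
  interpret descent_data_at K d E W u r s0 t x y l a b T \<tau> P A s B C a' q by (rule at[OF q(1)])
  have "val_ge 1 (w1 W)" using q(3) O_in_K[OF W_O(1)] by (auto simp: supersingular_at_def val_ge_def)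
  from supersingular_triple[OF q(2) this] show ?thesis
    unfolding val3_def vA_def vB_def vC_def by simp
qed

end

section \<open>The point of order two under a change of variables\<close>

lemma order_two_point:
  assumes "ec_has_order E (EC_pt x y) 2"
  shows "2 * y + w1 E * x + w3 E = 0"
proof -
  have "ec_multiple E 2 (EC_pt x y) = EC_zero" using assms by (simp add: ec_has_order_def)
  then have "ec_add E (EC_pt x y) (EC_pt x y) = EC_zero"
    by (simp add: ec_multiple_def numeral_2_eq_2)
  \<comment> \<open>Only the first branch of \<open>ec_add\<close> returns \<open>EC_zero\<close>;
    the chord and tangent branch returns an affine point.\<close>
  then have "y + y + w1 E * x + w3 E = 0" by (simp add: Let_def split: if_splits)
  then show ?thesis by simp
qed

text \<open>An identity between the defining polynomials, valid off the curve too, so that it can be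
  chained with the scaling.\<close>

lemma curve_translate:
  fixes x y r s t :: complex and E :: weierstrass
  defines "x1 \<equiv> x + r" and "y1 \<equiv> y + s * x + t" and "E' \<equiv> change_eq 1 r s t E"
  shows "y^2 + w1 E' * x * y + w3 E' * y - (x^3 + w2 E' * x^2 + w4 E' * x + w6 E') =
    y1^2 + w1 E * x1 * y1 + w3 E * y1 - (x1^3 + w2 E * x1^2 + w4 E * x1 + w6 E)"
  unfolding x1_def y1_def E'_def change_eq_def
  by (simp add: algebra_simps power2_eq_square power3_eq_cube)

lemma curve_scale:
  fixes x y u :: complex and E :: weierstrass
  assumes "u \<noteq> 0"
  defines "E' \<equiv> change_eq u 0 0 0 E"
  shows "u^6 * ((y / u^3)^2 + w1 E' * (x / u^2) * (y / u^3) + w3 E' * (y / u^3) -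
      ((x / u^2)^3 + w2 E' * (x / u^2)^2 + w4 E' * (x / u^2) + w6 E')) =
    y^2 + w1 E * x * y + w3 E * y - (x^3 + w2 E * x^2 + w4 E * x + w6 E)"
proof -
  have p: "u^6 = u * u * u * u * u * u" "u^4 = u * u * u * u" by (simp_all add: eval_nat_numeral)
  show ?thesis
    using assms(1) unfolding E'_def change_eq_def
    by (simp add: p power2_eq_square power3_eq_cube distrib_left right_diff_distrib)
qed

lemma two_torsion_change:
  assumes u: "u \<noteq> 0" and W: "W = change_eq u r s t E"
    and pt: "change_pt u r s t (EC_pt x1 y1) = EC_pt x y"
    and curve: "y1^2 + w1 E * x1 * y1 + w3 E * y1 = x1^3 + w2 E * x1^2 + w4 E * x1 + w6 E"
    and tors: "2 * y1 + w1 E * x1 + w3 E = 0"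
  shows "y^2 + w1 W * x * y + w3 W * y = x^3 + w2 W * x^2 + w4 W * x + w6 W"
    and "2 * y + w1 W * x + w3 W = 0"
proof -
  define x2 y2 where x2: "x2 = x1 - r" and y2: "y2 = y1 - s * (x1 - r) - t"
  have xy: "x = x2 / u^2" "y = y2 / u^3" using pt by (simp_all add: x2 y2)
  define F where "F = change_eq 1 r s t E"
  have WF: "W = change_eq u 0 0 0 F" unfolding W F_def by (rule change_eq_split)
  have x1y1: "x2 + r = x1" "y2 + s * x2 + t = y1" by (simp_all add: x2 y2)
  have "y2^2 + w1 F * x2 * y2 + w3 F * y2 - (x2^3 + w2 F * x2^2 + w4 F * x2 + w6 F) = 0"
    using curve_translate[of y2 r s t E x2] curve unfolding F_def by (simp add: x1y1)
  then have "u^6 * (y^2 + w1 W * x * y + w3 W * y - (x^3 + w2 W * x^2 + w4 W * x + w6 W)) = 0"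
    unfolding WF xy curve_scale[OF u] .
  then show "y^2 + w1 W * x * y + w3 W * y = x^3 + w2 W * x^2 + w4 W * x + w6 W"
    using u by simp
  have "2 * y + w1 W * x + w3 W = (2 * y1 + w1 E * x1 + w3 E) / u^3"
    using u unfolding W change_eq_def xy x2 y2
    by (simp add: field_simps power2_eq_square power3_eq_cube)
  then show "2 * y + w1 W * x + w3 W = 0" using tors by simp
qed

context quadratic_pid
begin

text \<open>The exponent is a sum of two natural numbers, and the tame one vanishes only for good
  reduction.\<close>

lemma odd_conductor_good_reduction:
  assumes "is_conductor K E N" "odd_in K N" "q \<in> primes_of K" "q divides\<^bsub>R\<^esub> 2"
  shows "good_reduction K E q"
proof -
  interpret prime_element K d q by unfold_locales (rule assms(3))
  have N: "N \<in> \<O>" "valuation K q N = int (conductor_exponent K E q)"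
    using assms(1,3) by (auto simp: is_conductor_def)
  have "\<not> q divides\<^bsub>R\<^esub> N"
    using assms(2,4) p_not_dvd_1 p_O by (auto simp: odd_in_def is_gcd_def)
  then have "val_is 0 N" using val_is_0_iff[OF N(1)] by blast
  then have "conductor_exponent K E q = 0" using N(2) by (simp add: val_is_def)
  then show ?thesis by (simp add: conductor_exponent_def split: if_splits)
qed

end

theorem theorem5p4:
  fixes K :: "complex set" and O_K :: "complex set"
  assumes K: "imaginary_quadratic_field K" "class_number K = 1"
    and O_K: "O_K = carrier (integers_of K)"
  shows
    "(\<forall>E N T u r s0 t W xT yT D a b \<tau>\<^sub>a \<tau>\<^sub>b P A s B C a'.
        elliptic_curve K E \<and>
        T \<in> ec_points E K \<and> ec_has_order E T 2 \<and>
        is_conductor K E N \<and> odd_in K N \<and>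
        u \<in> K \<and> r \<in> K \<and> s0 \<in> K \<and> t \<in> K \<and> u \<noteq> 0 \<and>
        W = change_eq u r s0 t E \<and> global_minimal_model K E W \<and>
        change_pt u r s0 t T = EC_pt xT yT \<and>
        D = discr W \<and>
        two_torsion_model K W xT a b \<and>
        generates_part_of_two K (\<lambda>q. q divides\<^bsub>integers_of K\<^esub> a) \<tau>\<^sub>a \<and>
        generates_part_of_two K (\<lambda>q. \<not> q divides\<^bsub>integers_of K\<^esub> a) \<tau>\<^sub>b \<and>
        \<tau>\<^sub>a * \<tau>\<^sub>b = 2 \<and>
        is_gcd (integers_of K) {D, b, a^2 - 4 * b} P \<and>
        s \<in> O_K \<and> square_free (integers_of K) A \<and> P = A * s^2 \<and>
        B = (a^2 - 4 * b) / (\<tau>\<^sub>a^2 * P) \<and>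
        C = 4 * b / (\<tau>\<^sub>a^2 * P) \<and>
        a' = a * s / (\<tau>\<^sub>a * P)
      \<longrightarrow>
        a'^2 * A = B + C \<and>
        a' \<in> O_K \<and> A \<in> O_K \<and> B \<in> O_K \<and> C \<in> O_K \<and>
        is_gcd (integers_of K) {B, C} 1 \<and> square_free (integers_of K) A \<and>
        only_primes_dividing K A (2 * D) \<and>
        only_primes_dividing K B (2 * D) \<and>
        only_primes_dividing K C (2 * D) \<and>
        (\<forall>p\<in>primes_of K. p divides\<^bsub>integers_of K\<^esub> D \<longrightarrow>
          (let k = real_of_int (valuation K p D); k' = k - 6
           in val3 K p A B C \<in>
                {(0, k, 0), (0, k', 0), (0, 0, k / 2), (0, 0, k' / 2), (1, 0, 0)})) \<and>
        (\<forall>q\<in>primes_of K. q divides\<^bsub>integers_of K\<^esub> 2 \<and> ordinary_at K W q \<longrightarrow>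
          (let e = real_of_int (ram_index_two K q)
           in val3 K q A B C \<in> {(0, 6 * e, 0), (0, 0, 6 * e)})) \<and>
        (\<forall>q\<in>primes_of K. q divides\<^bsub>integers_of K\<^esub> 2 \<and> supersingular_at K W q \<longrightarrow>
          val3 K q A B C = (0, 0, 0)))
     \<and>
     (\<forall>D A B C a' g a b.
        D \<in> O_K \<and> D \<noteq> 0 \<and> odd_in K D \<and>
        A \<in> O_K \<and> B \<in> O_K \<and> C \<in> O_K \<and> a' \<in> O_K \<and>
        a'^2 * A = B + C \<and>
        is_gcd (integers_of K) {B, C} 1 \<and> square_free (integers_of K) A \<and>
        only_primes_dividing K A (2 * D) \<and>
        only_primes_dividing K B (2 * D) \<and>
        only_primes_dividing K C (2 * D) \<and>
        is_gcd (integers_of K) {2, C} g \<and>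
        a = 2 * A * a' / g \<and> b = A * C / g^2
      \<longrightarrow>
        elliptic_curve K (E_ab a b) \<and>
        (\<forall>p\<in>primes_of K. \<not> p divides\<^bsub>integers_of K\<^esub> (2 * D) \<longrightarrow>
          good_reduction K (E_ab a b) p) \<and>
        (\<forall>s\<in>O_K. square_free (integers_of K) s \<and> s divides\<^bsub>integers_of K\<^esub> D \<longrightarrow>
          elliptic_curve K (E_ab (s * a) (s^2 * b)) \<and>
          (\<forall>p\<in>primes_of K. \<not> p divides\<^bsub>integers_of K\<^esub> (2 * D) \<longrightarrow>
            good_reduction K (E_ab (s * a) (s^2 * b)) p)))"
proof -
  obtain d where "quadratic_field K d"
    using imaginary_quadratic_field_imp_locale[OF K(1)] by blast
  then interpret quadratic_pid K d
    using K(2) by (intro quadratic_pid.intro quadratic_pid_axioms.intro)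
  show ?thesis unfolding O_K
  proof (intro conjI[of "All _" "All _"] allI impI)
    fix E N T u r s0 t W xT yT D a b \<tau>\<^sub>a \<tau>\<^sub>b P A s B C a'
    assume *: "elliptic_curve K E \<and>
        T \<in> ec_points E K \<and> ec_has_order E T 2 \<and>
        is_conductor K E N \<and> odd_in K N \<and>
        u \<in> K \<and> r \<in> K \<and> s0 \<in> K \<and> t \<in> K \<and> u \<noteq> 0 \<and>
        W = change_eq u r s0 t E \<and> global_minimal_model K E W \<and>
        change_pt u r s0 t T = EC_pt xT yT \<and>
        D = discr W \<and>
        two_torsion_model K W xT a b \<and>
        generates_part_of_two K (\<lambda>q. q divides\<^bsub>integers_of K\<^esub> a) \<tau>\<^sub>a \<and>
        generates_part_of_two K (\<lambda>q. \<not> q divides\<^bsub>integers_of K\<^esub> a) \<tau>\<^sub>b \<and>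
        \<tau>\<^sub>a * \<tau>\<^sub>b = 2 \<and>
        is_gcd (integers_of K) {D, b, a^2 - 4 * b} P \<and>
        s \<in> \<O> \<and> square_free (integers_of K) A \<and> P = A * s^2 \<and>
        B = (a^2 - 4 * b) / (\<tau>\<^sub>a^2 * P) \<and>
        C = 4 * b / (\<tau>\<^sub>a^2 * P) \<and>
        a' = a * s / (\<tau>\<^sub>a * P)"
    then have E: "elliptic_curve K E" and T: "T \<in> ec_points E K" "ec_has_order E T 2"
      and N: "is_conductor K E N" "odd_in K N"
      and uK: "u \<in> K" "r \<in> K" "s0 \<in> K" "t \<in> K" "u \<noteq> 0" "W = change_eq u r s0 t E"
      and min: "global_minimal_model K E W" and pt: "change_pt u r s0 t T = EC_pt xT yT"
      and D: "D = discr W" and model: "two_torsion_model K W xT a b"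
      by blast+
    from * have data: "generates_part_of_two K (\<lambda>q. q divides\<^bsub>R\<^esub> a) \<tau>\<^sub>a"
      "is_gcd R {discr W, b, a^2 - 4 * b} P" "s \<in> \<O>" "square_free R A" "P = A * s^2"
      "B = (a^2 - 4 * b) / (\<tau>\<^sub>a^2 * P)" "C = 4 * b / (\<tau>\<^sub>a^2 * P)" "a' = a * s / (\<tau>\<^sub>a * P)"
      unfolding D by blast+
    \<comment> \<open>\<open>change_pt\<close> fixes \<open>EC_zero\<close>, so a point with affine
      image is affine.\<close>
    obtain x1 y1 where T_eq: "T = EC_pt x1 y1" using pt by (cases T) auto
    have x1: "x1 \<in> K" "y1 \<in> K"
      and curve: "y1^2 + w1 E * x1 * y1 + w3 E * y1 = x1^3 + w2 E * x1^2 + w4 E * x1 + w6 E"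
      using T(1) by (auto simp: T_eq ec_points_def)
    note WT = two_torsion_change[OF uK(5,6) pt[unfolded T_eq] curve order_two_point[OF T(2)[unfolded T_eq]]]
    have "xT = (x1 - r) / u^2" "yT = (y1 - s0 * (x1 - r) - t) / u^3" using pt by (simp_all add: T_eq)
    then have xT: "xT \<in> K" "yT \<in> K"
      unfolding power2_eq_square power3_eq_cube using x1 uK by (simp_all add: K_divide K_diff K_mult)
    obtain S where S: "generators_above_two K S"
      "pcompose (scale_cubic (\<Prod>\<tau>\<in>S. \<tau> ^ scaling_exponent K W \<tau>) (completed_cubic W))
        [:(\<Prod>\<tau>\<in>S. \<tau> ^ scaling_exponent K W \<tau>) * xT, 1:] = [:0, b, a, 1:]"
      using model unfolding two_torsion_model_def Let_def by blast
    interpret descent_data K d E W u r s0 t xT yT "\<Prod>\<tau>\<in>S. \<tau> ^ scaling_exponent K W \<tau>" a b S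
      \<tau>\<^sub>a P A s B C a'
    proof (intro descent_data.intro minimal_two_torsion.intro quadratic_pid_axioms
        minimal_two_torsion_axioms.intro descent_data_axioms.intro)
      show "discr E \<noteq> 0" using E by (simp add: elliptic_curve_def)
      show "good_reduction K E q" if "q \<in> primes_of K" "q divides\<^bsub>R\<^esub> 2" for q
        using odd_conductor_good_reduction[OF N that] .
    qed (fact uK min xT WT S data refl)+
    show "a'^2 * A = B + C \<and>
        a' \<in> \<O> \<and> A \<in> \<O> \<and> B \<in> \<O> \<and> C \<in> \<O> \<and>
        is_gcd (integers_of K) {B, C} 1 \<and> square_free (integers_of K) A \<and>
        only_primes_dividing K A (2 * D) \<and>
        only_primes_dividing K B (2 * D) \<and>
        only_primes_dividing K C (2 * D) \<and>
        (\<forall>p\<in>primes_of K. p divides\<^bsub>integers_of K\<^esub> D \<longrightarrow>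
          (let k = real_of_int (valuation K p D); k' = k - 6
           in val3 K p A B C \<in>
                {(0, k, 0), (0, k', 0), (0, 0, k / 2), (0, 0, k' / 2), (1, 0, 0)})) \<and>
        (\<forall>q\<in>primes_of K. q divides\<^bsub>integers_of K\<^esub> 2 \<and> ordinary_at K W q \<longrightarrow>
          (let e = real_of_int (ram_index_two K q)
           in val3 K q A B C \<in> {(0, 6 * e, 0), (0, 0, 6 * e)})) \<and>
        (\<forall>q\<in>primes_of K. q divides\<^bsub>integers_of K\<^esub> 2 \<and> supersingular_at K W q \<longrightarrow>
          val3 K q A B C = (0, 0, 0))"
      unfolding D
      by (intro conjI ballI impI relation ABC_O BC_coprime A only_bad_primes bad_triple
          ordinary_at_triple supersingular_at_triple; (elim conjE)?; assumption)
  next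
    fix D A B C a' g a b
    assume *: "D \<in> \<O> \<and> D \<noteq> 0 \<and> odd_in K D \<and>
        A \<in> \<O> \<and> B \<in> \<O> \<and> C \<in> \<O> \<and> a' \<in> \<O> \<and>
        a'^2 * A = B + C \<and>
        is_gcd (integers_of K) {B, C} 1 \<and> square_free (integers_of K) A \<and>
        only_primes_dividing K A (2 * D) \<and>
        only_primes_dividing K B (2 * D) \<and>
        only_primes_dividing K C (2 * D) \<and>
        is_gcd (integers_of K) {2, C} g \<and>
        a = 2 * A * a' / g \<and> b = A * C / g^2"
    then have g: "g \<in> \<O>" "g divides\<^bsub>R\<^esub> 2" by (auto simp: is_gcd_def)
    have ab: "a = 2 * A * a' / g" "b = A * C / g^2" using * by blast+
    have good: "elliptic_curve K (E_ab (s * a) (s^2 * b)) \<and>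
        (\<forall>p\<in>primes_of K. \<not> p divides\<^bsub>R\<^esub> (2 * D) \<longrightarrow> good_reduction K (E_ab (s * a) (s^2 * b)) p)"
      if "s \<in> \<O>" "s divides\<^bsub>R\<^esub> D" for s
      unfolding ab by (rule converse_good_reduction[of D A B C a', OF _ _ _ _ _ _ _ _ _ _ g that]) (use * in blast)+
    \<comment> \<open>The untwisted curve is the twist by s = 1.\<close>
    have "1 divides\<^bsub>R\<^esub> D" using * by (auto simp: divides_R)
    from good[OF O_1 this] good
    show "elliptic_curve K (E_ab a b) \<and>
        (\<forall>p\<in>primes_of K. \<not> p divides\<^bsub>integers_of K\<^esub> (2 * D) \<longrightarrow>
          good_reduction K (E_ab a b) p) \<and>
        (\<forall>s\<in>\<O>. square_free (integers_of K) s \<and> s divides\<^bsub>integers_of K\<^esub> D \<longrightarrow>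
          elliptic_curve K (E_ab (s * a) (s^2 * b)) \<and>
          (\<forall>p\<in>primes_of K. \<not> p divides\<^bsub>integers_of K\<^esub> (2 * D) \<longrightarrow>
            good_reduction K (E_ab (s * a) (s^2 * b)) p))"
      by simp
  qed
qed

end
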